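(* Fix a constant $0<\epsilon<1$. There is a deterministic fully dynamic algorithm which, given a value $\alpha$ and a sequence of edge insertions and deletions applied to an initially empty graph $G$ on a fixed set of $n$ nodes such that the arboricity of $G$ never exceeds $\alpha$, maintains after every update a proper $(\Delta+(4+\epsilon)\alpha)$-edge coloring of $G$, where $\Delta$ is the maximum degree of $G$ throughout the entire update sequence (the algorithm does not need to know $\Delta$). The algorithm has $O(\log n/\epsilon)$ worst-case recourse per update and $O(\log^2 n\log\Delta/\epsilon^2)$ amortized update time.
   Context: A proper $\lambda$-edge coloring assigns each edge a color from $\{1,\dots,\lfloor\lambda\rfloor\}$ so that edges sharing an endpoint have different colors. The arboricity of $G=(V,E)$ is the smallest integer $\alpha$ with $\lceil|E(G[S])|/(|S|-1)\rceil\le\alpha$ for all $S\subseteq V$, $|S|\ge2$. The recourse of an update is the number of edges whose color changes while processing it; worst-case recourse $\lambda$ means every update has recourse at most $\lambda$. Amortized update time $\lambda$ means any sequence of $T$ updates starting from the empty graph is processed in total time $O(T\lambda)$. *)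

theory Defs
  imports Complex_Main
begin

section \<open>Graphs, arboricity and edge colorings\<close>

text \<open>A simple graph on the nodes \<^term>\<open>{..<n}\<close> is given by its set of edges, each edge being a
  two-element set of nodes.\<close>

definition induced_edges :: "nat set set \<Rightarrow> nat set \<Rightarrow> nat set set" where
  "induced_edges E S = {e \<in> E. e \<subseteq> S}"

definition arboricity :: "nat set \<Rightarrow> nat set set \<Rightarrow> nat" where
  "arboricity V E = (LEAST a::nat. \<forall>S \<subseteq> V. 2 \<le> card S \<longrightarrow>
     \<lceil>real (card (induced_edges E S)) / (real (card S) - 1)\<rceil> \<le> int a)"

definition degree :: "nat set set \<Rightarrow> nat \<Rightarrow> nat" where
  "degree E v = card {e \<in> E. v \<in> e}"

definition max_degree :: "nat \<Rightarrow> nat set set \<Rightarrow> nat" where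
  "max_degree n E = Max (insert 0 (degree E ` {..<n}))"

definition proper_edge_coloring :: "real \<Rightarrow> nat set set \<Rightarrow> (nat set \<rightharpoonup> nat) \<Rightarrow> bool" where
  "proper_edge_coloring l E \<chi> \<longleftrightarrow>
     dom \<chi> = E \<and> ran \<chi> \<subseteq> {1..nat \<lfloor>l\<rfloor>} \<and>
     (\<forall>e\<in>E. \<forall>f\<in>E. e \<noteq> f \<and> e \<inter> f \<noteq> {} \<longrightarrow> \<chi> e \<noteq> \<chi> f)"

text \<open>The edge that is inserted or deleted counts as changing its color, since it becomes colored or
  uncolored.\<close>

definition recourse :: "(nat set \<rightharpoonup> nat) \<Rightarrow> (nat set \<rightharpoonup> nat) \<Rightarrow> nat" where
  "recourse \<chi> \<chi>' = card {e. \<chi> e \<noteq> \<chi>' e}"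

section \<open>Update sequences\<close>

datatype update = Insert nat nat | Delete nat nat

fun apply_update :: "update \<Rightarrow> nat set set \<Rightarrow> nat set set" where
  "apply_update (Insert u v) E = insert {u, v} E"
| "apply_update (Delete u v) E = E - {{u, v}}"

fun valid_update :: "nat \<Rightarrow> nat set set \<Rightarrow> update \<Rightarrow> bool" where
  "valid_update n E (Insert u v) \<longleftrightarrow> u < n \<and> v < n \<and> u \<noteq> v \<and> {u, v} \<notin> E"
| "valid_update n E (Delete u v) \<longleftrightarrow> u < n \<and> v < n \<and> u \<noteq> v \<and> {u, v} \<in> E"

definition graph_after :: "update list \<Rightarrow> nat \<Rightarrow> nat set set" where
  "graph_after us i = fold apply_update (take i us) {}"

definition valid_updates :: "nat \<Rightarrow> nat \<Rightarrow> update list \<Rightarrow> bool" where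
  "valid_updates n \<alpha> us \<longleftrightarrow>
     (\<forall>i < length us. valid_update n (graph_after us i) (us ! i)) \<and>
     (\<forall>i \<le> length us. arboricity {..<n} (graph_after us i) \<le> \<alpha>)"

definition overall_max_degree :: "nat \<Rightarrow> update list \<Rightarrow> nat" where
  "overall_max_degree n us = (MAX i\<in>{..length us}. max_degree n (graph_after us i))"

section \<open>Computational model: a structured word RAM\<close>

text \<open>A program accesses finitely many arrays, named by program constants; every array is a random
  access memory indexed by words. This is a word RAM whose memory is split into interleaved
  segments. A word is a natural number below \<open>W\<close>; an operation whose result is not a word faults,
  so that evaluation has no result. Subtraction is truncated, and comparisons yield 0 or 1.\<close>

type_synonym memory = "nat \<Rightarrow> nat \<Rightarrow> nat"

datatype binop = Plus | Minus | Times | Quotient | Less | Equal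

fun apply_binop :: "binop \<Rightarrow> nat \<Rightarrow> nat \<Rightarrow> nat" where
  "apply_binop Plus x y = x + y"
| "apply_binop Minus x y = x - y"
| "apply_binop Times x y = x * y"
| "apply_binop Quotient x y = x div y"
| "apply_binop Less x y = (if x < y then 1 else 0)"
| "apply_binop Equal x y = (if x = y then 1 else 0)"

datatype expr = Const nat | Read nat expr | Binop binop expr expr

definition as_word :: "nat \<Rightarrow> nat \<Rightarrow> nat option" where
  "as_word W x = (if x < W then Some x else None)"

fun eval :: "nat \<Rightarrow> memory \<Rightarrow> expr \<Rightarrow> nat option" where
  "eval W M (Const k) = as_word W k"
| "eval W M (Read a e) = Option.bind (eval W M e) (\<lambda>i. as_word W (M a i))"
| "eval W M (Binop f e1 e2) =
     Option.bind (eval W M e1) (\<lambda>x. Option.bind (eval W M e2) (\<lambda>y. as_word W (apply_binop f x y)))"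

fun expr_cost :: "expr \<Rightarrow> nat" where
  "expr_cost (Const k) = 1"
| "expr_cost (Read a e) = 1 + expr_cost e"
| "expr_cost (Binop f e1 e2) = 1 + expr_cost e1 + expr_cost e2"

datatype com =
    Skip
  | Write nat expr expr
  | Seq com com
  | If expr com com
  | While expr com

text \<open>\<open>exec W c M t M'\<close>: started in memory \<open>M\<close>, the command \<open>c\<close> terminates without fault in
  memory \<open>M'\<close> after time \<open>t\<close>, where every basic operation takes unit time.\<close>

inductive exec :: "nat \<Rightarrow> com \<Rightarrow> memory \<Rightarrow> nat \<Rightarrow> memory \<Rightarrow> bool" for W :: nat where
  Skip: "exec W Skip M 1 M"
| Write: "eval W M e1 = Some i \<Longrightarrow> eval W M e2 = Some x \<Longrightarrow>
    exec W (Write a e1 e2) M (1 + expr_cost e1 + expr_cost e2) (M(a := (M a)(i := x)))"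
| Seq: "exec W c1 M t1 M1 \<Longrightarrow> exec W c2 M1 t2 M2 \<Longrightarrow> exec W (Seq c1 c2) M (t1 + t2) M2"
| If_true: "eval W M b = Some x \<Longrightarrow> x \<noteq> 0 \<Longrightarrow> exec W c1 M t M' \<Longrightarrow>
    exec W (If b c1 c2) M (1 + expr_cost b + t) M'"
| If_false: "eval W M b = Some 0 \<Longrightarrow> exec W c2 M t M' \<Longrightarrow>
    exec W (If b c1 c2) M (1 + expr_cost b + t) M'"
| While_false: "eval W M b = Some 0 \<Longrightarrow> exec W (While b c) M (1 + expr_cost b) M"
| While_true: "eval W M b = Some x \<Longrightarrow> x \<noteq> 0 \<Longrightarrow> exec W c M t1 M1 \<Longrightarrow>
    exec W (While b c) M1 t2 M2 \<Longrightarrow> exec W (While b c) M (1 + expr_cost b + t1 + t2) M2"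

inductive_cases SkipE: "exec W Skip M t M'"
  and WriteE: "exec W (Write a e1 e2) M t M'"
  and SeqE: "exec W (Seq c1 c2) M t M'"
  and IfE: "exec W (If b c1 c2) M t M'"
  and WhileE: "exec W (While b c) M t M'"

lemma exec_deterministic:
  "exec W c M t M' \<Longrightarrow> exec W c M s M'' \<Longrightarrow> s = t \<and> M'' = M'"
proof (induction arbitrary: s M'' rule: exec.induct)
  case (Skip M)
  then show ?case by (rule SkipE) simp
next
  case (Write M e1 i e2 x a)
  from Write.prems show ?case
    by (rule WriteE) (simp add: Write.hyps)
next
  case (Seq c1 M t1 M1 c2 t2 M2)
  from Seq.prems show ?case
    by (rule SeqE) (use Seq.IH in blast)
next
  case (If_true M b x c1 t M' c2)
  from If_true.prems show ?case
    by (rule IfE) (use If_true.hyps in \<open>auto dest: If_true.IH\<close>)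
next
  case (If_false M b c2 t M' c1)
  from If_false.prems show ?case
    by (rule IfE) (use If_false.hyps in \<open>auto dest: If_false.IH\<close>)
next
  case (While_false M b c)
  from While_false.prems show ?case
    by (rule WhileE) (simp_all add: While_false.hyps)
next
  case (While_true M b x c t1 M1 t2 M2)
  from While_true.prems show ?case
  proof (rule WhileE)
    assume "eval W M b = Some 0"
    with While_true.hyps show ?thesis by simp
  next
    fix y s1 N s2
    assume s: "s = Suc (expr_cost b + s1 + s2)" and c: "exec W c M s1 N"
      and w: "exec W (While b c) N s2 M''"
    from While_true.IH(1)[OF c] have 1: "s1 = t1" "N = M1" by blast+
    with w have "exec W (While b c) M1 s2 M''" by simp
    from While_true.IH(2)[OF this] 1 s show ?thesis by simp
  qed
qed

section \<open>Dynamic algorithms\<close>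

text \<open>A dynamic algorithm is a program that is run once for every update on the persistent memory.
  Array 0 serves as input: cells 0 and 1 initially hold \<open>n\<close> and \<open>\<alpha>\<close>, all other memory is 0, and
  the current update is placed in cells 2 to 4. There is no uncounted preprocessing. Array 1 serves
  as output: it is the table of edge colors, with the color of \<open>{u, v}\<close>, \<open>u < v\<close>, in cell
  \<open>u * n + v\<close>.\<close>

definition initial_memory :: "nat \<Rightarrow> nat \<Rightarrow> memory" where
  "initial_memory n \<alpha> = (\<lambda>_ _. 0)(0 := (\<lambda>_. 0)(0 := n, 1 := \<alpha>))"

fun input_update :: "update \<Rightarrow> memory \<Rightarrow> memory" where
  "input_update (Insert u v) M = M(0 := (M 0)(2 := 1, 3 := u, 4 := v))"
| "input_update (Delete u v) M = M(0 := (M 0)(2 := 0, 3 := u, 4 := v))"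

definition stored_coloring :: "nat \<Rightarrow> nat set set \<Rightarrow> memory \<Rightarrow> (nat set \<rightharpoonup> nat)" where
  "stored_coloring n E M = (\<lambda>e. if e \<in> E then Some (M 1 (Min e * n + Max e)) else None)"

text \<open>\<open>M i\<close> is the memory after \<open>i\<close> updates, \<open>t i\<close> the time spent on the update \<open>us ! i\<close>.\<close>

definition is_run ::
  "nat \<Rightarrow> com \<Rightarrow> nat \<Rightarrow> nat \<Rightarrow> update list \<Rightarrow> (nat \<Rightarrow> memory) \<Rightarrow> (nat \<Rightarrow> nat) \<Rightarrow> bool" where
  "is_run W p n \<alpha> us M t \<longleftrightarrow>
     M 0 = initial_memory n \<alpha> \<and>
     (\<forall>i < length us. exec W p (input_update (us ! i) (M i)) (t i) (M (Suc i)))"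

end

theory Submission
  imports Defs
begin

text \<open>Every node has a level below \<open>L = O(log n / \<epsilon>)\<close>. A node with more than about \<open>(4 + \<epsilon>) \<alpha>\<close>
  neighbors on its own level or above is moved up; a node with fewer than about \<open>(2 + \<epsilon>) \<alpha>\<close>
  neighbors on the level below its own or higher is moved down. The second rule makes the number of
  nodes above a level decrease geometrically, because the arboricity bounds the average degree by
  \<open>2 \<alpha>\<close>. The gap of a factor of 2 between the two thresholds lets a potential function pay for all
  moves.

  An edge \<open>xy\<close> whose lower endpoint is \<open>x\<close> receives the first color that is missing at \<open>y\<close> and at the
  edges from \<open>x\<close> to nodes that are not below \<open>x\<close>. At most one other edge \<open>xz\<close> has this color; it is
  uncolored and treated in the same way. As \<open>z\<close> is on a smaller level than \<open>x\<close>, this stops after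
  \<open>L\<close> steps. Counting trees over the colors of every node and level support the search for the
  color in logarithmic time, and they also serve as adjacency lists.\<close>

section \<open>Graphs and levels\<close>

definition graph_on :: "nat \<Rightarrow> nat set set \<Rightarrow> bool" where
  "graph_on n E \<longleftrightarrow> (\<forall>e\<in>E. \<exists>u v. e = {u, v} \<and> u < n \<and> v < n \<and> u \<noteq> v)"

definition neighbors :: "nat set set \<Rightarrow> nat \<Rightarrow> nat set" where
  "neighbors E v = {w. {v, w} \<in> E}"

definition deg_above :: "nat set set \<Rightarrow> (nat \<Rightarrow> nat) \<Rightarrow> nat \<Rightarrow> nat \<Rightarrow> nat" where
  "deg_above E l v i = card {w \<in> neighbors E v. i \<le> l w}"

definition nodes_above :: "nat \<Rightarrow> (nat \<Rightarrow> nat) \<Rightarrow> nat \<Rightarrow> nat set" where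
  "nodes_above n l i = {v. v < n \<and> i \<le> l v}"

lemma neighbors_sym: "w \<in> neighbors E v \<longleftrightarrow> v \<in> neighbors E w"
  by (simp add: neighbors_def insert_commute)

lemma graph_on_neighbors: "graph_on n E \<Longrightarrow> w \<in> neighbors E v \<Longrightarrow> v < n \<and> w < n \<and> v \<noteq> w"
  unfolding graph_on_def neighbors_def by (fastforce simp: doubleton_eq_iff)

lemma not_in_neighbors: "graph_on n E \<Longrightarrow> v \<notin> neighbors E v"
  using graph_on_neighbors by blast

lemma finite_neighbors: "graph_on n E \<Longrightarrow> finite (neighbors E v)"
  by (rule finite_subset[of _ "{..<n}"]) (auto dest: graph_on_neighbors)

lemma finite_graph_on: "graph_on n E \<Longrightarrow> finite E"
  by (rule finite_subset[of _ "Pow {..<n}"]) (force simp: graph_on_def)+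

lemma card_graph_on:
  assumes "graph_on n E"
  shows "card E \<le> n * n"
proof -
  have "E \<subseteq> (\<lambda>(u, v). {u, v}) ` ({..<n} \<times> {..<n})"
  proof
    fix e assume "e \<in> E"
    then obtain u v where "e = {u, v}" "u < n" "v < n" using assms unfolding graph_on_def by blast
    then show "e \<in> (\<lambda>(u, v). {u, v}) ` ({..<n} \<times> {..<n})" by (intro image_eqI[of _ _ "(u, v)"]) auto
  qed
  then have "card E \<le> card ({..<n} \<times> {..<n})" by (rule surj_card_le[rotated]) simp
  then show ?thesis by simp
qed

lemma card_neighbors_less:
  assumes "graph_on n E" "v < n"
  shows "card (neighbors E v) < n"
proof -
  have "neighbors E v \<subseteq> {..<n} - {v}" using assms(1) graph_on_neighbors by blast
  then have "card (neighbors E v) \<le> card ({..<n} - {v})" by (intro card_mono) auto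
  then show ?thesis using assms(2) by simp
qed

lemma bij_betw_neighbors_edges:
  assumes "graph_on n E"
  shows "bij_betw (\<lambda>w. {v, w}) (neighbors E v) {e \<in> E. v \<in> e}"
  unfolding bij_betw_def
proof
  show "inj_on (\<lambda>w. {v, w}) (neighbors E v)" by (auto simp: inj_on_def doubleton_eq_iff)
  show "(\<lambda>w. {v, w}) ` neighbors E v = {e \<in> E. v \<in> e}"
    using assms unfolding graph_on_def neighbors_def
    by (auto simp: image_iff) (metis insertE insert_commute singletonD)
qed

lemma degree_eq_card_neighbors: "graph_on n E \<Longrightarrow> degree E v = card (neighbors E v)"
  unfolding degree_def by (rule bij_betw_same_card[OF bij_betw_neighbors_edges, symmetric])

lemma sum_edges_split:
  fixes f :: "nat set \<Rightarrow> nat"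
  assumes g: "graph_on n E"
  shows "(\<Sum>e\<in>E. f e) = (\<Sum>e\<in>{e \<in> E. v \<notin> e}. f e) + (\<Sum>w\<in>neighbors E v. f {v, w})"
proof -
  have "(\<Sum>e\<in>E. f e) = (\<Sum>e\<in>{e \<in> E. v \<notin> e} \<union> {e \<in> E. v \<in> e}. f e)"
    by (rule sum.cong) auto
  also have "\<dots> = (\<Sum>e\<in>{e \<in> E. v \<notin> e}. f e) + (\<Sum>e\<in>{e \<in> E. v \<in> e}. f e)"
    using finite_graph_on[OF g] by (intro sum.union_disjoint) auto
  also have "(\<Sum>e\<in>{e \<in> E. v \<in> e}. f e) = (\<Sum>w\<in>neighbors E v. f {v, w})"
    by (rule sum.reindex_bij_betw[OF bij_betw_neighbors_edges[OF g], symmetric])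
  finally show ?thesis .
qed

lemma deg_above_le_card_neighbors: "graph_on n E \<Longrightarrow> deg_above E l v i \<le> card (neighbors E v)"
  unfolding deg_above_def by (rule card_mono) (auto simp: finite_neighbors)

lemma deg_above_less: "graph_on n E \<Longrightarrow> v < n \<Longrightarrow> deg_above E l v i < n"
  using deg_above_le_card_neighbors card_neighbors_less le_less_trans by blast

lemma deg_above_antimono: "graph_on n E \<Longrightarrow> i \<le> k \<Longrightarrow> deg_above E l v k \<le> deg_above E l v i"
  unfolding deg_above_def by (rule card_mono) (auto intro: finite_subset[OF _ finite_neighbors])

lemma deg_above_raise:
  assumes g: "graph_on n E"
  shows "deg_above E (l(v := Suc (l v))) x k =
    deg_above E l x k + (if v \<in> neighbors E x \<and> k = Suc (l v) then 1 else 0)"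
proof (cases "v \<in> neighbors E x \<and> k = Suc (l v)")
  case True
  then have "{w \<in> neighbors E x. k \<le> (l(v := Suc (l v))) w} =
      insert v {w \<in> neighbors E x. k \<le> l w}"
    and "v \<notin> {w \<in> neighbors E x. k \<le> l w}" by auto
  then show ?thesis using True finite_neighbors[OF g] by (simp add: deg_above_def)
next
  case False
  then have "{w \<in> neighbors E x. k \<le> (l(v := Suc (l v))) w} = {w \<in> neighbors E x. k \<le> l w}" by auto
  then show ?thesis unfolding deg_above_def if_not_P[OF False] by simp
qed

lemma deg_above_lower:
  assumes g: "graph_on n E" and pos: "0 < l v"
  shows "deg_above E l x k =
    deg_above E (l(v := l v - 1)) x k + (if v \<in> neighbors E x \<and> k = l v then 1 else 0)"
  using deg_above_raise[OF g, of "l(v := l v - 1)" v x k] pos by simp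

lemma deg_above_insert_edge:
  assumes g: "graph_on n (insert e E)"
  shows "deg_above E l x k \<le> deg_above (insert e E) l x k"
    and "deg_above (insert e E) l x k \<le> deg_above E l x k + (if x \<in> e then 1 else 0)"
proof -
  have g': "graph_on n E" using g by (simp add: graph_on_def)
  show "deg_above E l x k \<le> deg_above (insert e E) l x k"
    unfolding deg_above_def
    using finite_neighbors[OF g, of x] by (intro card_mono) (auto simp: neighbors_def)
  show "deg_above (insert e E) l x k \<le> deg_above E l x k + (if x \<in> e then 1 else 0)"
  proof (cases "\<exists>w. e = {x, w}")
    case True
    then obtain w where w: "e = {x, w}" by blast
    have "{w \<in> neighbors (insert e E) x. k \<le> l w} \<subseteq> insert w {w \<in> neighbors E x. k \<le> l w}"
      by (auto simp: neighbors_def w doubleton_eq_iff)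
    then have "deg_above (insert e E) l x k \<le> card (insert w {w \<in> neighbors E x. k \<le> l w})"
      unfolding deg_above_def using finite_neighbors[OF g'] by (intro card_mono) auto
    also have "\<dots> \<le> deg_above E l x k + 1"
      unfolding deg_above_def using finite_neighbors[OF g'] by (simp add: card_insert_if)
    finally show ?thesis using w by simp
  next
    case False
    then have "neighbors (insert e E) x = neighbors E x" by (auto simp: neighbors_def)
    then show ?thesis by (simp add: deg_above_def)
  qed
qed

section \<open>Sparsity bounds the levels\<close>

lemma card_induced_edges_le_arboricity:
  assumes "finite E" "S \<subseteq> V" "2 \<le> card S"
  shows "card (induced_edges E S) \<le> arboricity V E * (card S - 1)"
proof -
  let ?sparse = "\<lambda>a::nat. \<forall>S \<subseteq> V. 2 \<le> card S \<longrightarrow>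
     \<lceil>real (card (induced_edges E S)) / (real (card S) - 1)\<rceil> \<le> int a"
  have "?sparse (card E)"
  proof (intro allI impI)
    fix S :: "nat set" assume S: "2 \<le> card S"
    have "card (induced_edges E S) \<le> card E"
      unfolding induced_edges_def by (rule card_mono) (use assms(1) in auto)
    then have "real (card (induced_edges E S)) \<le> real (card E) * 1" by simp
    also have "\<dots> \<le> real (card E) * (real (card S) - 1)" using S by (intro mult_left_mono) auto
    finally show "\<lceil>real (card (induced_edges E S)) / (real (card S) - 1)\<rceil> \<le> int (card E)"
      using S by (simp add: ceiling_le_iff divide_le_eq)
  qed
  then have "?sparse (arboricity V E)" unfolding arboricity_def by (rule LeastI)
  then have "real (card (induced_edges E S)) \<le> real (arboricity V E) * (real (card S) - 1)"
    using assms(2,3) by (auto simp: ceiling_le_iff divide_le_eq)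
  also have "real (card S) - 1 = real (card S - 1)" using assms(3) by simp
  finally show ?thesis by (metis of_nat_le_iff of_nat_mult)
qed

lemma induced_edges_small:
  assumes "graph_on n E" "finite S" "card S < 2"
  shows "induced_edges E S = {}"
proof (rule ccontr)
  assume "induced_edges E S \<noteq> {}"
  then obtain e where "e \<in> E" "e \<subseteq> S" by (auto simp: induced_edges_def)
  then obtain u v where "{u, v} \<subseteq> S" "u \<noteq> v" using assms(1) by (auto simp: graph_on_def)
  then have "card {u, v} \<le> card S" using assms(2) card_mono by blast
  then show False using \<open>u \<noteq> v\<close> assms(3) by simp
qed

lemma card_induced_edges_le:
  assumes g: "graph_on n E" and a: "arboricity {..<n} E \<le> \<alpha>" and S: "S \<subseteq> {..<n}"
  shows "card (induced_edges E S) \<le> \<alpha> * card S"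
proof (cases "2 \<le> card S")
  case True
  have "card (induced_edges E S) \<le> arboricity {..<n} E * (card S - 1)"
    by (rule card_induced_edges_le_arboricity[OF finite_graph_on[OF g] S True])
  also have "\<dots> \<le> \<alpha> * card S" using a by (intro mult_mono) auto
  finally show ?thesis .
next
  case False
  then show ?thesis using induced_edges_small[OF g finite_subset[OF S]] by simp
qed

lemma sum_card_neighbors_le:
  assumes g: "graph_on n E" and XY: "X \<subseteq> Y" and fin: "finite Y"
  shows "(\<Sum>v\<in>X. card (neighbors E v \<inter> Y)) \<le> 2 * card (induced_edges E Y)"
proof -
  let ?I = "induced_edges E Y"
  have gI: "graph_on n ?I" using g by (auto simp: graph_on_def induced_edges_def)
  have inner: "card (neighbors E v \<inter> Y) = card {e \<in> ?I. v \<in> e}" if "v \<in> Y" for v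
  proof -
    have "neighbors E v \<inter> Y = neighbors ?I v" using that by (auto simp: neighbors_def induced_edges_def)
    then show ?thesis using bij_betw_same_card[OF bij_betw_neighbors_edges[OF gI]] by metis
  qed
  have "(\<Sum>v\<in>X. card (neighbors E v \<inter> Y)) \<le> (\<Sum>v\<in>Y. card (neighbors E v \<inter> Y))"
    by (rule sum_mono2) (use fin XY in auto)
  also have "\<dots> = (\<Sum>v\<in>Y. card {e \<in> ?I. v \<in> e})" using inner by simp
  also have "\<dots> = 2 * card ?I"
  proof (rule sum_multicount[OF fin finite_graph_on[OF gI]], intro ballI)
    fix e assume e: "e \<in> ?I"
    then obtain u v where "e = {u, v}" "u \<noteq> v" using gI by (auto simp: graph_on_def)
    moreover have "{i \<in> Y. i \<in> e} = e" using e by (auto simp: induced_edges_def)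
    ultimately show "card {i \<in> Y. i \<in> e} = 2" by simp
  qed
  finally show ?thesis .
qed

lemma card_nodes_above_Suc:
  assumes g: "graph_on n E" and a: "arboricity {..<n} E \<le> \<alpha>" "1 \<le> \<alpha>"
    and deg: "\<And>v. v < n \<Longrightarrow> 0 < l v \<Longrightarrow> (2 * N + 1) * \<alpha> \<le> N * deg_above E l v (l v - 1)"
  shows "(2 * N + 1) * card (nodes_above n l (Suc i)) \<le> 2 * N * card (nodes_above n l i)"
proof -
  let ?Z = "nodes_above n l"
  have "(2 * N + 1) * \<alpha> \<le> N * card (neighbors E v \<inter> ?Z i)" if "v \<in> ?Z (Suc i)" for v
  proof -
    have v: "v < n" "Suc i \<le> l v" using that by (auto simp: nodes_above_def)
    have "(2 * N + 1) * \<alpha> \<le> N * deg_above E l v (l v - 1)" using deg v by simp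
    also have "\<dots> \<le> N * deg_above E l v i"
      using v by (intro mult_left_mono deg_above_antimono[OF g]) auto
    also have "{w \<in> neighbors E v. i \<le> l w} = neighbors E v \<inter> ?Z i"
      using graph_on_neighbors[OF g] by (auto simp: nodes_above_def)
    then have "deg_above E l v i = card (neighbors E v \<inter> ?Z i)" by (simp add: deg_above_def)
    finally show ?thesis .
  qed
  then have "card (?Z (Suc i)) * ((2 * N + 1) * \<alpha>) \<le> (\<Sum>v\<in>?Z (Suc i). N * card (neighbors E v \<inter> ?Z i))"
    using sum_bounded_below[of "?Z (Suc i)" "(2 * N + 1) * \<alpha>"] by simp
  also have "\<dots> \<le> N * (2 * card (induced_edges E (?Z i)))"
    unfolding sum_distrib_left[symmetric]
    by (intro mult_left_mono sum_card_neighbors_le[OF g]) (auto simp: nodes_above_def)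
  also have "\<dots> \<le> N * (2 * (\<alpha> * card (?Z i)))"
    by (intro mult_left_mono card_induced_edges_le[OF g a(1)]) (auto simp: nodes_above_def)
  finally have "\<alpha> * ((2 * N + 1) * card (?Z (Suc i))) \<le> \<alpha> * (2 * N * card (?Z i))"
    by (simp add: algebra_simps)
  then show ?thesis using a(2) by simp
qed

lemma geometric_decay:
  fixes f :: "nat \<Rightarrow> nat"
  assumes "\<And>i. b * f (Suc i) \<le> a * f i"
  shows "b ^ i * f i \<le> a ^ i * f 0"
proof (induction i)
  case (Suc i)
  have "b ^ Suc i * f (Suc i) = b ^ i * (b * f (Suc i))" by (simp add: algebra_simps)
  also have "\<dots> \<le> b ^ i * (a * f i)" by (intro mult_left_mono assms) simp
  also have "\<dots> = a * (b ^ i * f i)" by simp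
  also have "\<dots> \<le> a * (a ^ i * f 0)" by (intro mult_left_mono Suc.IH) simp
  finally show ?case by (simp add: algebra_simps)
qed simp

lemma two_times_power_le: "2 * m ^ m \<le> (m + 1) ^ m" if "1 \<le> m" for m :: nat
proof -
  have "real m * (1 / real m) = 1" using that by simp
  then have "2 \<le> (1 + 1 / real m) ^ m"
    using Bernoulli_inequality[of "1 / real m" m] order_trans[of "-1" 0 "1 / real m"] by simp
  also have "1 + 1 / real m = real (m + 1) / real m" using that by (simp add: field_simps)
  finally have "2 * real m ^ m \<le> real (m + 1) ^ m"
    using that by (simp add: power_divide pos_le_divide_eq del: of_nat_add)
  then have "real (2 * m ^ m) \<le> real ((m + 1) ^ m)" by simp
  then show ?thesis by (simp only: of_nat_le_iff)
qed

lemma level_bound: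
  assumes g: "graph_on n E" and a: "arboricity {..<n} E \<le> \<alpha>" "1 \<le> \<alpha>" and N: "1 \<le> N"
    and H: "n < 2 ^ H"
    and deg: "\<And>v. v < n \<Longrightarrow> 0 < l v \<Longrightarrow> (2 * N + 1) * \<alpha> \<le> N * deg_above E l v (l v - 1)"
    and v: "v < n"
  shows "l v < 2 * N * H"
proof -
  let ?Z = "nodes_above n l" and ?m = "2 * N" and ?i = "2 * N * H"
  have "2 ^ H * ?m ^ ?i = (2 * ?m ^ ?m) ^ H" by (simp only: power_mult_distrib power_mult[of _ ?m H])
  also have "\<dots> \<le> ((?m + 1) ^ ?m) ^ H" using N by (intro power_mono two_times_power_le) auto
  also have "\<dots> = (?m + 1) ^ ?i" by (simp only: power_mult[of _ ?m H])
  finally have "2 ^ H * ?m ^ ?i * card (?Z ?i) \<le> (?m + 1) ^ ?i * card (?Z ?i)"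
    by (rule mult_right_mono) simp
  also have "\<dots> \<le> ?m ^ ?i * card (?Z 0)"
    by (rule geometric_decay[where f = "\<lambda>i. card (?Z i)", OF card_nodes_above_Suc[OF g a deg]])
  finally have "?m ^ ?i * (2 ^ H * card (?Z ?i)) \<le> ?m ^ ?i * n"
    by (simp add: nodes_above_def algebra_simps)
  then have "2 ^ H * card (?Z ?i) \<le> n" using N by simp
  then have "\<not> 1 \<le> card (?Z ?i)"
    using H mult_left_mono[of 1 "card (?Z ?i)" "2 ^ H"] by linarith
  moreover have "finite (?Z ?i)" by (simp add: nodes_above_def)
  ultimately have "?Z ?i = {}" by (simp add: not_le)
  then have "v \<notin> ?Z ?i" by blast
  then show ?thesis using v by (simp add: nodes_above_def)
qed

section \<open>The potential of a level assignment\<close>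

definition edge_pot :: "nat \<Rightarrow> (nat \<Rightarrow> nat) \<Rightarrow> nat set \<Rightarrow> nat" where
  "edge_pot L l e = 4 * (L - Min (l ` e)) + (if Min (l ` e) = Max (l ` e) then 2 else 0)"

definition node_pot :: "nat \<Rightarrow> nat \<Rightarrow> nat set set \<Rightarrow> (nat \<Rightarrow> nat) \<Rightarrow> nat \<Rightarrow> nat" where
  "node_pot N \<alpha> E l v = (\<Sum>k<l v. (2 * N + 1) ^ 2 * \<alpha> - N ^ 2 * deg_above E l v k)"

text \<open>With \<open>1 / N\<close> in the role of \<open>\<epsilon>\<close> up to a constant, everything is scaled to be integral. Raising
  a node is paid by its edges, each of which releases at least 2; lowering a node is paid by the top
  summand of its own \<^const>\<open>node_pot\<close>. The truncated subtraction makes this summand vanish for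
  nodes that are raised.\<close>

definition potential :: "nat \<Rightarrow> nat \<Rightarrow> nat \<Rightarrow> nat \<Rightarrow> nat set set \<Rightarrow> (nat \<Rightarrow> nat) \<Rightarrow> nat" where
  "potential n \<alpha> N L E l = N * (\<Sum>e\<in>E. edge_pot L l e) + 5 * (\<Sum>v<n. node_pot N \<alpha> E l v)"

lemma edge_pot_pair:
  "edge_pot L l {u, v} = 4 * (L - min (l u) (l v)) + (if l u = l v then 2 else 0)"
  by (auto simp: edge_pot_def min_def max_def)

lemma edge_pot_le: "edge_pot L l e \<le> 4 * L + 2"
  by (auto simp: edge_pot_def intro: diff_le_self trans_le_add1)

lemma edge_pot_upd_other: "v \<notin> e \<Longrightarrow> edge_pot L (l(v := i)) e = edge_pot L l e"
proof -
  assume "v \<notin> e"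
  then have "l(v := i) ` e = l ` e" by (auto simp: image_iff)
  then show ?thesis by (simp add: edge_pot_def)
qed

lemma sum_edge_pot_split:
  assumes "graph_on n E"
  shows "(\<Sum>e\<in>E. edge_pot L (l(v := i)) e) =
    (\<Sum>e\<in>{e \<in> E. v \<notin> e}. edge_pot L l e) + (\<Sum>w\<in>neighbors E v. edge_pot L (l(v := i)) {v, w})"
  unfolding sum_edges_split[OF assms, of _ v] by (simp add: edge_pot_upd_other)

lemma sum_if_level_ge:
  fixes a :: nat
  assumes "graph_on n E"
  shows "(\<Sum>w\<in>neighbors E v. if i \<le> l w then a else 0) = a * deg_above E l v i"
  using finite_neighbors[OF assms] by (simp add: deg_above_def sum.If_cases Int_def)

lemma sum_edge_pot_raise:
  assumes g: "graph_on n E" and v: "l v < L"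
  shows "(\<Sum>e\<in>E. edge_pot L (l(v := Suc (l v))) e) + 2 * deg_above E l v (l v)
    \<le> (\<Sum>e\<in>E. edge_pot L l e)"
proof -
  let ?l = "l(v := Suc (l v))"
  have "(\<Sum>w\<in>neighbors E v. edge_pot L ?l {v, w}) + 2 * deg_above E l v (l v) =
      (\<Sum>w\<in>neighbors E v. edge_pot L ?l {v, w} + (if l v \<le> l w then 2 else 0))"
    by (simp add: sum.distrib sum_if_level_ge[OF g])
  also have "\<dots> \<le> (\<Sum>w\<in>neighbors E v. edge_pot L l {v, w})"
  proof (rule sum_mono)
    fix w assume "w \<in> neighbors E v"
    then have "w \<noteq> v" using not_in_neighbors[OF g] by blast
    then show "edge_pot L ?l {v, w} + (if l v \<le> l w then 2 else 0) \<le> edge_pot L l {v, w}"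
      using v by (simp add: edge_pot_pair min_def) arith
  qed
  finally show ?thesis
    using sum_edge_pot_split[OF g, of L l v] sum_edge_pot_split[OF g, of L l v "l v"] by simp
qed

lemma node_pot_raise:
  assumes g: "graph_on n E" and N: "1 \<le> N" and high: "(4 * N + 5) * \<alpha> < N * deg_above E l v (l v)"
  shows "node_pot N \<alpha> E (l(v := Suc (l v))) x \<le> node_pot N \<alpha> E l x"
proof (cases "x = v")
  case True
  have "(2 * N + 1) ^ 2 * \<alpha> \<le> N * ((4 * N + 5) * \<alpha>)"
    using N by (simp add: power2_eq_square algebra_simps)
  also have "\<dots> \<le> N * (N * deg_above E l v (l v))" using high by (intro mult_left_mono) auto
  finally have "(2 * N + 1) ^ 2 * \<alpha> - N ^ 2 * deg_above E l v (l v) = 0" by (simp add: power2_eq_square)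
  then show ?thesis
    using True not_in_neighbors[OF g] by (simp add: node_pot_def deg_above_raise[OF g])
next
  case False
  then show ?thesis unfolding node_pot_def deg_above_raise[OF g]
    by (auto intro!: sum_mono diff_le_mono2)
qed

lemma potential_raise:
  assumes g: "graph_on n E" and v: "l v < L" and N: "1 \<le> N"
    and high: "(4 * N + 5) * \<alpha> < N * deg_above E l v (l v)"
  shows "potential n \<alpha> N L E (l(v := Suc (l v))) + N * (deg_above E l v (l v) + 1)
    \<le> potential n \<alpha> N L E l"
proof -
  let ?l = "l(v := Suc (l v))" and ?d = "deg_above E l v (l v)"
  have "(\<Sum>x<n. node_pot N \<alpha> E ?l x) \<le> (\<Sum>x<n. node_pot N \<alpha> E l x)"
    by (intro sum_mono node_pot_raise[OF g N high])
  moreover have "N * (\<Sum>e\<in>E. edge_pot L ?l e) + N * (2 * ?d) \<le> N * (\<Sum>e\<in>E. edge_pot L l e)"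
    using sum_edge_pot_raise[where l = l and v = v, OF g v] by (metis distrib_left mult_le_mono2)
  moreover have "?d \<noteq> 0" using high by (intro notI) simp
  then have "N * (?d + 1) \<le> N * (2 * ?d)" by (intro mult_left_mono) auto
  ultimately show ?thesis unfolding potential_def by linarith
qed

lemma sum_edge_pot_lower:
  assumes g: "graph_on n E" and v: "0 < l v" "l v \<le> L"
  shows "(\<Sum>e\<in>E. edge_pot L (l(v := l v - 1)) e)
    \<le> (\<Sum>e\<in>E. edge_pot L l e) + 4 * deg_above E l v (l v - 1)"
proof -
  let ?l = "l(v := l v - 1)"
  have "(\<Sum>w\<in>neighbors E v. edge_pot L ?l {v, w}) \<le>
      (\<Sum>w\<in>neighbors E v. edge_pot L l {v, w} + (if l v - 1 \<le> l w then 4 else 0))"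
  proof (rule sum_mono)
    fix w assume "w \<in> neighbors E v"
    then have "w \<noteq> v" using not_in_neighbors[OF g] by blast
    then show "edge_pot L ?l {v, w} \<le> edge_pot L l {v, w} + (if l v - 1 \<le> l w then 4 else 0)"
      using v by (simp add: edge_pot_pair min_def) arith
  qed
  also have "\<dots> = (\<Sum>w\<in>neighbors E v. edge_pot L l {v, w}) + 4 * deg_above E l v (l v - 1)"
    by (simp add: sum.distrib sum_if_level_ge[OF g])
  finally show ?thesis
    using sum_edge_pot_split[OF g, of L l v] sum_edge_pot_split[OF g, of L l v "l v"] by simp
qed

lemma node_pot_lower_other:
  assumes g: "graph_on n E" and v: "0 < l v" and x: "x \<noteq> v"
  shows "node_pot N \<alpha> E (l(v := l v - 1)) x
    \<le> node_pot N \<alpha> E l x + (if x \<in> neighbors E v \<and> l v < l x then N ^ 2 else 0)"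
proof -
  have "node_pot N \<alpha> E (l(v := l v - 1)) x \<le> (\<Sum>k<l x.
      ((2 * N + 1) ^ 2 * \<alpha> - N ^ 2 * deg_above E l x k) +
      (if k = l v then if v \<in> neighbors E x then N ^ 2 else 0 else 0))"
    unfolding node_pot_def using x
    by (auto intro!: sum_mono simp: deg_above_lower[where l = l and v = v, OF g v] algebra_simps)
  also have "\<dots> = node_pot N \<alpha> E l x + (if x \<in> neighbors E v \<and> l v < l x then N ^ 2 else 0)"
    by (simp add: sum.distrib node_pot_def sum.delta neighbors_sym[of x])
  finally show ?thesis .
qed

lemma node_pot_lower_self:
  assumes g: "graph_on n E" and v: "0 < l v"
  shows "node_pot N \<alpha> E (l(v := l v - 1)) v +
    ((2 * N + 1) ^ 2 * \<alpha> - N ^ 2 * deg_above E l v (l v - 1)) = node_pot N \<alpha> E l v"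
proof -
  have "deg_above E (l(v := l v - 1)) v k = deg_above E l v k" for k
    using deg_above_lower[where l = l and v = v, OF g v, of v k] not_in_neighbors[OF g] by simp
  moreover have "{..<l v} = insert (l v - 1) {..<l v - 1}" using v by auto
  ultimately show ?thesis by (simp add: node_pot_def)
qed

lemma sum_node_pot_lower:
  assumes g: "graph_on n E" and v: "v < n" "0 < l v"
  defines "d \<equiv> deg_above E l v (l v - 1)"
  shows "(\<Sum>x<n. node_pot N \<alpha> E (l(v := l v - 1)) x) + ((2 * N + 1) ^ 2 * \<alpha> - N ^ 2 * d)
    \<le> (\<Sum>x<n. node_pot N \<alpha> E l x) + N ^ 2 * d"
proof -
  let ?l = "l(v := l v - 1)" and ?D = "(2 * N + 1) ^ 2 * \<alpha>"
  let ?above = "\<lambda>x. if x \<in> neighbors E v \<and> l v < l x then N ^ 2 else 0"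
  have remove: "(\<Sum>x<n. f x) = (\<Sum>x\<in>{..<n} - {v}. f x) + f v" for f :: "nat \<Rightarrow> nat"
    using v(1) by (simp add: sum.remove[of "{..<n}" v])
  have "(\<Sum>x<n. node_pot N \<alpha> E ?l x) + (?D - N ^ 2 * d) =
      (\<Sum>x\<in>{..<n} - {v}. node_pot N \<alpha> E ?l x) + node_pot N \<alpha> E l v"
    using node_pot_lower_self[where l = l and v = v, OF g v(2)] by (simp add: remove d_def)
  also have "\<dots> \<le> (\<Sum>x\<in>{..<n} - {v}. node_pot N \<alpha> E l x + ?above x) + (node_pot N \<alpha> E l v + ?above v)"
    using node_pot_lower_other[where l = l and v = v, OF g v(2)] by (intro add_mono sum_mono) auto
  also have "\<dots> = (\<Sum>x<n. node_pot N \<alpha> E l x + ?above x)" by (rule remove[symmetric])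
  also have "\<dots> = (\<Sum>x<n. node_pot N \<alpha> E l x) + N ^ 2 * card {x \<in> {..<n}. x \<in> neighbors E v \<and> l v < l x}"
    by (simp add: sum.distrib sum.If_cases Int_def)
  also have "card {x \<in> {..<n}. x \<in> neighbors E v \<and> l v < l x} \<le> d"
    unfolding d_def deg_above_def by (rule card_mono) (auto simp: finite_neighbors[OF g])
  finally show ?thesis by simp
qed

lemma potential_lower:
  assumes g: "graph_on n E" and v: "v < n" "0 < l v" "l v \<le> L" and N: "1 \<le> N"
    and low: "N * deg_above E l v (l v - 1) < (2 * N + 1) * \<alpha>"
  shows "potential n \<alpha> N L E (l(v := l v - 1)) + N * (deg_above E l v (l v) + 1)
    \<le> potential n \<alpha> N L E l"
proof -
  let ?l = "l(v := l v - 1)" and ?d = "deg_above E l v (l v - 1)" and ?D = "(2 * N + 1) ^ 2 * \<alpha>"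
  have "(2 * N + 1) * (N * ?d + 1) \<le> (2 * N + 1) * ((2 * N + 1) * \<alpha>)"
    using low by (intro mult_left_mono) auto
  then have "2 * (N ^ 2 * ?d) + N * ?d + 2 * N + 1 \<le> ?D"
    by (simp add: power2_eq_square algebra_simps)
  moreover have "N * (\<Sum>e\<in>E. edge_pot L ?l e) \<le> N * (\<Sum>e\<in>E. edge_pot L l e) + 4 * (N * ?d)"
    using mult_left_mono[OF sum_edge_pot_lower[where l = l and v = v, OF g v(2,3)], of N]
    by (simp add: algebra_simps)
  moreover have "N * (deg_above E l v (l v) + 1) \<le> N * ?d + N"
    using deg_above_antimono[OF g, of "l v - 1" "l v" l v] by simp
  ultimately show ?thesis
    using sum_node_pot_lower[where l = l and v = v, OF g v(1,2), of N \<alpha>] unfolding potential_def by linarith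
qed

lemma potential_insert:
  assumes g: "graph_on n (insert e E)"
  shows "potential n \<alpha> N L (insert e E) l \<le> potential n \<alpha> N L E l + N * (4 * L + 2)"
proof -
  have "(\<Sum>e\<in>insert e E. edge_pot L l e) \<le> (\<Sum>e\<in>E. edge_pot L l e) + (4 * L + 2)"
    using finite_graph_on[OF g] edge_pot_le[of L l e] by (simp add: sum.insert_if)
  then have "N * (\<Sum>e\<in>insert e E. edge_pot L l e) \<le> N * (\<Sum>e\<in>E. edge_pot L l e) + N * (4 * L + 2)"
    by (metis distrib_left mult_le_mono2)
  moreover have "(\<Sum>x<n. node_pot N \<alpha> (insert e E) l x) \<le> (\<Sum>x<n. node_pot N \<alpha> E l x)"
    unfolding node_pot_def
    by (intro sum_mono diff_le_mono2 mult_left_mono deg_above_insert_edge[OF g]) auto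
  ultimately show ?thesis by (simp add: potential_def)
qed

lemma node_pot_delete:
  assumes g: "graph_on n (insert e E)"
  shows "node_pot N \<alpha> E l x \<le> node_pot N \<alpha> (insert e E) l x + (if x \<in> e then N ^ 2 * l x else 0)"
proof -
  have "node_pot N \<alpha> E l x \<le> (\<Sum>k<l x.
      ((2 * N + 1) ^ 2 * \<alpha> - N ^ 2 * deg_above (insert e E) l x k) + (if x \<in> e then N ^ 2 else 0))"
    unfolding node_pot_def
  proof (rule sum_mono)
    fix k
    have "N ^ 2 * deg_above (insert e E) l x k \<le> N ^ 2 * deg_above E l x k + (if x \<in> e then N ^ 2 else 0)"
      using mult_left_mono[OF deg_above_insert_edge(2)[OF g, of l x k], of "N ^ 2"]
      by (auto simp: algebra_simps split: if_splits)
    then show "(2 * N + 1) ^ 2 * \<alpha> - N ^ 2 * deg_above E l x k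
        \<le> (2 * N + 1) ^ 2 * \<alpha> - N ^ 2 * deg_above (insert e E) l x k + (if x \<in> e then N ^ 2 else 0)"
      by linarith
  qed
  also have "\<dots> = node_pot N \<alpha> (insert e E) l x + (if x \<in> e then N ^ 2 * l x else 0)"
    by (simp add: sum.distrib node_pot_def mult.commute)
  finally show ?thesis .
qed

lemma potential_delete:
  assumes g: "graph_on n (insert e E)" and L: "\<And>x. x < n \<Longrightarrow> l x \<le> L"
  shows "potential n \<alpha> N L E l \<le> potential n \<alpha> N L (insert e E) l + 10 * (N ^ 2 * L)"
proof -
  have "(\<Sum>x<n. node_pot N \<alpha> E l x) \<le>
      (\<Sum>x<n. node_pot N \<alpha> (insert e E) l x + (if x \<in> e then N ^ 2 * L else 0))"
  proof (rule sum_mono)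
    fix x assume x: "x \<in> {..<n}"
    have "node_pot N \<alpha> E l x \<le> node_pot N \<alpha> (insert e E) l x + (if x \<in> e then N ^ 2 * l x else 0)"
      by (rule node_pot_delete[OF g])
    also have "\<dots> \<le> node_pot N \<alpha> (insert e E) l x + (if x \<in> e then N ^ 2 * L else 0)"
      using L x by simp
    finally show "node_pot N \<alpha> E l x \<le> \<dots>" .
  qed
  also have "\<dots> = (\<Sum>x<n. node_pot N \<alpha> (insert e E) l x) + card ({..<n} \<inter> e) * (N ^ 2 * L)"
    by (simp add: sum.distrib sum.If_cases)
  also have "card ({..<n} \<inter> e) \<le> 2"
  proof -
    obtain u v where e: "e = {u, v}" using g by (auto simp: graph_on_def)
    have "card ({..<n} \<inter> e) \<le> card e" by (rule card_mono) (auto simp: e)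
    also have "\<dots> \<le> 2" by (simp add: e card_insert_if)
    finally show ?thesis .
  qed
  finally have "(\<Sum>x<n. node_pot N \<alpha> E l x) \<le> (\<Sum>x<n. node_pot N \<alpha> (insert e E) l x) + 2 * (N ^ 2 * L)"
    by simp
  moreover have "(\<Sum>e\<in>E. edge_pot L l e) \<le> (\<Sum>e\<in>insert e E. edge_pot L l e)"
    using finite_graph_on[OF g] by (intro sum_mono2) auto
  then have "N * (\<Sum>e\<in>E. edge_pot L l e) \<le> N * (\<Sum>e\<in>insert e E. edge_pot L l e)" by simp
  ultimately show ?thesis unfolding potential_def by linarith
qed

lemma potential_le:
  assumes g: "graph_on n E" and L: "\<And>x. x < n \<Longrightarrow> l x \<le> L"
  shows "potential n \<alpha> N L E l \<le> N * (n * n * (4 * L + 2)) + 5 * (n * (L * ((2 * N + 1) ^ 2 * \<alpha>)))"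
proof -
  have "(\<Sum>e\<in>E. edge_pot L l e) \<le> card E * (4 * L + 2)"
    using sum_bounded_above[of E "edge_pot L l", OF edge_pot_le] by simp
  also have "\<dots> \<le> n * n * (4 * L + 2)" by (intro mult_right_mono card_graph_on[OF g]) simp
  finally have "N * (\<Sum>e\<in>E. edge_pot L l e) \<le> N * (n * n * (4 * L + 2))" by simp
  moreover have "node_pot N \<alpha> E l x \<le> L * ((2 * N + 1) ^ 2 * \<alpha>)" if "x < n" for x
  proof -
    have "node_pot N \<alpha> E l x \<le> card {..<l x} * ((2 * N + 1) ^ 2 * \<alpha>)"
      unfolding node_pot_def by (rule sum_bounded_above[where 'a = nat, simplified]) simp
    also have "\<dots> \<le> L * ((2 * N + 1) ^ 2 * \<alpha>)" using L[OF that] by (intro mult_right_mono) auto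
    finally show ?thesis .
  qed
  then have "(\<Sum>x<n. node_pot N \<alpha> E l x) \<le> n * (L * ((2 * N + 1) ^ 2 * \<alpha>))"
    using sum_bounded_above[of "{..<n}" "node_pot N \<alpha> E l"] by simp
  ultimately show ?thesis unfolding potential_def by linarith
qed

section \<open>Reasoning about programs\<close>

definition runs :: "nat \<Rightarrow> com \<Rightarrow> nat \<Rightarrow> memory \<Rightarrow> (memory \<Rightarrow> bool) \<Rightarrow> bool" where
  "runs W c T M Q \<longleftrightarrow> (\<exists>t M'. exec W c M t M' \<and> t \<le> T \<and> Q M')"

lemma runsI: "exec W c M t M' \<Longrightarrow> t \<le> T \<Longrightarrow> Q M' \<Longrightarrow> runs W c T M Q"
  unfolding runs_def by blast

lemma runs_conseq:
  "runs W c T M Q \<Longrightarrow> T \<le> T' \<Longrightarrow> (\<And>M'. Q M' \<Longrightarrow> Q' M') \<Longrightarrow> runs W c T' M Q'"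
  unfolding runs_def by (meson order_trans)

lemma runs_Skip: "runs W Skip T M Q \<longleftrightarrow> 1 \<le> T \<and> Q M"
  unfolding runs_def by (auto intro: exec.Skip[simplified] elim: SkipE)

lemma runs_Write: "runs W (Write a e1 e2) T M Q \<longleftrightarrow> 1 + expr_cost e1 + expr_cost e2 \<le> T \<and>
    (\<exists>i x. eval W M e1 = Some i \<and> eval W M e2 = Some x \<and> Q (M(a := (M a)(i := x))))"
  unfolding runs_def by (auto intro: exec.Write[simplified] elim!: WriteE)

lemma runs_SeqI:
  assumes "runs W c1 T1 M P" "\<And>M'. P M' \<Longrightarrow> runs W c2 T2 M' Q" "T1 + T2 \<le> T"
  shows "runs W (Seq c1 c2) T M Q"
proof -
  obtain t1 M1 t2 M2 where "exec W c1 M t1 M1" "t1 \<le> T1" "exec W c2 M1 t2 M2" "t2 \<le> T2" "Q M2"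
    using assms(1,2) unfolding runs_def by blast
  then show ?thesis using exec.Seq assms(3) by (intro runsI[of W _ M "t1 + t2" M2]) auto
qed

lemma runs_SeqI_ex:
  assumes "runs W c1 T1 M P" and "\<And>M'. P M' \<Longrightarrow> \<exists>T. runs W c2 (T2 + T) M' (Q T)" and "T1 + T2 \<le> T0"
  shows "\<exists>T. runs W (Seq c1 c2) (T0 + T) M (Q T)"
proof -
  obtain t1 M1 where first: "exec W c1 M t1 M1" "t1 \<le> T1" "P M1" using assms(1) unfolding runs_def by blast
  then obtain T where T: "runs W c2 (T2 + T) M1 (Q T)" using assms(2) by blast
  have "runs W c1 T1 M (\<lambda>M'. M' = M1)" using first by (auto intro: runsI)
  then have "runs W (Seq c1 c2) (T0 + T) M (Q T)" by (rule runs_SeqI) (use T assms(3) in auto)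
  then show ?thesis ..
qed

lemma runs_Write_Seq: "runs W (Seq (Write a e1 e2) c) T M Q \<longleftrightarrow>
    1 + expr_cost e1 + expr_cost e2 \<le> T \<and>
    (\<exists>i x. eval W M e1 = Some i \<and> eval W M e2 = Some x \<and>
       runs W c (T - (1 + expr_cost e1 + expr_cost e2)) (M(a := (M a)(i := x))) Q)"
    (is "?L \<longleftrightarrow> ?k \<le> T \<and> ?R")
proof
  assume ?L
  then show "?k \<le> T \<and> ?R" unfolding runs_def by (fastforce elim!: SeqE WriteE)
next
  assume R: "?k \<le> T \<and> ?R"
  then obtain i x where e: "eval W M e1 = Some i" "eval W M e2 = Some x"
    and r: "runs W c (T - ?k) (M(a := (M a)(i := x))) Q" by blast
  have "runs W (Write a e1 e2) ?k M (\<lambda>M'. M' = M(a := (M a)(i := x)))"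
    using e by (simp add: runs_Write)
  then show ?L by (rule runs_SeqI) (use r R in auto)
qed

lemma runs_If: "runs W (If b c1 c2) T M Q \<longleftrightarrow> 1 + expr_cost b \<le> T \<and>
    (\<exists>x. eval W M b = Some x \<and> runs W (if x = 0 then c2 else c1) (T - (1 + expr_cost b)) M Q)"
    (is "?L \<longleftrightarrow> ?k \<le> T \<and> ?R")
proof
  assume ?L
  then show "?k \<le> T \<and> ?R" unfolding runs_def by (fastforce elim!: IfE)
next
  assume R: "?k \<le> T \<and> ?R"
  then obtain x t M' where x: "eval W M b = Some x" and e: "exec W (if x = 0 then c2 else c1) M t M'"
    and t: "t \<le> T - ?k" "Q M'" unfolding runs_def by blast
  have "exec W (If b c1 c2) M (?k + t) M'"
    using x e by (cases "x = 0") (auto intro: exec.If_true[simplified] exec.If_false[simplified])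
  then show ?L using t R by (intro runsI) auto
qed

text \<open>The credit \<open>k\<close> pays \<open>s\<close> units for every time step.\<close>

lemma runs_While_amortized:
  assumes "I k M" and s: "0 < s"
    and step: "\<And>k M. I k M \<Longrightarrow> \<exists>x. eval W M b = Some x \<and>
      (if x = 0 then Q k M
       else \<exists>T. runs W c T M (\<lambda>M'. \<exists>k'. I k' M' \<and> s * (1 + expr_cost b + T) + k' \<le> k))"
  shows "\<exists>T. runs W (While b c) T M (\<lambda>M'. \<exists>k'. Q k' M' \<and> s * T + k' \<le> k + s * (1 + expr_cost b))"
  using assms(1)
proof (induction k arbitrary: M rule: less_induct)
  case (less k)
  let ?b = "1 + expr_cost b"
  obtain x where x: "eval W M b = Some x" and alt: "if x = 0 then Q k M
      else \<exists>T. runs W c T M (\<lambda>M'. \<exists>k'. I k' M' \<and> s * (?b + T) + k' \<le> k)"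
    using step[OF less.prems] by blast
  show ?case
  proof (cases "x = 0")
    case True
    then show ?thesis
      using x alt exec.While_false[of W M b c]
      by (intro exI[of _ ?b] runsI[of W _ M ?b M] exI[of _ k]) auto
  next
    case False
    then obtain T t M1 k1 where c: "exec W c M t M1" "t \<le> T" and k1: "I k1 M1" "s * (?b + T) + k1 \<le> k"
      using alt unfolding runs_def by auto
    have "0 < s * (?b + T)" using s by simp
    then have "k1 < k" using k1(2) by linarith
    then obtain T2 t2 M2 k2 where w: "exec W (While b c) M1 t2 M2" "t2 \<le> T2"
      and k2: "Q k2 M2" "s * T2 + k2 \<le> k1 + s * ?b"
      using less.IH[OF _ k1(1)] unfolding runs_def by blast
    have "s * (?b + T + T2) + k2 \<le> k + s * ?b"
      using k1(2) k2(2) by (simp only: distrib_left)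
    moreover have "exec W (While b c) M (?b + t + t2) M2" by (rule exec.While_true[OF x False c(1) w(1)])
    ultimately have "runs W (While b c) (?b + T + T2) M
        (\<lambda>M'. \<exists>k'. Q k' M' \<and> s * (?b + T + T2) + k' \<le> k + s * ?b)"
      using c(2) w(2) k2(1) by (intro runsI[of W _ M "?b + t + t2" M2]) auto
    then show ?thesis by blast
  qed
qed

lemma runs_While_decreasing:
  assumes "I k M"
    and step: "\<And>k M. I k M \<Longrightarrow> \<exists>x. eval W M b = Some x \<and>
      (if x = 0 then Q M else runs W c T M (\<lambda>M'. \<exists>k'<k. I k' M'))"
  shows "runs W (While b c) (k * (T + 1 + expr_cost b) + (1 + expr_cost b)) M Q"
proof -
  let ?b = "T + 1 + expr_cost b"
  have "\<exists>T'. runs W (While b c) T' M (\<lambda>M'. \<exists>k'. Q M' \<and> 1 * T' + k' \<le> k * ?b + 1 * (1 + expr_cost b))"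
  proof (rule runs_While_amortized[where I = "\<lambda>k M. \<exists>j. I j M \<and> k = j * ?b" and s = 1])
    fix k M assume "\<exists>j. I j M \<and> k = j * ?b"
    then obtain j where j: "I j M" "k = j * ?b" by blast
    obtain x where x: "eval W M b = Some x"
      and alt: "if x = 0 then Q M else runs W c T M (\<lambda>M'. \<exists>k'<j. I k' M')" using step[OF j(1)] by blast
    have credit: "1 * (1 + expr_cost b + T) + i * ?b \<le> k" if "i < j" for i
      using mult_le_mono1[of "Suc i" j ?b] that by (simp add: j(2))
    have "runs W c T M (\<lambda>M'. \<exists>k'. (\<exists>j. I j M' \<and> k' = j * ?b) \<and> 1 * (1 + expr_cost b + T) + k' \<le> k)"
      if "x \<noteq> 0"
    proof (rule runs_conseq[where T = T])
      show "runs W c T M (\<lambda>M'. \<exists>k'<j. I k' M')" using alt that by simp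
    qed (use credit in blast)+
    then show "\<exists>x. eval W M b = Some x \<and> (if x = 0 then Q M else \<exists>T. runs W c T M
      (\<lambda>M'. \<exists>k'. (\<exists>j. I j M' \<and> k' = j * ?b) \<and> 1 * (1 + expr_cost b + T) + k' \<le> k))"
      using x alt by (intro exI[of _ x]) auto
  qed (use assms(1) in auto)
  then show ?thesis unfolding runs_def by fastforce
qed

lemma runs_While_countdown:
  assumes init: "I k M"
    and step: "\<And>k M. I (Suc k) M \<Longrightarrow> (\<exists>x. eval W M b = Some x \<and> x \<noteq> 0) \<and> runs W c T M (I k)"
    and exit: "\<And>M. I 0 M \<Longrightarrow> eval W M b = Some 0"
  shows "runs W (While b c) (k * (T + 1 + expr_cost b) + (1 + expr_cost b)) M (I 0)"
proof (rule runs_While_decreasing[where I = I, OF init])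
  fix k M assume I: "I k M"
  show "\<exists>x. eval W M b = Some x \<and> (if x = 0 then I 0 M else runs W c T M (\<lambda>M'. \<exists>k'<k. I k' M'))"
  proof (cases k)
    case 0
    then show ?thesis using exit I by auto
  next
    case (Suc j)
    then have "runs W c T M (\<lambda>M'. \<exists>k'<k. I k' M')"
      using step I by (blast intro: runs_conseq[OF _ order.refl])
    moreover obtain x where "eval W M b = Some x" "x \<noteq> 0" using step I Suc by blast
    ultimately show ?thesis by auto
  qed
qed

text \<open>Simplification of a program stops in front of the first command without a rewrite rule.\<close>

lemma runs_weak_cong [cong]: "T = T' \<Longrightarrow> M = M' \<Longrightarrow> runs W c T M Q \<longleftrightarrow> runs W c T' M' Q"
  by simp

lemmas runs_simps = runs_Skip runs_Write runs_Write_Seq runs_If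

lemma as_word_less [simp]: "x < W \<Longrightarrow> as_word W x = Some x"
  by (simp add: as_word_def)

text \<open>The literal \<open>Const 1\<close> is to survive simplification.\<close>

declare One_nat_def [simp del]

text \<open>A scalar variable is an array of which only cell 0 is used.\<close>

abbreviation Var :: "nat \<Rightarrow> expr" where "Var a \<equiv> Read a (Const 0)"
abbreviation Assign :: "nat \<Rightarrow> expr \<Rightarrow> com" (infix "::=" 70) where "a ::= e \<equiv> Write a (Const 0) e"
abbreviation Then :: "com \<Rightarrow> com \<Rightarrow> com" (infixr ";;" 60) where "c1 ;; c2 \<equiv> Seq c1 c2"
abbreviation EPlus (infixl "\<oplus>" 85) where "x \<oplus> y \<equiv> Binop Plus x y"
abbreviation EMinus (infixl "\<ominus>" 85) where "x \<ominus> y \<equiv> Binop Minus x y"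
abbreviation ETimes (infixl "\<otimes>" 90) where "x \<otimes> y \<equiv> Binop Times x y"
abbreviation EQuot (infixl "\<oslash>" 90) where "x \<oslash> y \<equiv> Binop Quotient x y"
abbreviation ELess (infix "\<prec>" 80) where "x \<prec> y \<equiv> Binop Less x y"
abbreviation EEqual (infix "\<doteq>" 80) where "x \<doteq> y \<equiv> Binop Equal x y"

abbreviation (input) unchanged :: "nat set \<Rightarrow> memory \<Rightarrow> memory \<Rightarrow> bool" where
  "unchanged X M M' \<equiv> \<forall>r. r \<notin> X \<longrightarrow> M' r = M r"

text \<open>The colors, buckets and mates (the neighbor along a color) of the edges, the levels of the nodes,
  the counters of all trees, and a stack of nodes.\<close>

abbreviation (input) INPUT :: nat where "INPUT \<equiv> 0"
abbreviation (input) COLOR :: nat where "COLOR \<equiv> 1"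
abbreviation (input) BUCKET :: nat where "BUCKET \<equiv> 2"
abbreviation (input) MATE :: nat where "MATE \<equiv> 3"
abbreviation (input) LEVEL :: nat where "LEVEL \<equiv> 4"
abbreviation (input) COUNT :: nat where "COUNT \<equiv> 5"
abbreviation (input) STACK :: nat where "STACK \<equiv> 6"

text \<open>Scalars: the number of leaves of a tree and the stride of the tables; the base addresses of two
  trees, a leaf, the position in a tree and the size of the subtree there; ranks; the ends of an edge
  and its bucket; the state of the coloring loop; the size of the stack; the node that is moved, its
  old level and a new bucket.\<close>

abbreviation (input) LEAVES :: nat where "LEAVES \<equiv> 10"
abbreviation (input) STRIDE :: nat where "STRIDE \<equiv> 11"
abbreviation (input) TREE :: nat where "TREE \<equiv> 12"
abbreviation (input) TREE2 :: nat where "TREE2 \<equiv> 13"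
abbreviation (input) KEY :: nat where "KEY \<equiv> 14"
abbreviation (input) POS :: nat where "POS \<equiv> 15"
abbreviation (input) SPAN :: nat where "SPAN \<equiv> 16"
abbreviation (input) RANK :: nat where "RANK \<equiv> 17"
abbreviation (input) REST :: nat where "REST \<equiv> 18"
abbreviation (input) TAIL :: nat where "TAIL \<equiv> 19"
abbreviation (input) HEAD :: nat where "HEAD \<equiv> 20"
abbreviation (input) SLOT :: nat where "SLOT \<equiv> 21"
abbreviation (input) ACTIVE :: nat where "ACTIVE \<equiv> 22"
abbreviation (input) NEXT :: nat where "NEXT \<equiv> 23"
abbreviation (input) SAVED :: nat where "SAVED \<equiv> 24"
abbreviation (input) TOP :: nat where "TOP \<equiv> 25"
abbreviation (input) NODE :: nat where "NODE \<equiv> 26"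
abbreviation (input) OLD :: nat where "OLD \<equiv> 27"
abbreviation (input) NEW :: nat where "NEW \<equiv> 28"

section \<open>Counting trees\<close>

text \<open>A set \<open>F\<close> of colors below \<open>2 ^ H\<close> is stored as a binary heap with the leaf \<open>2 ^ H + c\<close> for
  the color \<open>c\<close>; every node holds the number of elements of \<open>F\<close> below it.\<close>

definition ancestor :: "nat \<Rightarrow> nat \<Rightarrow> bool" where
  "ancestor x y \<longleftrightarrow> (\<exists>h. y div 2 ^ h = x)"

definition tree_count :: "nat \<Rightarrow> nat set \<Rightarrow> nat \<Rightarrow> nat" where
  "tree_count H F x = card {c \<in> F. ancestor x (2 ^ H + c)}"

definition tree_node :: "nat \<Rightarrow> nat \<Rightarrow> nat \<Rightarrow> bool" where
  "tree_node H h x \<longleftrightarrow> 2 ^ H \<le> x * 2 ^ h \<and> (x + 1) * 2 ^ h \<le> 2 * 2 ^ H"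

definition tree_at :: "nat \<Rightarrow> memory \<Rightarrow> nat \<Rightarrow> nat set \<Rightarrow> bool" where
  "tree_at H M K F \<longleftrightarrow> (\<forall>x. 0 < x \<longrightarrow> x < 2 * 2 ^ H \<longrightarrow> M COUNT (K + x) = tree_count H F x)"

lemma ancestor_refl: "ancestor y y"
  unfolding ancestor_def by (rule exI[of _ 0]) simp

lemma ancestor_le: "ancestor x y \<Longrightarrow> x \<le> y"
  by (auto simp: ancestor_def)

lemma ancestor_half: "ancestor x y \<Longrightarrow> x = y \<or> ancestor x (y div 2)"
proof -
  assume "ancestor x y"
  then obtain h where "y div 2 ^ h = x" by (auto simp: ancestor_def)
  then show ?thesis by (cases h) (auto simp: ancestor_def div_mult2_eq)
qed

lemma ancestor_comparable:
  assumes "ancestor x y" "ancestor x' y"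
  shows "ancestor x x' \<or> ancestor x' x"
proof -
  have below: "ancestor (y div 2 ^ j) (y div 2 ^ i)" if "i \<le> j" for i j
  proof -
    have "y div 2 ^ j = y div 2 ^ i div 2 ^ (j - i)"
      using that by (simp add: div_mult2_eq[symmetric] power_add[symmetric])
    then show ?thesis by (auto simp: ancestor_def)
  qed
  obtain i j where "y div 2 ^ i = x" "y div 2 ^ j = x'" using assms by (auto simp: ancestor_def)
  then show ?thesis using below[of i j] below[of j i] by (cases "i \<le> j") auto
qed

lemma ancestor_same_height: "ancestor x y \<Longrightarrow> y < 2 * x \<Longrightarrow> x = y"
  using ancestor_half[of x y] ancestor_le[of x "y div 2"] by auto

lemma ancestor_iff_child: "ancestor x y \<longleftrightarrow> x = y \<or> ancestor (2 * x) y \<or> ancestor (2 * x + 1) y"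
proof
  assume "ancestor x y"
  then obtain h where h: "y div 2 ^ h = x" by (auto simp: ancestor_def)
  show "x = y \<or> ancestor (2 * x) y \<or> ancestor (2 * x + 1) y"
  proof (cases h)
    case (Suc k)
    then have "y div 2 ^ k div 2 = x" using h by (metis div_mult2_eq power_Suc2)
    then have "y div 2 ^ k = 2 * x \<or> y div 2 ^ k = 2 * x + 1" by linarith
    then show ?thesis by (auto simp: ancestor_def)
  qed (use h in simp)
next
  have "ancestor (z div 2) y" if z: "ancestor z y" for z
  proof -
    obtain k where "y div 2 ^ k = z" using z by (auto simp: ancestor_def)
    then have "y div 2 ^ Suc k = z div 2" by (metis div_mult2_eq power_Suc2)
    then show ?thesis unfolding ancestor_def by blast
  qed
  from this[of "2 * x"] this[of "2 * x + 1"]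
  show "x = y \<or> ancestor (2 * x) y \<or> ancestor (2 * x + 1) y \<Longrightarrow> ancestor x y" using ancestor_refl by auto
qed

lemma ancestor_between:
  assumes "ancestor x y" "ancestor p y" "p div 2 < x" "x \<le> p"
  shows "x = p"
  using ancestor_comparable[OF assms(1,2)] ancestor_half[of x p] ancestor_le[of x "p div 2"]
    ancestor_le[of p x] assms(3,4) by auto

lemma ancestor_children_disjoint:
  assumes "0 < x"
  shows "\<not> (ancestor (2 * x) y \<and> ancestor (2 * x + 1) y)"
  using ancestor_comparable[of "2 * x" y "2 * x + 1"] ancestor_same_height[of "2 * x" "2 * x + 1"]
    ancestor_le[of "2 * x + 1" "2 * x"] assms by auto

lemma tree_node_bounds:
  assumes "tree_node H h x"
  shows "0 < x" "x < 2 * 2 ^ H" "h \<le> H" "0 < h \<Longrightarrow> x < 2 ^ H" "2 ^ h \<le> (2::nat) ^ H"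
proof -
  show pos: "0 < x" using assms by (cases "x = 0") (auto simp: tree_node_def)
  have "x < (x + 1) * 1" by simp
  also have "\<dots> \<le> (x + 1) * 2 ^ h" by (rule mult_left_mono) auto
  also have "\<dots> \<le> 2 * 2 ^ H" using assms by (simp only: tree_node_def)
  finally show "x < 2 * 2 ^ H" .
  have "2 * 2 ^ h \<le> (x + 1) * (2::nat) ^ h" using pos by (intro mult_right_mono) auto
  also have "\<dots> \<le> 2 * 2 ^ H" using assms by (simp only: tree_node_def)
  finally show "2 ^ h \<le> (2::nat) ^ H" by simp
  then show "h \<le> H" by simp
  show "x < 2 ^ H" if "0 < h"
  proof -
    have "(2::nat) ^ 1 \<le> 2 ^ h" using that by (intro power_increasing) auto
    then have "(x + 1) * 2 \<le> (x + 1) * 2 ^ h" by (intro mult_left_mono) auto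
    then show ?thesis using assms by (simp add: tree_node_def)
  qed
qed

lemma tree_node_root: "tree_node H H 1"
  by (simp add: tree_node_def)

lemma tree_node_leaf: "tree_node H 0 x \<longleftrightarrow> (\<exists>c<2 ^ H. x = 2 ^ H + c)"
proof
  assume "tree_node H 0 x"
  then show "\<exists>c<2 ^ H. x = 2 ^ H + c" by (intro exI[of _ "x - 2 ^ H"]) (auto simp: tree_node_def)
qed (auto simp: tree_node_def)

lemma tree_node_children:
  "tree_node H (Suc h) x \<Longrightarrow> tree_node H h (2 * x) \<and> tree_node H h (2 * x + 1)"
  by (auto simp: tree_node_def algebra_simps)

lemma tree_node_unique:
  assumes "tree_node H h x" "tree_node H h x'" "ancestor x x'"
  shows "x = x'"
proof (rule ancestor_same_height[OF assms(3)])
  have "x' * 2 ^ h < (x' + 1) * 2 ^ h" by simp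
  also have "\<dots> \<le> 2 * 2 ^ H" using assms(2) by (simp only: tree_node_def)
  also have "\<dots> \<le> (2 * x) * 2 ^ h" using assms(1) by (simp add: tree_node_def)
  finally have "x' * 2 ^ h < (2 * x) * 2 ^ h" .
  then show "x' < 2 * x" by simp
qed

lemma tree_node_ancestor:
  assumes "h \<le> H" "c < 2 ^ H"
  shows "tree_node H h ((2 ^ H + c) div 2 ^ h)"
proof -
  have H: "(2::nat) ^ H = 2 ^ (H - h) * 2 ^ h" using assms(1) by (simp add: power_add[symmetric])
  then have "(2 ^ H + c) div 2 ^ h = 2 ^ (H - h) + c div 2 ^ h" by simp
  moreover have "c div 2 ^ h < 2 ^ (H - h)"
    using assms(2) unfolding H by (rule less_mult_imp_div_less)
  then have "c div 2 ^ h + 1 \<le> 2 ^ (H - h)" by simp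
  then have "(c div 2 ^ h + 1) * 2 ^ h \<le> 2 ^ H" unfolding H by (rule mult_right_mono) simp
  ultimately show ?thesis by (simp add: tree_node_def distrib_right H[symmetric])
qed

lemma ancestor_leaf_iff:
  assumes x: "tree_node H h x" and c: "c < 2 ^ H"
  shows "ancestor x (2 ^ H + c) \<longleftrightarrow> x * 2 ^ h \<le> 2 ^ H + c \<and> 2 ^ H + c < (x + 1) * 2 ^ h"
proof -
  let ?x = "(2 ^ H + c) div 2 ^ h"
  have "ancestor x (2 ^ H + c) \<longleftrightarrow> ?x = x"
  proof
    assume a: "ancestor x (2 ^ H + c)"
    have "ancestor ?x (2 ^ H + c)" by (auto simp: ancestor_def)
    moreover have "tree_node H h ?x" by (rule tree_node_ancestor[OF tree_node_bounds(3)[OF x] c])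
    ultimately show "?x = x" using ancestor_comparable[OF a] tree_node_unique x by blast
  qed (auto simp: ancestor_def)
  also have "\<dots> \<longleftrightarrow> x * 2 ^ h \<le> 2 ^ H + c \<and> 2 ^ H + c < (x + 1) * 2 ^ h"
    using div_less_iff_less_mult[of "2 ^ h" "2 ^ H + c" "x + 1"]
      less_eq_div_iff_mult_less_eq[of "2 ^ h" x "2 ^ H + c"] by auto
  finally show ?thesis .
qed

context
  fixes H :: nat and F :: "nat set"
  assumes F: "F \<subseteq> {..<2 ^ H}"
begin

lemma finite_leaves: "finite F"
  using F finite_subset by blast

lemma tree_count_le: "tree_count H F x \<le> 2 ^ H"
proof -
  have "tree_count H F x \<le> card F" unfolding tree_count_def using finite_leaves by (intro card_mono) auto
  also have "\<dots> \<le> 2 ^ H" using card_mono[OF _ F] by simp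
  finally show ?thesis .
qed

lemma tree_count_children:
  assumes "0 < x" "x < 2 ^ H"
  shows "tree_count H F x = tree_count H F (2 * x) + tree_count H F (2 * x + 1)"
proof -
  have "{c \<in> F. ancestor x (2 ^ H + c)} =
      {c \<in> F. ancestor (2 * x) (2 ^ H + c)} \<union> {c \<in> F. ancestor (2 * x + 1) (2 ^ H + c)}"
    using assms(2) ancestor_iff_child[of x] by fastforce
  moreover have "{c \<in> F. ancestor (2 * x) (2 ^ H + c)} \<inter> {c \<in> F. ancestor (2 * x + 1) (2 ^ H + c)} = {}"
    using ancestor_children_disjoint[OF assms(1)] by blast
  ultimately show ?thesis unfolding tree_count_def using finite_leaves by (simp add: card_Un_disjoint)
qed

lemma tree_count_root: "tree_count H F 1 = card F"
proof -
  have "ancestor 1 (2 ^ H + c)" if "c < 2 ^ H" for c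
    using ancestor_leaf_iff[OF tree_node_root that] that by simp
  then have "{c \<in> F. ancestor 1 (2 ^ H + c)} = F" using F by auto
  then show ?thesis by (simp add: tree_count_def)
qed

lemma tree_count_leaf:
  assumes "c < 2 ^ H"
  shows "tree_count H F (2 ^ H + c) = (if c \<in> F then 1 else 0)"
proof -
  have "tree_node H 0 (2 ^ H + c)" using assms tree_node_leaf by blast
  then have "ancestor (2 ^ H + c) (2 ^ H + d) \<longleftrightarrow> d = c" if "d \<in> F" for d
    using ancestor_leaf_iff[of H 0 "2 ^ H + c" d] F that by auto
  then have "{d \<in> F. ancestor (2 ^ H + c) (2 ^ H + d)} = (if c \<in> F then {c} else {})" by auto
  then show ?thesis by (simp add: tree_count_def)
qed

lemma card_left_of_node:
  assumes x: "tree_node H h x"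
  shows "card {c \<in> F. 2 ^ H + c < (x + 1) * 2 ^ h} = card {c \<in> F. 2 ^ H + c < x * 2 ^ h} + tree_count H F x"
proof -
  have ancestor: "ancestor x (2 ^ H + c) \<longleftrightarrow> x * 2 ^ h \<le> 2 ^ H + c \<and> 2 ^ H + c < (x + 1) * 2 ^ h" if "c \<in> F" for c
    using ancestor_leaf_iff[OF x, of c] F that by blast
  have "x * 2 ^ h \<le> (x + 1) * 2 ^ h" by simp
  then have "{c \<in> F. 2 ^ H + c < (x + 1) * 2 ^ h} =
      {c \<in> F. 2 ^ H + c < x * 2 ^ h} \<union> {c \<in> F. ancestor x (2 ^ H + c)}"
    using ancestor by (auto simp del: add_mult_distrib mult_Suc intro: less_le_trans)
  moreover have "{c \<in> F. 2 ^ H + c < x * 2 ^ h} \<inter> {c \<in> F. ancestor x (2 ^ H + c)} = {}"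
    using ancestor by auto
  ultimately show ?thesis unfolding tree_count_def using finite_leaves by (simp add: card_Un_disjoint)
qed

end

definition rank :: "nat set \<Rightarrow> nat \<Rightarrow> nat" where
  "rank F c = card {d \<in> F. d < c}"

lemma rank_strict_mono: "finite F \<Longrightarrow> c \<in> F \<Longrightarrow> c < d \<Longrightarrow> rank F c < rank F d"
  unfolding rank_def by (rule psubset_card_mono) auto

lemma rank_less_card: "finite F \<Longrightarrow> c \<in> F \<Longrightarrow> rank F c < card F"
  unfolding rank_def by (rule psubset_card_mono) auto

lemma rank_remove:
  assumes "finite F" "c \<in> F"
  shows "rank F d = rank (F - {c}) d + (if c < d then 1 else 0)"
proof -
  have "{x \<in> F. x < d} = (if c < d then insert c {x \<in> F - {c}. x < d} else {x \<in> F - {c}. x < d})"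
    using assms(2) by auto
  then show ?thesis using assms(1) unfolding rank_def by simp
qed

definition set_change :: "binop \<Rightarrow> nat \<Rightarrow> nat set \<Rightarrow> nat set \<Rightarrow> bool" where
  "set_change f c F F' \<longleftrightarrow>
     f = Plus \<and> c \<notin> F \<and> F' = insert c F \<or> f = Minus \<and> c \<in> F \<and> F' = F - {c}"

lemma tree_count_change:
  assumes "set_change f c F F'" "finite F"
  shows "tree_count H F' x =
    (if ancestor x (2 ^ H + c) then apply_binop f (tree_count H F x) 1 else tree_count H F x)"
proof -
  let ?X = "\<lambda>F. {d \<in> F. ancestor x (2 ^ H + d)}"
  have fin: "finite (?X F)" using assms(2) by simp
  consider (insert) "f = Plus" "c \<notin> F" "F' = insert c F" | (remove) "f = Minus" "c \<in> F" "F' = F - {c}"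
    using assms(1) unfolding set_change_def by blast
  then show ?thesis
  proof cases
    case insert
    then have "?X F' = (if ancestor x (2 ^ H + c) then insert c (?X F) else ?X F)" by auto
    then show ?thesis using insert fin unfolding tree_count_def by simp
  next
    case remove
    then have "?X F' = (if ancestor x (2 ^ H + c) then ?X F - {c} else ?X F)" by auto
    then show ?thesis using remove fin unfolding tree_count_def by simp
  qed
qed

definition tree_update_step :: "binop \<Rightarrow> com" where
  "tree_update_step f =
     Write COUNT (Var TREE \<oplus> Var POS) (Binop f (Read COUNT (Var TREE \<oplus> Var POS)) (Const 1)) ;;
     POS ::= Var POS \<oslash> Const 2"

definition tree_update_loop :: "binop \<Rightarrow> com" where
  "tree_update_loop f = While (Var POS) (tree_update_step f)"

definition tree_update :: "binop \<Rightarrow> com" where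
  "tree_update f = POS ::= Var LEAVES \<oplus> Var KEY ;; tree_update_loop f"

definition find_free_step :: com where
  "find_free_step = SPAN ::= Var SPAN \<oslash> Const 2 ;; POS ::= Const 2 \<otimes> Var POS ;;
     If (Read COUNT (Var TREE \<oplus> Var POS) \<oplus> Read COUNT (Var TREE2 \<oplus> Var POS) \<prec> Var SPAN)
       Skip (POS ::= Var POS \<oplus> Const 1)"

definition find_free_loop :: com where
  "find_free_loop = While (Var POS \<prec> Var LEAVES) find_free_step"

definition find_free :: com where
  "find_free = POS ::= Const 1 ;; SPAN ::= Var LEAVES ;; find_free_loop ;; KEY ::= Var POS \<ominus> Var LEAVES"

definition select_step :: com where
  "select_step = POS ::= Const 2 \<otimes> Var POS ;;
     If (Var REST \<prec> Read COUNT (Var TREE \<oplus> Var POS)) Skip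
       (REST ::= Var REST \<ominus> Read COUNT (Var TREE \<oplus> Var POS) ;; POS ::= Var POS \<oplus> Const 1)"

definition select_loop :: com where
  "select_loop = While (Var POS \<prec> Var LEAVES) select_step"

definition select :: com where
  "select = POS ::= Const 1 ;; REST ::= Var RANK ;; select_loop ;; KEY ::= Var POS \<ominus> Var LEAVES"

definition change_ancestors :: "binop \<Rightarrow> nat \<Rightarrow> nat \<Rightarrow> nat \<Rightarrow> (nat \<Rightarrow> nat) \<Rightarrow> nat \<Rightarrow> nat" where
  "change_ancestors f K y p g i = (if K + p < i \<and> ancestor (i - K) y then apply_binop f (g i) 1 else g i)"

lemma change_ancestors_self: "change_ancestors f K y y g = g"
proof
  show "change_ancestors f K y y g i = g i" for i
    using ancestor_le[of "i - K" y] by (auto simp: change_ancestors_def)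
qed

lemma change_ancestors_parent:
  assumes "0 < p" "ancestor p y"
  shows "change_ancestors f K y (p div 2) g = (change_ancestors f K y p g)(K + p := apply_binop f (g (K + p)) 1)"
proof
  fix i
  have "K + p div 2 < i \<and> ancestor (i - K) y \<longleftrightarrow> i = K + p \<or> K + p < i \<and> ancestor (i - K) y"
  proof (cases "K < i")
    case True
    then obtain x where "i = K + x" using less_imp_add_positive by blast
    then show ?thesis using ancestor_between[of x y p] assms by (cases "x \<le> p") auto
  qed (use assms in auto)
  then show "change_ancestors f K y (p div 2) g i =
      ((change_ancestors f K y p g)(K + p := apply_binop f (g (K + p)) 1)) i"
    by (simp add: change_ancestors_def)
qed

context
  fixes H W :: nat
  assumes W: "4 * 2 ^ H \<le> W"
begin

lemma leaf_words: "2 ^ H < W" "2 < W" "1 < W" "0 < W" "2 ^ H + 1 < W" "x < 2 * 2 ^ H \<Longrightarrow> x < W"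
  using W one_le_power[of "2::nat" H] by linarith+

lemma runs_tree_update_loop:
  assumes c: "c < 2 ^ H" and M: "M TREE 0 = K" "M POS 0 = 2 ^ H + c" "K + 2 * 2 ^ H \<le> W"
    and f: "f = Plus \<or> f = Minus" and count: "\<And>x. 0 < x \<Longrightarrow> x < 2 * 2 ^ H \<Longrightarrow> M COUNT (K + x) \<le> 2 ^ H"
  shows "runs W (tree_update_loop f) (23 * Suc H + 3) M (\<lambda>M'. unchanged {COUNT, POS} M M' \<and>
    M' COUNT = change_ancestors f K (2 ^ H + c) 0 (M COUNT))"
proof -
  define y where "y = 2 ^ H + c"
  define I where "I k M' \<longleftrightarrow> k \<le> Suc H \<and> M' POS 0 = y div 2 ^ (Suc H - k) \<and> unchanged {COUNT, POS} M M' \<and>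
    M' COUNT = change_ancestors f K y (M' POS 0) (M COUNT)" for k M'
  have last: "y div 2 ^ (Suc H) = 0" using c by (simp add: y_def)
  have "runs W (tree_update_loop f) (Suc H * (20 + 1 + expr_cost (Var POS)) + (1 + expr_cost (Var POS))) M (I 0)"
    unfolding tree_update_loop_def
  proof (rule runs_While_countdown[where I = I])
    show "I (Suc H) M" using M change_ancestors_self by (simp add: I_def y_def)
    fix k M' assume I: "I (Suc k) M'"
    define p where "p = M' POS 0"
    have kH: "k \<le> H" and p: "p = y div 2 ^ (H - k)"
      and M': "unchanged {COUNT, POS} M M'" "M' COUNT = change_ancestors f K y p (M COUNT)"
      using I by (auto simp: I_def p_def)
    have "tree_node H (H - k) p" unfolding p y_def using c by (intro tree_node_ancestor) auto
    note bounds = tree_node_bounds(1,2)[OF this]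
    have next_pos: "y div 2 ^ (Suc H - k) = p div 2"
      using kH unfolding p by (simp add: Suc_diff_le div_mult2_eq[symmetric] mult.commute)
    have val: "M' COUNT (K + p) = M COUNT (K + p)" by (simp add: M' change_ancestors_def)
    have words: "M COUNT (K + p) < W" "M COUNT (K + p) + 1 < W" "K + p < W" "p < W" "K < W"
      using count[OF bounds] leaf_words(1,5) bounds M(3) by linarith+
    have "ancestor p y" by (auto simp: p ancestor_def)
    then have "I k (M'(COUNT := (M' COUNT)(K + p := apply_binop f (M COUNT (K + p)) 1),
        POS := (M' POS)(0 := p div 2)))"
      using kH M' next_pos change_ancestors_parent[OF bounds(1)] by (simp add: I_def)
    then show "(\<exists>x. eval W M' (Var POS) = Some x \<and> x \<noteq> 0) \<and> runs W (tree_update_step f) 20 M' (I k)"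
      unfolding tree_update_step_def
      using words f bounds(1) M(1) M'(1) val leaf_words(1-4)
      by (auto simp: runs_simps p_def[symmetric])
  next
    fix M' assume "I 0 M'"
    then show "eval W M' (Var POS) = Some 0" using last leaf_words by (simp add: I_def)
  qed
  then show ?thesis by (rule runs_conseq) (use last in \<open>auto simp: I_def y_def\<close>)
qed

lemma runs_tree_update:
  assumes F: "F \<subseteq> {..<2 ^ H}" and c: "c < 2 ^ H" and change: "set_change f c F F'"
    and M: "M LEAVES 0 = 2 ^ H" "M TREE 0 = K" "M KEY 0 = c" and K: "K + 2 * 2 ^ H \<le> W"
    and tree: "tree_at H M K F"
  shows "runs W (tree_update f) (25 * (H + 2)) M (\<lambda>M'. unchanged {COUNT, POS} M M' \<and> tree_at H M' K F' \<and>
    (\<forall>i. i \<notin> {K<..<K + 2 * 2 ^ H} \<longrightarrow> M' COUNT i = M COUNT i))"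
proof -
  let ?y = "2 ^ H + c" and ?M = "M(POS := (M POS)(0 := 2 ^ H + c))"
  have f: "f = Plus \<or> f = Minus" using change by (auto simp: set_change_def)
  have loop: "runs W (tree_update_loop f) (23 * Suc H + 3) ?M (\<lambda>M'. unchanged {COUNT, POS} ?M M' \<and>
      M' COUNT = change_ancestors f K ?y 0 (?M COUNT))"
    using tree tree_count_le[OF F] by (intro runs_tree_update_loop c K f) (auto simp: M tree_at_def)
  have "runs W (tree_update_loop f) (25 * (H + 2) - 7) ?M (\<lambda>M'. unchanged {COUNT, POS} M M' \<and>
      tree_at H M' K F' \<and> (\<forall>i. i \<notin> {K<..<K + 2 * 2 ^ H} \<longrightarrow> M' COUNT i = M COUNT i))"
  proof (rule runs_conseq[OF loop])
    fix M' assume M': "unchanged {COUNT, POS} ?M M' \<and>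
      M' COUNT = change_ancestors f K ?y 0 (?M COUNT)"
    have "tree_at H M' K F'"
      using M' tree tree_count_change[OF change finite_leaves[OF F]]
      by (simp add: tree_at_def change_ancestors_def)
    moreover have "\<not> (K < i \<and> ancestor (i - K) ?y)" if "i \<notin> {K<..<K + 2 * 2 ^ H}" for i
      using that ancestor_le[of "i - K" ?y] c by auto
    ultimately show "unchanged {COUNT, POS} M M' \<and> tree_at H M' K F' \<and>
        (\<forall>i. i \<notin> {K<..<K + 2 * 2 ^ H} \<longrightarrow> M' COUNT i = M COUNT i)" using M' by (auto simp: change_ancestors_def)
  qed simp
  then show ?thesis unfolding tree_update_def using M c leaf_words(1,4,6) by (simp add: runs_simps)
qed

definition free_below :: "nat set \<Rightarrow> nat set \<Rightarrow> nat \<Rightarrow> memory \<Rightarrow> bool" where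
  "free_below F1 F2 h M \<longleftrightarrow> (let x = M POS 0; k = tree_count H F1 x + tree_count H F2 x in
     M SPAN 0 = 2 ^ h \<and> tree_node H h x \<and> k < 2 ^ h \<and> x * 2 ^ h + k \<le> 2 ^ H + (card F1 + card F2))"

lemma runs_find_free_step:
  assumes F1: "F1 \<subseteq> {..<2 ^ H}" "tree_at H M K1 F1" and F2: "F2 \<subseteq> {..<2 ^ H}" "tree_at H M K2 F2"
    and M: "M TREE 0 = K1" "M TREE2 0 = K2" and K: "K1 + 2 * 2 ^ H \<le> W" "K2 + 2 * 2 ^ H \<le> W"
    and free: "free_below F1 F2 (Suc h) M"
  shows "runs W find_free_step 35 M (\<lambda>M'. unchanged {POS, SPAN} M M' \<and> free_below F1 F2 h M')"
    (is "runs W _ _ M ?Q")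
proof -
  let ?used = "\<lambda>x. tree_count H F1 x + tree_count H F2 x"
  define x where "x = M POS 0"
  have x: "tree_node H (Suc h) x" and span: "M SPAN 0 = 2 * 2 ^ h" and used: "?used x < 2 * 2 ^ h"
      "x * (2 * 2 ^ h) + ?used x \<le> 2 ^ H + (card F1 + card F2)"
    using free by (simp_all add: free_below_def x_def Let_def)
  have xH: "0 < x" "x < 2 ^ H" using tree_node_bounds(1,4)[OF x] by auto
  have split: "?used x = ?used (2 * x) + ?used (2 * x + 1)"
    using tree_count_children[OF F1(1) xH] tree_count_children[OF F2(1) xH] by simp
  have cells: "M COUNT (K1 + 2 * x) = tree_count H F1 (2 * x)" "M COUNT (K2 + 2 * x) = tree_count H F2 (2 * x)"
    using F1(2) F2(2) xH by (simp_all add: tree_at_def)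
  have words: "2 * x < W" "2 * x + 1 < W" "K1 + 2 * x < W" "K2 + 2 * x < W" "x < W" "2 * 2 ^ h < W" "2 ^ h < W"
    "K1 < W" "K2 < W" "tree_count H F1 (2 * x) < W" "tree_count H F2 (2 * x) < W" "?used (2 * x) < W"
    using K xH W tree_count_le[OF F1(1), of "2 * x"] tree_count_le[OF F2(1), of "2 * x"]
      tree_node_bounds(5)[OF x] by simp_all
  have "?Q (M(SPAN := (M SPAN)(0 := 2 ^ h), POS := (M POS)(0 := 2 * x)))" if "?used (2 * x) < 2 ^ h"
    using that tree_node_children[OF x] used split by (simp add: free_below_def Let_def algebra_simps)
  moreover have "?Q (M(SPAN := (M SPAN)(0 := 2 ^ h), POS := (M POS)(0 := 2 * x + 1)))"
    if "\<not> ?used (2 * x) < 2 ^ h"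
    using that tree_node_children[OF x] used split by (simp add: free_below_def Let_def algebra_simps)
  ultimately show ?thesis
    unfolding find_free_step_def
    using M span words cells leaf_words(1-4) by (simp add: runs_simps x_def[symmetric])
qed

lemma runs_find_free_loop:
  assumes F1: "F1 \<subseteq> {..<2 ^ H}" "tree_at H M K1 F1" and F2: "F2 \<subseteq> {..<2 ^ H}" "tree_at H M K2 F2"
    and M: "M LEAVES 0 = 2 ^ H" "M TREE 0 = K1" "M TREE2 0 = K2" "M POS 0 = 1" "M SPAN 0 = 2 ^ H"
    and K: "K1 + 2 * 2 ^ H \<le> W" "K2 + 2 * 2 ^ H \<le> W" and card: "card F1 + card F2 < 2 ^ H"
  shows "runs W find_free_loop (41 * H + 6) M
    (\<lambda>M'. unchanged {POS, SPAN} M M' \<and> (\<exists>c<2 ^ H. M' POS 0 = 2 ^ H + c \<and>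
       c \<le> card F1 + card F2 \<and> c \<notin> F1 \<and> c \<notin> F2))"
    (is "runs W _ _ M ?Q")
proof -
  let ?b = "Var POS \<prec> Var LEAVES" and ?I = "\<lambda>h M'. unchanged {POS, SPAN} M M' \<and> free_below F1 F2 h M'"
  have "runs W find_free_loop (H * (35 + 1 + expr_cost ?b) + (1 + expr_cost ?b)) M (?I 0)"
    unfolding find_free_loop_def
  proof (rule runs_While_countdown[where I = ?I])
    show "?I H M"
      using card M tree_node_root[of H] tree_count_root[OF F1(1)] tree_count_root[OF F2(1)]
      by (simp add: free_below_def)
  next
    fix M' assume "?I 0 M'"
    then show "eval W M' ?b = Some 0"
      using M(1) leaf_words(1,2,4,6) tree_node_bounds(2) by (auto simp: free_below_def Let_def tree_node_leaf)
  next
    fix h M' assume I: "?I (Suc h) M'"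
    have trees: "tree_at H M' K1 F1" "tree_at H M' K2 F2" using I F1(2) F2(2) by (simp_all add: tree_at_def)
    have "tree_node H (Suc h) (M' POS 0)" using I by (simp add: free_below_def Let_def)
    then have "M' POS 0 < 2 ^ H" by (rule tree_node_bounds(4)) simp
    then have "\<exists>y. eval W M' ?b = Some y \<and> y \<noteq> 0" using I M(1) leaf_words(1-4,6) by simp
    moreover have "runs W find_free_step 35 M' (?I h)"
      by (rule runs_conseq[OF runs_find_free_step[OF F1(1) trees(1) F2(1) trees(2) _ _ K]]) (use I M in auto)
    ultimately show "(\<exists>y. eval W M' ?b = Some y \<and> y \<noteq> 0) \<and> runs W find_free_step 35 M' (?I h)" ..
  qed
  then show ?thesis
  proof (rule runs_conseq)
    fix M' assume "?I 0 M'"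
    then obtain c where c: "c < 2 ^ H" "M' POS 0 = 2 ^ H + c" "unchanged {POS, SPAN} M M'"
      and "tree_count H F1 (2 ^ H + c) + tree_count H F2 (2 ^ H + c) = 0" "c \<le> card F1 + card F2"
      by (auto simp: free_below_def Let_def tree_node_leaf)
    then show "?Q M'" using tree_count_leaf[OF F1(1) c(1)] tree_count_leaf[OF F2(1) c(1)]
      by (auto split: if_splits)
  qed simp
qed

lemma runs_find_free:
  assumes "F1 \<subseteq> {..<2 ^ H}" "tree_at H M K1 F1" "F2 \<subseteq> {..<2 ^ H}" "tree_at H M K2 F2"
    and M: "M LEAVES 0 = 2 ^ H" "M TREE 0 = K1" "M TREE2 0 = K2"
    and "K1 + 2 * 2 ^ H \<le> W" "K2 + 2 * 2 ^ H \<le> W" "card F1 + card F2 < 2 ^ H"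
  shows "runs W find_free (50 * (H + 1)) M (\<lambda>M'. unchanged {KEY, POS, SPAN} M M' \<and>
    M' KEY 0 < 2 ^ H \<and> M' KEY 0 \<notin> F1 \<and> M' KEY 0 \<notin> F2 \<and> M' KEY 0 \<le> card F1 + card F2)"
    (is "runs W _ _ M ?Q")
proof -
  let ?M = "M(POS := (M POS)(0 := 1), SPAN := (M SPAN)(0 := 2 ^ H))"
  have "runs W (find_free_loop ;; KEY ::= Var POS \<ominus> Var LEAVES) (41 * H + 13) ?M ?Q"
  proof (rule runs_SeqI[where ?T2.0 = 7])
    show "runs W find_free_loop (41 * H + 6) ?M (\<lambda>M'. unchanged {POS, SPAN} ?M M' \<and>
        (\<exists>c<2 ^ H. M' POS 0 = 2 ^ H + c \<and> c \<le> card F1 + card F2 \<and> c \<notin> F1 \<and> c \<notin> F2))"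
      by (rule runs_find_free_loop[where ?K1.0 = K1 and ?K2.0 = K2]) (use assms in \<open>auto simp: tree_at_def\<close>)
  qed (use M(1) leaf_words in \<open>auto simp: runs_simps\<close>)
  then show ?thesis
    unfolding find_free_def using M(1) leaf_words(1-4) by (auto simp: runs_simps elim: runs_conseq)
qed

definition rank_below :: "nat set \<Rightarrow> nat \<Rightarrow> nat \<Rightarrow> memory \<Rightarrow> bool" where
  "rank_below F k h M \<longleftrightarrow> (let x = M POS 0 in tree_node H h x \<and> M REST 0 < tree_count H F x \<and>
     card {c \<in> F. 2 ^ H + c < x * 2 ^ h} + M REST 0 = k)"

lemma runs_select_step:
  assumes F: "F \<subseteq> {..<2 ^ H}" "tree_at H M K F" and K: "K + 2 * 2 ^ H \<le> W" and M: "M TREE 0 = K"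
    and below: "rank_below F k (Suc h) M"
  shows "runs W select_step 34 M (\<lambda>M'. unchanged {POS, REST} M M' \<and> rank_below F k h M')"
    (is "runs W _ _ M ?Q")
proof -
  define x where "x = M POS 0"
  define q where "q = M REST 0"
  have x: "tree_node H (Suc h) x"
    and q: "q < tree_count H F x" "card {c \<in> F. 2 ^ H + c < x * (2 * 2 ^ h)} + q = k"
    using below by (simp_all add: rank_below_def x_def q_def Let_def)
  have xH: "0 < x" "x < 2 ^ H" using tree_node_bounds(1,4)[OF x] by auto
  note children = tree_node_children[OF x]
  have left: "card {c \<in> F. 2 ^ H + c < (2 * x + 1) * 2 ^ h} =
      card {c \<in> F. 2 ^ H + c < x * (2 * 2 ^ h)} + tree_count H F (2 * x)"
    using card_left_of_node[OF F(1), of h "2 * x"] children by (simp add: mult.assoc mult.left_commute)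
  have cell: "M COUNT (K + 2 * x) = tree_count H F (2 * x)"
    using F(2) xH by (simp add: tree_at_def)
  have words: "2 * x < W" "2 * x + 1 < W" "K + 2 * x < W" "x < W" "K < W" "q < W" "tree_count H F (2 * x) < W"
    using K xH W tree_count_le[OF F(1), of "2 * x"] tree_count_le[OF F(1), of x] q(1) by simp_all
  have "?Q (M(POS := (M POS)(0 := 2 * x)))" if "q < tree_count H F (2 * x)"
    using that children q by (simp add: rank_below_def Let_def q_def mult.assoc mult.left_commute)
  moreover have "?Q (M(REST := (M REST)(0 := q - tree_count H F (2 * x)), POS := (M POS)(0 := 2 * x + 1)))"
    if "\<not> q < tree_count H F (2 * x)"
    using that children q left tree_count_children[OF F(1) xH] by (simp add: rank_below_def Let_def)
  ultimately show ?thesis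
    unfolding select_step_def
    using M words cell leaf_words(1-4) by (simp add: runs_simps x_def[symmetric] q_def[symmetric] fun_upd_twist)
qed

lemma runs_select_loop:
  assumes F: "F \<subseteq> {..<2 ^ H}" "tree_at H M K F" and K: "K + 2 * 2 ^ H \<le> W"
    and M: "M LEAVES 0 = 2 ^ H" "M TREE 0 = K" "M POS 0 = 1" and k: "M REST 0 = k" "k < card F"
  shows "runs W select_loop (40 * H + 6) M
    (\<lambda>M'. unchanged {POS, REST} M M' \<and> (\<exists>c\<in>F. M' POS 0 = 2 ^ H + c \<and> rank F c = k))"
    (is "runs W _ _ M ?Q")
proof -
  let ?b = "Var POS \<prec> Var LEAVES" and ?I = "\<lambda>h M'. unchanged {POS, REST} M M' \<and> rank_below F k h M'"
  have "runs W select_loop (H * (34 + 1 + expr_cost ?b) + (1 + expr_cost ?b)) M (?I 0)"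
    unfolding select_loop_def
  proof (rule runs_While_countdown[where I = ?I])
    show "?I H M" using k M tree_node_root[of H] tree_count_root[OF F(1)] by (simp add: rank_below_def)
  next
    fix M' assume "?I 0 M'"
    then show "eval W M' ?b = Some 0"
      using M(1) leaf_words(1,2,4,6) by (auto simp: rank_below_def Let_def tree_node_leaf)
  next
    fix h M' assume I: "?I (Suc h) M'"
    have tree: "tree_at H M' K F" using I F(2) by (simp add: tree_at_def)
    have "tree_node H (Suc h) (M' POS 0)" using I by (simp add: rank_below_def Let_def)
    then have "M' POS 0 < 2 ^ H" by (rule tree_node_bounds(4)) simp
    then have "\<exists>y. eval W M' ?b = Some y \<and> y \<noteq> 0" using I M(1) leaf_words(1-4,6) by simp
    moreover have "runs W select_step 34 M' (?I h)"
      by (rule runs_conseq[OF runs_select_step[OF F(1) tree K]]) (use I M in auto)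
    ultimately show "(\<exists>y. eval W M' ?b = Some y \<and> y \<noteq> 0) \<and> runs W select_step 34 M' (?I h)" ..
  qed
  then show ?thesis
  proof (rule runs_conseq)
    fix M' assume I: "?I 0 M'"
    then obtain c where c: "c < 2 ^ H" "M' POS 0 = 2 ^ H + c" "unchanged {POS, REST} M M'"
      and "M' REST 0 < tree_count H F (2 ^ H + c)" "rank F c + M' REST 0 = k"
      by (auto simp: rank_below_def Let_def tree_node_leaf rank_def)
    then show "?Q M'" using tree_count_leaf[OF F(1) c(1)] by (auto split: if_splits)
  qed simp
qed

lemma runs_select:
  assumes F: "F \<subseteq> {..<2 ^ H}" "tree_at H M K F" and K: "K + 2 * 2 ^ H \<le> W"
    and M: "M LEAVES 0 = 2 ^ H" "M TREE 0 = K" and k: "M RANK 0 = k" "k < card F"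
  shows "runs W select (50 * (H + 1)) M (\<lambda>M'. unchanged {KEY, POS, REST} M M' \<and>
    M' KEY 0 \<in> F \<and> rank F (M' KEY 0) = k)"
    (is "runs W _ _ M ?Q")
proof -
  let ?M = "M(POS := (M POS)(0 := 1), REST := (M REST)(0 := k))"
  have kW: "k < W" using k(2) tree_count_root[OF F(1)] tree_count_le[OF F(1), of 1] leaf_words(1) by linarith
  have "runs W (select_loop ;; KEY ::= Var POS \<ominus> Var LEAVES) (40 * H + 13) ?M ?Q"
  proof (rule runs_SeqI[where ?T2.0 = 7])
    show "runs W select_loop (40 * H + 6) ?M (\<lambda>M'. unchanged {POS, REST} ?M M' \<and>
        (\<exists>c\<in>F. M' POS 0 = 2 ^ H + c \<and> rank F c = k))"
      by (rule runs_select_loop) (use assms in \<open>auto simp: tree_at_def\<close>)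
  qed (use M(1) leaf_words F(1) in \<open>auto simp: runs_simps\<close>)
  then show ?thesis
    unfolding select_def using M(1) k(1) kW leaf_words(1-4) by (auto simp: runs_simps elim: runs_conseq)
qed

end

section \<open>The stored graph\<close>

text \<open>Every edge has a color (counted from 0) and a bucket. There is one counting tree for the colors of
  every bucket of every node, and the bucket number \<open>B - 1\<close> stands for all edges at the node.\<close>

type_synonym state = "nat set \<rightharpoonup> nat \<times> nat"

definition update_bucket :: "binop \<Rightarrow> nat \<Rightarrow> expr \<Rightarrow> com" where
  "update_bucket f r e = TREE ::= (Var r \<otimes> Var STRIDE \<oplus> e) \<otimes> Var STRIDE ;; tree_update f"

definition update_trees :: "binop \<Rightarrow> com" where
  "update_trees f =
     update_bucket f TAIL (Var SLOT) ;; update_bucket f TAIL (Var STRIDE \<ominus> Const 1) ;;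
     update_bucket f HEAD (Var SLOT) ;; update_bucket f HEAD (Var STRIDE \<ominus> Const 1)"

definition store_edge :: com where
  "store_edge =
     Write COLOR (Var TAIL \<otimes> Var INPUT \<oplus> Var HEAD) (Var KEY \<oplus> Const 1) ;;
     Write COLOR (Var HEAD \<otimes> Var INPUT \<oplus> Var TAIL) (Var KEY \<oplus> Const 1) ;;
     Write BUCKET (Var TAIL \<otimes> Var INPUT \<oplus> Var HEAD) (Var SLOT) ;;
     Write BUCKET (Var HEAD \<otimes> Var INPUT \<oplus> Var TAIL) (Var SLOT) ;;
     Write MATE (Var TAIL \<otimes> Var STRIDE \<oplus> Var KEY) (Var HEAD) ;;
     Write MATE (Var HEAD \<otimes> Var STRIDE \<oplus> Var KEY) (Var TAIL)"

definition remove_edge :: com where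
  "remove_edge = KEY ::= Read COLOR (Var TAIL \<otimes> Var INPUT \<oplus> Var HEAD) \<ominus> Const 1 ;;
     SLOT ::= Read BUCKET (Var TAIL \<otimes> Var INPUT \<oplus> Var HEAD) ;; update_trees Minus"

definition add_edge :: com where
  "add_edge = update_trees Plus ;; store_edge"

lemma index_inject:
  "b < k \<Longrightarrow> b' < k \<Longrightarrow> a * k + b = a' * k + b' \<longleftrightarrow> a = a' \<and> b = b'" for a b k :: nat
  by (metis add.commute mod_less mod_mult_self2 mult.commute add_right_cancel
      mult_cancel1 not_less_zero)

locale coloring_ram =
  fixes n \<alpha> N H W :: nat
  assumes n_ge: "2 \<le> n" and \<alpha>_ge: "1 \<le> \<alpha>" and N_ge: "1 \<le> N"
    and H_ge: "2 * n \<le> 2 ^ H" and H_le: "2 ^ H < 4 * n"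
    and W_ge: "\<alpha> * (4 * N * 2 ^ H) ^ 3 \<le> W"
begin

definition B :: nat where "B = 4 * N * 2 ^ H"

definition L :: nat where "L = 2 * N * H"

definition full :: nat where "full = B - 1"

lemma B_bounds: "4 * 2 ^ H \<le> B" "16 * N \<le> B" "2 * L \<le> B" "8 * (n * N) \<le> B" "8 * n \<le> B" "16 \<le> B" "2 \<le> H"
proof -
  have P: "4 \<le> (2::nat) ^ H" using n_ge H_ge by simp
  show leaves: "4 * 2 ^ H \<le> B" using N_ge by (simp add: B_def)
  then show "16 \<le> B" using P by simp
  show "8 * n \<le> B" using leaves H_ge by simp
  have "4 * N * 4 \<le> B" unfolding B_def using P by (rule mult_left_mono) simp
  then show "16 * N \<le> B" by simp
  have "4 * N * (2 * n) \<le> B" unfolding B_def using H_ge by (rule mult_left_mono) simp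
  then show "8 * (n * N) \<le> B" by (simp add: algebra_simps)
  have "4 * N * H \<le> 4 * N * 2 ^ H" by (rule mult_left_mono) (simp_all add: less_imp_le)
  then show "2 * L \<le> B" by (simp add: L_def B_def)
  have "(2::nat) ^ 2 \<le> 2 ^ H" using P by simp
  then show "2 \<le> H" by (rule power_le_imp_le_exp[rotated]) simp
qed

lemma L_ge: "4 * N \<le> L"
  unfolding L_def using mult_le_mono2[OF B_bounds(7), of "2 * N"] by simp

lemma full_bounds: "full < B" "B - 1 = full" "full + 1 = B" "L + 2 \<le> full" "0 < full"
  unfolding full_def using B_bounds by simp_all

lemma B_cube: "B * B * B \<le> W" "\<alpha> * (B * B * B) \<le> W"
proof -
  show bound: "\<alpha> * (B * B * B) \<le> W" using W_ge by (simp add: B_def power3_eq_cube)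
  have "1 * (B * B * B) \<le> \<alpha> * (B * B * B)" using \<alpha>_ge by (rule mult_right_mono) simp
  then show "B * B * B \<le> W" using bound by linarith
qed

lemma B_square: "B * B < W"
proof -
  have "B * B * 16 \<le> B * B * B" using B_bounds(6) by (rule mult_left_mono) simp
  moreover have "0 < B * B" using B_bounds(6) by simp
  ultimately show ?thesis using B_cube(1) by linarith
qed

lemma B_less_W: "4 * B < W"
proof -
  have "16 * B \<le> B * B" using B_bounds(6) by (rule mult_right_mono) simp
  then show ?thesis using B_square by linarith
qed

lemma word_small [simp]: "n < W" "B < W" "2 ^ H < W" "0 < W" "1 < W" "2 < W" "3 < W" "4 < W" "full < W"
  "x < 2 ^ H \<Longrightarrow> x < W" "x < 2 ^ H \<Longrightarrow> x + 1 < W" "j < B \<Longrightarrow> j < W" "v < n \<Longrightarrow> v < W"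
  using B_less_W B_bounds full_bounds(1) by linarith+

lemma four_leaves_le_W: "4 * 2 ^ H \<le> W"
  using B_less_W B_bounds(1) by linarith

abbreviation tree_base :: "nat \<Rightarrow> nat \<Rightarrow> nat" where
  "tree_base v j \<equiv> (v * B + j) * B"

lemma index_less: "v < B \<Longrightarrow> j < B \<Longrightarrow> v * B + j < B * B"
  using mult_le_mono1[of "Suc v" B B] by simp

lemma tree_base_bound:
  assumes "v < n" "j < B"
  shows "tree_base v j + B \<le> W"
proof -
  have "v * B + j < B * B" using assms B_bounds(5) by (intro index_less) auto
  then have "Suc (v * B + j) * B \<le> B * B * B" by (intro mult_le_mono1) simp
  then show ?thesis using B_cube(1) by simp
qed

lemma tree_words: "v < n \<Longrightarrow> j < B \<Longrightarrow> tree_base v j + 2 * 2 ^ H \<le> W"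
  using tree_base_bound B_bounds(1) by fastforce

lemma word_index [simp]:
  assumes "v < n"
  shows "j < B \<Longrightarrow> v * B + j < W" "v * B < W" "j < B \<Longrightarrow> tree_base v j < W"
    "j < B \<Longrightarrow> x < B \<Longrightarrow> tree_base v j + x < W" "w < n \<Longrightarrow> v * n + w < W" "v * n < W"
proof -
  have v: "v < B" "n \<le> B" using assms B_bounds(5) by auto
  show bucket: "v * B + j < W" if "j < B" for j using index_less[OF v(1) that] B_square by simp
  then show "v * B < W" using B_bounds(6) by fastforce
  show "tree_base v j + x < W" if "j < B" "x < B" for x using tree_base_bound[OF assms that(1)] that(2) by simp
  then show "tree_base v j < W" if "j < B" using that B_bounds(6) by fastforce
  show pair: "v * n + w < W" if "w < n" for w
  proof -
    have "v * n \<le> v * B" using v(2) by simp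
    then show ?thesis using bucket[of w] that v(2) by linarith
  qed
  from pair[of 0] show "v * n < W" using assms by simp
qed

definition colors :: "state \<Rightarrow> nat \<Rightarrow> nat \<Rightarrow> nat set" where
  "colors S v j = {c. \<exists>w j'. S {v, w} = Some (c, j') \<and> (j = j' \<or> j = full)}"

definition valid_state :: "state \<Rightarrow> bool" where
  "valid_state S \<longleftrightarrow> graph_on n (dom S) \<and>
     (\<forall>e c j. S e = Some (c, j) \<longrightarrow> c < 2 ^ H \<and> j < full) \<and>
     (\<forall>v w w' c j j'. S {v, w} = Some (c, j) \<longrightarrow> S {v, w'} = Some (c, j') \<longrightarrow> w = w')"

definition tables_at :: "state \<Rightarrow> memory \<Rightarrow> bool" where
  "tables_at S M \<longleftrightarrow> (\<forall>u v c j. S {u, v} = Some (c, j) \<longrightarrow>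
     M COLOR (u * n + v) = c + 1 \<and> M BUCKET (u * n + v) = j \<and> M MATE (u * B + c) = v)"

definition trees_at :: "(nat \<Rightarrow> nat \<Rightarrow> nat set) \<Rightarrow> memory \<Rightarrow> bool" where
  "trees_at G M \<longleftrightarrow> (\<forall>v<n. \<forall>j<B. tree_at H M (tree_base v j) (G v j))"

definition represents :: "state \<Rightarrow> (nat \<Rightarrow> nat) \<Rightarrow> memory \<Rightarrow> bool" where
  "represents S l M \<longleftrightarrow> valid_state S \<and> M INPUT 0 = n \<and> M INPUT 1 = \<alpha> \<and>
     (\<forall>v<n. M LEVEL v = l v \<and> l v < full) \<and> tables_at S M \<and> trees_at (colors S) M"

definition ready :: "state \<Rightarrow> (nat \<Rightarrow> nat) \<Rightarrow> memory \<Rightarrow> bool" where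
  "ready S l M \<longleftrightarrow> represents S l M \<and> M LEAVES 0 = 2 ^ H \<and> M STRIDE 0 = B"

lemma represents_cong:
  assumes "\<And>a. a \<in> {INPUT, COLOR, BUCKET, MATE, LEVEL, COUNT} \<Longrightarrow> M' a = M a"
  shows "represents S l M' \<longleftrightarrow> represents S l M"
  by (simp add: represents_def tables_at_def trees_at_def tree_at_def assms)

lemma ready_cong:
  assumes "\<And>a. a \<in> {INPUT, COLOR, BUCKET, MATE, LEVEL, COUNT, LEAVES, STRIDE} \<Longrightarrow> M' a = M a"
  shows "ready S l M' \<longleftrightarrow> ready S l M"
proof -
  have "represents S l M' \<longleftrightarrow> represents S l M" by (rule represents_cong) (use assms in auto)
  then show ?thesis using assms by (simp add: ready_def)
qed

lemma ready_unchanged: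
  assumes "ready S l M" "unchanged X M M'"
    and "X \<inter> {INPUT, COLOR, BUCKET, MATE, LEVEL, COUNT, LEAVES, STRIDE} = {}"
  shows "ready S l M'"
  using ready_cong[of M' M S l] assms by (metis disjoint_iff)

lemma ready_upd [simp]:
  "a \<notin> {INPUT, COLOR, BUCKET, MATE, LEVEL, COUNT, LEAVES, STRIDE} \<Longrightarrow> ready S l (M(a := f)) \<longleftrightarrow> ready S l M"
  by (rule ready_cong) auto

lemma valid_stateD:
  assumes "valid_state S" "S {u, v} = Some (c, j)"
  shows "u < n" "v < n" "u \<noteq> v" "c < 2 ^ H" "j < full" "S {v, u} = Some (c, j)"
    "S {u, w} = Some (c, i) \<Longrightarrow> w = v"
proof -
  have "v \<in> neighbors (dom S) u" using assms by (auto simp: neighbors_def)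
  then show "u < n" "v < n" "u \<noteq> v" using assms graph_on_neighbors by (auto simp: valid_state_def)
  show "c < 2 ^ H" "j < full" using assms by (auto simp: valid_state_def)
  show "S {v, u} = Some (c, j)" using assms by (simp add: insert_commute)
  show "w = v" if "S {u, w} = Some (c, i)" using assms that unfolding valid_state_def by blast
qed

lemma colors_bounded: "valid_state S \<Longrightarrow> colors S v j \<subseteq> {..<2 ^ H}"
  by (auto simp: colors_def valid_state_def)

lemma colorsE:
  assumes "c \<in> colors S v j"
  obtains w j' where "S {v, w} = Some (c, j')" "j = j' \<or> j = full"
  using assms by (auto simp: colors_def)

lemma valid_state_map_le:
  assumes "valid_state S'" "S \<subseteq>\<^sub>m S'"
  shows "valid_state S"
proof -
  have le: "S' e = Some x" if "S e = Some x" for e x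
    using assms(2) that by (metis domI map_le_def)
  show ?thesis unfolding valid_state_def
  proof (intro conjI allI impI)
    show "graph_on n (dom S)"
      using assms(1) map_le_implies_dom_le[OF assms(2)] unfolding valid_state_def graph_on_def by (meson subsetD)
    show "c < 2 ^ H" "j < full" if "S e = Some (c, j)" for e c j
      using le[OF that] assms(1) by (auto simp: valid_state_def)
    show "w = w'" if "S {v, w} = Some (c, j)" "S {v, w'} = Some (c, j')" for v w w' c j j'
      using valid_stateD(7)[OF assms(1) le[OF that(2)] le[OF that(1)]] .
  qed
qed

lemma valid_state_insert:
  assumes S: "valid_state S" "S {u, v} = None" and uv: "u < n" "v < n" "u \<noteq> v" "c < 2 ^ H" "j < full"
    and free: "c \<notin> colors S u full" "c \<notin> colors S v full"
  shows "valid_state (S({u, v} \<mapsto> (c, j)))"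
proof -
  let ?S = "S({u, v} \<mapsto> (c, j))"
  have pair: "{a, b} = {u, v} \<longleftrightarrow> a = u \<and> b = v \<or> a = v \<and> b = u" for a b by (auto simp: doubleton_eq_iff)
  have new: "S {u, w} \<noteq> Some (c, i)" "S {v, w} \<noteq> Some (c, i)" for w i
    using free by (auto simp: colors_def)
  show ?thesis unfolding valid_state_def
  proof (intro conjI allI impI)
    show "graph_on n (dom ?S)" using S uv unfolding valid_state_def graph_on_def by auto
    show "k < 2 ^ H" "i < full" if "?S e = Some (k, i)" for e k i
      using S uv that by (auto simp: valid_state_def split: if_splits)
    show "w = w'" if "?S {x, w} = Some (k, i)" "?S {x, w'} = Some (k, i')" for x w w' k i i'
    proof (cases "{x, w} = {u, v} \<or> {x, w'} = {u, v}")
      case True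
      then show ?thesis using that new uv(3) by (auto simp: pair split: if_splits)
    next
      case False
      then have "S {x, w} = Some (k, i)" "S {x, w'} = Some (k, i')" using that by auto
      then show ?thesis using S(1) unfolding valid_state_def by blast
    qed
  qed
qed

lemma colors_insert:
  assumes S: "S {u, v} = None"
  shows "colors (S({u, v} \<mapsto> (c, j))) a b =
    (if a \<in> {u, v} \<and> b \<in> {j, full} then insert c (colors S a b) else colors S a b)"
proof -
  have endpoint: "colors (S({x, y} \<mapsto> (c, j))) x b =
      (if b \<in> {j, full} then insert c (colors S x b) else colors S x b)" if "S {x, y} = None" for x y
  proof -
    have "(S({x, y} \<mapsto> (c, j))) {x, w} = Some (d, i) \<longleftrightarrow>
        w = y \<and> d = c \<and> i = j \<or> S {x, w} = Some (d, i)" for w d i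
      using that by (auto simp: doubleton_eq_iff)
    then show ?thesis unfolding colors_def by auto
  qed
  consider (tail) "a = u" | (head) "a = v" | (other) "a \<notin> {u, v}" by blast
  then show ?thesis
  proof cases
    case tail
    then show ?thesis using endpoint[OF S] by simp
  next
    case head
    then show ?thesis using endpoint[of v u] S by (simp add: insert_commute)
  next
    case other
    then have "{a, w} \<noteq> {u, v}" for w by (auto simp: doubleton_eq_iff)
    then show ?thesis using other by (simp add: colors_def)
  qed
qed

lemma color_of_edge_new:
  assumes S: "S {u, v} = None" "valid_state (S({u, v} \<mapsto> (c, j)))" and a: "a \<in> {u, v}"
  shows "c \<notin> colors S a b"
proof
  assume "c \<in> colors S a b"
  then obtain w i where w: "S {a, w} = Some (c, i)" by (rule colorsE)
  obtain z where z: "{a, z} = {u, v}" using a by (auto simp: insert_commute)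
  have "{a, w} \<noteq> {u, v}" using w S(1) by auto
  then have "(S({u, v} \<mapsto> (c, j))) {a, w} = Some (c, i)" "(S({u, v} \<mapsto> (c, j))) {a, z} = Some (c, j)"
    using w z by simp_all
  then have "w = z" using valid_stateD(7)[OF S(2)] by blast
  then show False using w z S(1) by simp
qed

lemma set_change_colors:
  assumes "S {u, v} = None" "valid_state (S({u, v} \<mapsto> (c, j)))" "a \<in> {u, v}" "b \<in> {j, full}"
  shows "set_change Plus c (colors S a b) (colors (S({u, v} \<mapsto> (c, j))) a b)"
    and "set_change Minus c (colors (S({u, v} \<mapsto> (c, j))) a b) (colors S a b)"
  using color_of_edge_new[OF assms(1-3)] assms(3,4)
  by (simp_all add: set_change_def colors_insert[of S, OF assms(1)])

lemma trees_at_update: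
  assumes G: "trees_at G M" and v: "v < n" "j < B" and tree: "tree_at H M' (tree_base v j) F"
    and rest: "\<And>i. i \<notin> {tree_base v j<..<tree_base v j + 2 * 2 ^ H} \<Longrightarrow> M' COUNT i = M COUNT i"
  shows "trees_at (\<lambda>a b. if a = v \<and> b = j then F else G a b) M'"
  unfolding trees_at_def
proof (intro allI impI)
  fix a b assume a: "a < n" "b < B"
  show "tree_at H M' (tree_base a b) (if a = v \<and> b = j then F else G a b)"
  proof (cases "a = v \<and> b = j")
    case False
    have "M' COUNT (tree_base a b + x) = M COUNT (tree_base a b + x)" if x: "x < 2 * 2 ^ H" for x
    proof (rule rest, rule notI)
      assume i: "tree_base a b + x \<in> {tree_base v j<..<tree_base v j + 2 * 2 ^ H}"
      define y where "y = tree_base a b + x - tree_base v j"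
      have "y < B" "x < B" "tree_base a b + x = tree_base v j + y"
        using i x B_bounds(1) by (auto simp: y_def)
      then have "a * B + b = v * B + j" using index_inject by blast
      then show False using index_inject[OF a(2) v(2)] False by blast
    qed
    then show ?thesis using G a False by (auto simp: trees_at_def tree_at_def)
  qed (use tree in simp)
qed

lemma runs_update_bucket:
  assumes M: "M LEAVES 0 = 2 ^ H" "M STRIDE 0 = B" "M r 0 = v" "v < n" "M KEY 0 = c" "c < 2 ^ H"
    and e: "eval W M e = Some j" "j < B"
    and G: "trees_at G M" "G v j \<subseteq> {..<2 ^ H}" and change: "set_change f c (G v j) F"
  shows "runs W (update_bucket f r e) (25 * (H + 2) + 11 + expr_cost e) M
    (\<lambda>M'. unchanged {COUNT, TREE, POS} M M' \<and> trees_at (\<lambda>a b. if a = v \<and> b = j then F else G a b) M')"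
    (is "runs W _ _ M ?Q")
proof -
  let ?M = "M(TREE := (M TREE)(0 := tree_base v j))"
  have "runs W (tree_update f) (25 * (H + 2)) ?M ?Q"
  proof (rule runs_conseq[OF runs_tree_update[OF four_leaves_le_W G(2) M(6) change]])
    show "tree_at H ?M (tree_base v j) (G v j)" using G(1) M(4) e(2) by (simp add: trees_at_def tree_at_def)
    show "tree_base v j + 2 * 2 ^ H \<le> W" by (rule tree_words[OF M(4) e(2)])
    fix M' assume "unchanged {COUNT, POS} ?M M' \<and> tree_at H M' (tree_base v j) F \<and>
      (\<forall>i. i \<notin> {tree_base v j<..<tree_base v j + 2 * 2 ^ H} \<longrightarrow> M' COUNT i = ?M COUNT i)"
    then show "?Q M'" using trees_at_update[OF G(1) M(4) e(2)] by simp
  qed (use M in auto)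
  then show ?thesis unfolding update_bucket_def using M e by (simp add: runs_simps)
qed

lemma runs_update_trees:
  assumes M: "M LEAVES 0 = 2 ^ H" "M STRIDE 0 = B" "M TAIL 0 = u" "u < n" "M HEAD 0 = v" "v < n" "u \<noteq> v"
    "M KEY 0 = c" "c < 2 ^ H" "M SLOT 0 = j" "j < full"
    and G: "trees_at G M" "\<And>a b. G a b \<subseteq> {..<2 ^ H}"
    and change: "\<And>a b. a \<in> {u, v} \<Longrightarrow> b \<in> {j, full} \<Longrightarrow> set_change f c (G a b) (G' a b)"
    and same: "\<And>a b. \<not> (a \<in> {u, v} \<and> b \<in> {j, full}) \<Longrightarrow> G' a b = G a b"
  shows "runs W (update_trees f) (100 * (H + 2) + 60) M
    (\<lambda>M'. unchanged {COUNT, TREE, POS} M M' \<and> trees_at G' M')"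
proof -
  define mixed where "mixed X a b = (if (a, b) \<in> X then G' a b else G a b)" for X a b
  define P where "P X M' \<longleftrightarrow> unchanged {COUNT, TREE, POS} M M' \<and> trees_at (mixed X) M'" for X M'
  have step: "runs W (update_bucket f r e) (25 * (H + 2) + 15) M' (P (insert (a, b) X))"
    if P: "P X M'" and a: "(r, a) \<in> {(TAIL, u), (HEAD, v)}"
      and b: "(e, b) \<in> {(Var SLOT, j), (Var STRIDE \<ominus> Const 1, full)}" and new: "(a, b) \<notin> X" for X M' r a e b
  proof (rule runs_conseq[OF runs_update_bucket[
          where v = a and j = b and c = c and G = "mixed X" and F = "G' a b"]])
    have "j < B" using M(11) full_bounds(1) by simp
    then show "eval W M' e = Some b" "b < B" using P b M full_bounds by (auto simp: P_def)
    show "25 * (H + 2) + 11 + expr_cost e \<le> 25 * (H + 2) + 15" using b by auto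
    show "set_change f c (mixed X a b) (G' a b)" using a b new by (auto simp: mixed_def intro!: change)
    show "mixed X a b \<subseteq> {..<2 ^ H}" using G(2) new by (simp add: mixed_def)
    have "mixed (insert (a, b) X) = (\<lambda>a' b'. if a' = a \<and> b' = b then G' a b else mixed X a' b')"
      by (auto simp: mixed_def fun_eq_iff)
    then show "P (insert (a, b) X) M''" if "unchanged {COUNT, TREE, POS} M' M'' \<and>
        trees_at (\<lambda>a' b'. if a' = a \<and> b' = b then G' a b else mixed X a' b') M''" for M''
      using P that by (simp add: P_def)
  qed (use P a M in \<open>auto simp: P_def\<close>)
  have jf: "j \<noteq> full" using M(11) by simp
  let ?all = "{(v, full), (v, j), (u, full), (u, j)}"
  have all: "unchanged {COUNT, TREE, POS} M M' \<and> trees_at G' M'" if "P ?all M'" for M'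
  proof -
    have "mixed ?all a b = G' a b" for a b using same[of a b] by (auto simp: mixed_def)
    then have "mixed ?all = G'" by (intro ext)
    then show ?thesis using that by (simp add: P_def)
  qed
  have "mixed {} = G" by (simp add: mixed_def fun_eq_iff)
  then have "P {} M" using G(1) by (simp add: P_def)
  then show ?thesis unfolding update_trees_def
    by (intro runs_SeqI[OF step runs_SeqI[OF step runs_SeqI[OF step runs_conseq[OF step order.refl all]]]])
      (use M(7) jf in auto)
qed

lemma runs_store_edge:
  assumes M: "M INPUT 0 = n" "M STRIDE 0 = B" "M TAIL 0 = u" "M HEAD 0 = v" "M KEY 0 = c" "M SLOT 0 = j"
    and S: "tables_at S M" "S {u, v} = None" "valid_state (S({u, v} \<mapsto> (c, j)))"
  shows "runs W store_edge 70 M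
    (\<lambda>M'. unchanged {COLOR, BUCKET, MATE} M M' \<and> tables_at (S({u, v} \<mapsto> (c, j))) M')"
proof -
  let ?S = "S({u, v} \<mapsto> (c, j))"
  define M' where "M' = M(COLOR := (M COLOR)(u * n + v := c + 1, v * n + u := c + 1),
    BUCKET := (M BUCKET)(u * n + v := j, v * n + u := j), MATE := (M MATE)(u * B + c := v, v * B + c := u))"
  have uv: "u < n" "v < n" "u \<noteq> v" "c < 2 ^ H" "j < full" using valid_stateD(1-5)[OF S(3), of u v c j] by simp_all
  then have words: "c < B" "c < W" "c + 1 < W" "j < W" using B_bounds(1) full_bounds(1) by auto
  have "M' COLOR (a * n + b) = k + 1 \<and> M' BUCKET (a * n + b) = i \<and> M' MATE (a * B + k) = b"
    if ab: "?S {a, b} = Some (k, i)" for a b k i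
  proof -
    note d = valid_stateD[OF S(3) ab]
    have "k < B" using d(4) B_bounds(1) by simp
    then have cells: "a * n + b = u * n + v \<longleftrightarrow> a = u \<and> b = v" "a * n + b = v * n + u \<longleftrightarrow> a = v \<and> b = u"
      "a * B + k = u * B + c \<longleftrightarrow> a = u \<and> k = c" "a * B + k = v * B + c \<longleftrightarrow> a = v \<and> k = c"
      using index_inject d uv words(1) by auto
    show ?thesis
    proof (cases "{a, b} = {u, v}")
      case True
      then show ?thesis using ab cells uv(3) by (auto simp: M'_def doubleton_eq_iff)
    next
      case False
      then have old: "S {a, b} = Some (k, i)" using ab by simp
      then have "k \<in> colors S a full" by (auto simp: colors_def)
      then have "\<not> (a \<in> {u, v} \<and> k = c)" using color_of_edge_new[OF S(2,3)] by blast
      moreover have "\<not> (a = u \<and> b = v)" "\<not> (a = v \<and> b = u)" using False by auto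
      ultimately have "a * n + b \<noteq> u * n + v" "a * n + b \<noteq> v * n + u"
        "a * B + k \<noteq> u * B + c" "a * B + k \<noteq> v * B + c" unfolding cells by auto
      moreover have "M COLOR (a * n + b) = k + 1 \<and> M BUCKET (a * n + b) = i \<and> M MATE (a * B + k) = b"
        using S(1) old unfolding tables_at_def by blast
      ultimately show ?thesis by (simp add: M'_def)
    qed
  qed
  then have "tables_at ?S M'" by (simp add: tables_at_def)
  moreover have "unchanged {COLOR, BUCKET, MATE} M M'" by (simp add: M'_def)
  ultimately show ?thesis unfolding store_edge_def using M uv words by (simp add: runs_simps M'_def)
qed

lemma runs_remove_edge:
  assumes r: "ready S l M" and e: "S {u, v} = Some (c, j)" and M: "M TAIL 0 = u" "M HEAD 0 = v"
  shows "runs W remove_edge (200 * (H + 2)) M (\<lambda>M'. unchanged {COUNT, TREE, KEY, POS, SLOT} M M' \<and>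
    ready (S({u, v} := None)) l M' \<and> M' KEY 0 = c \<and> M' SLOT 0 = j)"
    (is "runs W _ _ M ?Q")
proof -
  let ?S = "S({u, v} := None)" and ?M = "M(KEY := (M KEY)(0 := c), SLOT := (M SLOT)(0 := j))"
  have S: "valid_state S" using r by (simp add: ready_def represents_def)
  have S': "valid_state ?S" by (rule valid_state_map_le[OF S upd_None_map_le])
  have upd: "?S({u, v} \<mapsto> (c, j)) = S" using e by (simp add: fun_upd_idem)
  note d = valid_stateD[OF S e]
  have new: "?S {u, v} = None" "valid_state (?S({u, v} \<mapsto> (c, j)))" using S upd by simp_all
  have trees: "runs W (update_trees Minus) (100 * (H + 2) + 60) ?M
      (\<lambda>M'. unchanged {COUNT, TREE, POS} ?M M' \<and> trees_at (colors ?S) M')"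
  proof (rule runs_update_trees[where G = "colors S"])
    show "trees_at (colors S) ?M" using r by (simp add: ready_def represents_def trees_at_def tree_at_def)
    show "set_change Minus c (colors S a b) (colors ?S a b)" if "a \<in> {u, v}" "b \<in> {j, full}" for a b
      using set_change_colors(2)[OF new that] unfolding upd .
    show "colors ?S a b = colors S a b" if "\<not> (a \<in> {u, v} \<and> b \<in> {j, full})" for a b
      using colors_insert[of ?S u v c j a b, OF new(1)] unfolding upd if_not_P[OF that] by (rule sym)
  qed (use r M d colors_bounded[OF S] in \<open>simp_all add: ready_def\<close>)
  have "runs W (update_trees Minus) (200 * (H + 2) - 24) ?M ?Q"
  proof (rule runs_conseq[OF trees])
    fix M' assume M': "unchanged {COUNT, TREE, POS} ?M M' \<and> trees_at (colors ?S) M'"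
    then have "ready ?S l M'" using r S' by (simp add: ready_def represents_def tables_at_def)
    then show "?Q M'" using M' by simp
  qed simp
  moreover have "M COLOR (u * n + v) = c + 1" "M BUCKET (u * n + v) = j" "M INPUT 0 = n"
    using r e by (auto simp: ready_def represents_def tables_at_def)
  moreover have "c + 1 < W" "c < W" "j < W" using d(4,5) full_bounds(1) by simp_all
  ultimately show ?thesis unfolding remove_edge_def using d M by (simp add: runs_simps)
qed

lemma runs_add_edge:
  assumes r: "ready S l M" and e: "S {u, v} = None"
    and M: "M TAIL 0 = u" "M HEAD 0 = v" "M KEY 0 = c" "M SLOT 0 = j"
    and uv: "u < n" "v < n" "u \<noteq> v" "c < 2 ^ H" "j < full"
    and free: "c \<notin> colors S u full" "c \<notin> colors S v full"
  shows "runs W add_edge (200 * (H + 2)) M (\<lambda>M'. unchanged {COLOR, BUCKET, MATE, COUNT, TREE, POS} M M' \<and>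
    ready (S({u, v} \<mapsto> (c, j))) l M')"
    (is "runs W _ _ M ?Q")
proof -
  let ?S = "S({u, v} \<mapsto> (c, j))"
  have S: "valid_state S" using r by (simp add: ready_def represents_def)
  have S': "valid_state ?S" by (rule valid_state_insert[OF S e uv free])
  have trees: "runs W (update_trees Plus) (100 * (H + 2) + 60) M
      (\<lambda>M'. unchanged {COUNT, TREE, POS} M M' \<and> trees_at (colors ?S) M')"
  proof (rule runs_update_trees[where G = "colors S"])
    show "set_change Plus c (colors S a b) (colors ?S a b)" if "a \<in> {u, v}" "b \<in> {j, full}" for a b
      by (rule set_change_colors(1)[of S, OF e S' that])
    show "colors ?S a b = colors S a b" if "\<not> (a \<in> {u, v} \<and> b \<in> {j, full})" for a b
      using colors_insert[of S u v c j a b, OF e] unfolding if_not_P[OF that] .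
  qed (use r M uv colors_bounded[OF S] in \<open>simp_all add: ready_def represents_def\<close>)
  show ?thesis unfolding add_edge_def
  proof (rule runs_SeqI[OF trees])
    fix M1 assume M1: "unchanged {COUNT, TREE, POS} M M1 \<and> trees_at (colors ?S) M1"
    have "runs W store_edge 70 M1 (\<lambda>M'. unchanged {COLOR, BUCKET, MATE} M1 M' \<and> tables_at ?S M')"
      by (rule runs_store_edge) (use M1 r M e S' in \<open>simp_all add: ready_def represents_def tables_at_def\<close>)
    then show "runs W store_edge 70 M1 ?Q"
    proof (rule runs_conseq)
      fix M' assume M': "unchanged {COLOR, BUCKET, MATE} M1 M' \<and> tables_at ?S M'"
      then have "ready ?S l M'"
        using M1 r S' by (simp add: ready_def represents_def trees_at_def tree_at_def)
      then show "?Q M'" using M' M1 by simp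
    qed simp
  qed (use B_bounds(7) in simp)
qed

end

section \<open>Coloring an edge\<close>

definition find_color :: com where
  "find_color = TREE ::= (Var HEAD \<otimes> Var STRIDE \<oplus> (Var STRIDE \<ominus> Const 1)) \<otimes> Var STRIDE ;;
     TREE2 ::= (Var TAIL \<otimes> Var STRIDE \<oplus> Read LEVEL (Var TAIL)) \<otimes> Var STRIDE ;; find_free"

definition evict :: com where
  "evict = If (Read COUNT ((Var TAIL \<otimes> Var STRIDE \<oplus> (Var STRIDE \<ominus> Const 1)) \<otimes> Var STRIDE \<oplus> (Var LEAVES \<oplus> Var KEY)))
     (NEXT ::= Read MATE (Var TAIL \<otimes> Var STRIDE \<oplus> Var KEY) ;; SAVED ::= Var HEAD ;; HEAD ::= Var NEXT ;;
      remove_edge ;; HEAD ::= Var SAVED)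
     (ACTIVE ::= Const 0 ;; NEXT ::= Const 0)"

definition place :: com where
  "place = SLOT ::= Read LEVEL (Var TAIL) ;; add_edge ;; HEAD ::= Var TAIL ;; TAIL ::= Var NEXT"

definition color_loop :: com where
  "color_loop = While (Var ACTIVE) (find_color ;; evict ;; place)"

abbreviation (input) color_vars :: "nat set" where
  "color_vars \<equiv> {COLOR, BUCKET, MATE, COUNT, TREE, TREE2, KEY, POS, SPAN, TAIL, HEAD, SLOT, ACTIVE, NEXT, SAVED}"

definition color_changes :: "state \<Rightarrow> state \<Rightarrow> nat set set" where
  "color_changes S S' = {e. map_option fst (S e) \<noteq> map_option fst (S' e)}"

context coloring_ram
begin

lemma ready_valid_state: "ready S l M \<Longrightarrow> valid_state S"
  by (simp add: ready_def represents_def)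

lemma ready_scalars:
  "ready S l M \<Longrightarrow> M INPUT 0 = n \<and> M INPUT 1 = \<alpha> \<and> M LEAVES 0 = 2 ^ H \<and> M STRIDE 0 = B"
  by (simp add: ready_def represents_def)

lemma ready_level:
  assumes "ready S l M" "v < n"
  shows "M LEVEL v = l v" "l v < full" "l v < B" "l v < W"
proof -
  show "M LEVEL v = l v" and less_full: "l v < full" using assms by (auto simp: ready_def represents_def)
  show "l v < B" "l v < W" using less_full full_bounds(1) B_less_W by linarith+
qed

lemma ready_mate: "ready S l M \<Longrightarrow> S {u, v} = Some (c, j) \<Longrightarrow> M MATE (u * B + c) = v"
  unfolding ready_def represents_def tables_at_def by blast

lemma ready_tree: "ready S l M \<Longrightarrow> v < n \<Longrightarrow> j < B \<Longrightarrow> tree_at H M (tree_base v j) (colors S v j)"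
  by (simp add: ready_def represents_def trees_at_def)

lemma ready_tree_root:
  assumes "ready S l M" "v < n" "j < B"
  shows "M COUNT (tree_base v j + 1) = card (colors S v j)"
  using ready_tree[OF assms] tree_count_root[OF colors_bounded[OF ready_valid_state[OF assms(1)]]] n_ge H_ge
  by (simp add: tree_at_def)

lemma ready_tree_leaf:
  assumes "ready S l M" "v < n" "j < B" "c < 2 ^ H"
  shows "M COUNT (tree_base v j + (2 ^ H + c)) = (if c \<in> colors S v j then 1 else 0)"
  using ready_tree[OF assms(1-3)] tree_count_leaf[OF colors_bounded[OF ready_valid_state[OF assms(1)]] assms(4)]
    assms(4) by (simp add: tree_at_def)

lemma card_colors:
  assumes S: "valid_state S"
  shows "card (colors S v j) = card {w \<in> neighbors (dom S) v. j = snd (the (S {v, w})) \<or> j = full}"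
proof -
  let ?A = "{w \<in> neighbors (dom S) v. j = snd (the (S {v, w})) \<or> j = full}"
  have "colors S v j = (\<lambda>w. fst (the (S {v, w}))) ` ?A"
    by (force simp: colors_def neighbors_def image_iff)
  moreover have "inj_on (\<lambda>w. fst (the (S {v, w}))) ?A"
  proof (rule inj_onI)
    fix x y assume "x \<in> ?A" "y \<in> ?A" and eq: "fst (the (S {v, x})) = fst (the (S {v, y}))"
    then obtain c i d k where "S {v, x} = Some (c, i)" "S {v, y} = Some (d, k)"
      by (auto simp: neighbors_def)
    then show "x = y" using valid_stateD(7)[OF S] eq by auto
  qed
  ultimately show ?thesis by (simp add: card_image)
qed

lemma card_colors_le:
  assumes "valid_state S"
  shows "card (colors S v j) \<le> card (neighbors (dom S) v)"
proof -
  have "finite (neighbors (dom S) v)" using assms finite_neighbors by (auto simp: valid_state_def)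
  then show ?thesis unfolding card_colors[OF assms] by (rule card_mono) auto
qed

lemma card_colors_less: "valid_state S \<Longrightarrow> v < n \<Longrightarrow> card (colors S v j) < n"
  using card_colors_le card_neighbors_less le_less_trans unfolding valid_state_def by blast

text \<open>The bucket of an edge is the smaller level of its ends.\<close>

definition consistent :: "state \<Rightarrow> (nat \<Rightarrow> nat) \<Rightarrow> bool" where
  "consistent S l \<longleftrightarrow> (\<forall>u v c j. S {u, v} = Some (c, j) \<longrightarrow> j = min (l u) (l v))"

lemma consistentD: "consistent S l \<Longrightarrow> S {u, v} = Some (c, j) \<Longrightarrow> j = min (l u) (l v)"
  unfolding consistent_def by blast

lemma consistent_delete: "consistent S l \<Longrightarrow> consistent (S(e := None)) l"
  unfolding consistent_def by (metis fun_upd_apply option.distinct(1))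

lemma consistent_insert:
  assumes "consistent S l" "l x \<le> l y"
  shows "consistent (S({x, y} \<mapsto> (c, l x))) l"
  unfolding consistent_def
proof (intro allI impI)
  fix u v d j assume a: "(S({x, y} \<mapsto> (c, l x))) {u, v} = Some (d, j)"
  show "j = min (l u) (l v)"
  proof (cases "{u, v} = {x, y}")
    case True
    then have "j = l x" using a by simp
    then show ?thesis using True assms(2) by (auto simp: doubleton_eq_iff)
  next
    case False
    then show ?thesis using a consistentD[OF assms(1)] by simp
  qed
qed

lemma card_colors_consistent:
  assumes "valid_state S" "consistent S l" "j < full"
  shows "card (colors S v j) = card {w \<in> neighbors (dom S) v. j = min (l v) (l w)}"
proof -
  have "snd (the (S {v, w})) = min (l v) (l w)" if "w \<in> neighbors (dom S) v" for w
    using that consistentD[OF assms(2)] by (fastforce simp: neighbors_def)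
  then have "{w \<in> neighbors (dom S) v. j = snd (the (S {v, w})) \<or> j = full} =
      {w \<in> neighbors (dom S) v. j = min (l v) (l w)}" using assms(3) by auto
  then show ?thesis unfolding card_colors[OF assms(1)] by simp
qed

lemma card_colors_level:
  assumes "valid_state S" "consistent S l" "l v < full"
  shows "card (colors S v (l v)) = deg_above (dom S) l v (l v)"
proof -
  have "l v = min (l v) (l w) \<longleftrightarrow> l v \<le> l w" for w by linarith
  then show ?thesis unfolding card_colors_consistent[OF assms] deg_above_def by simp
qed

lemma card_colors_below:
  assumes S: "valid_state S" "consistent S l" and l: "l v < full" "0 < l v"
  shows "card (colors S v (l v)) + card (colors S v (l v - 1)) = deg_above (dom S) l v (l v - 1)"
proof -
  let ?X = "{w \<in> neighbors (dom S) v. l v \<le> l w}" and ?Y = "{w \<in> neighbors (dom S) v. l w = l v - 1}"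
  have "finite (neighbors (dom S) v)" using S(1) finite_neighbors by (auto simp: valid_state_def)
  then have "card (?X \<union> ?Y) = card ?X + card ?Y" using l(2) by (intro card_Un_disjoint) auto
  moreover have "?X \<union> ?Y = {w \<in> neighbors (dom S) v. l v - 1 \<le> l w}" by auto
  moreover have "l v - 1 = min (l v) (l w) \<longleftrightarrow> l w = l v - 1" for w using l(2) by linarith
  then have "card (colors S v (l v - 1)) = card ?Y"
    using card_colors_consistent[OF S, of "l v - 1" v] l(1) by simp
  ultimately show ?thesis using card_colors_level[OF S l(1)] by (simp add: deg_above_def)
qed

lemma runs_find_color:
  assumes r: "ready S l M" and M: "M TAIL 0 = x" "M HEAD 0 = y" and xy: "x < n" "y < n"
  shows "runs W find_color (50 * (H + 1) + 40) M (\<lambda>M'. unchanged {TREE, TREE2, KEY, POS, SPAN} M M' \<and>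
    M' KEY 0 < 2 ^ H \<and> M' KEY 0 \<notin> colors S y full \<and> M' KEY 0 \<notin> colors S x (l x) \<and>
    M' KEY 0 \<le> card (colors S y full) + card (colors S x (l x)))"
    (is "runs W _ _ M ?Q")
proof -
  let ?M = "M(TREE := (M TREE)(0 := tree_base y full), TREE2 := (M TREE2)(0 := tree_base x (l x)))"
  note S = ready_valid_state[OF r] and scalars = ready_scalars[OF r] and level = ready_level[OF r xy(1)]
  have r': "ready S l ?M" using r by simp
  have "card (colors S y full) + card (colors S x (l x)) < 2 ^ H"
    using card_colors_less[OF S xy(1), of "l x"] card_colors_less[OF S xy(2), of full] H_ge by linarith
  then have "runs W find_free (50 * (H + 1)) ?M (\<lambda>M'. unchanged {KEY, POS, SPAN} ?M M' \<and>
      M' KEY 0 < 2 ^ H \<and> M' KEY 0 \<notin> colors S y full \<and> M' KEY 0 \<notin> colors S x (l x) \<and>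
      M' KEY 0 \<le> card (colors S y full) + card (colors S x (l x)))"
    using scalars
    by (intro runs_find_free[where ?K1.0 = "tree_base y full" and ?K2.0 = "tree_base x (l x)"]
        four_leaves_le_W colors_bounded[OF S] tree_words xy full_bounds(1) level(3) ready_tree[OF r']) simp_all
  then have "runs W find_free (50 * (H + 1)) ?M ?Q" by (rule runs_conseq) simp_all
  then show ?thesis unfolding find_color_def using M xy scalars level full_bounds(1,2)
    by (simp add: runs_simps) (auto elim: runs_conseq)
qed

lemma eval_conflict:
  assumes r: "ready S l M" and M: "M TAIL 0 = x" "M KEY 0 = k" and x: "x < n" and k: "k < 2 ^ H"
  shows "eval W M (Read COUNT ((Var TAIL \<otimes> Var STRIDE \<oplus> (Var STRIDE \<ominus> Const 1)) \<otimes> Var STRIDE \<oplus>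
    (Var LEAVES \<oplus> Var KEY))) = Some (if k \<in> colors S x full then 1 else 0)"
proof -
  have "2 ^ H + k < B" using k B_bounds(1) by linarith
  then show ?thesis
    using ready_tree_leaf[OF r x full_bounds(1) k] ready_scalars[OF r] M x k full_bounds(1,2) by simp
qed

lemma runs_evict_free:
  assumes r: "ready S l M" and M: "M TAIL 0 = x" "M KEY 0 = k" and x: "x < n" and k: "k < 2 ^ H"
    and free: "k \<notin> colors S x full"
  shows "runs W evict 60 M (\<lambda>M'. unchanged {ACTIVE, NEXT} M M' \<and> ready S l M' \<and>
    M' ACTIVE 0 = 0 \<and> M' NEXT 0 = 0)"
  unfolding evict_def using eval_conflict[OF r M x k] free r
  by (simp add: runs_If runs_Write runs_Write_Seq del: eval.simps) simp

lemma runs_evict_conflict: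
  assumes r: "ready S l M" and M: "M TAIL 0 = x" "M HEAD 0 = y" "M KEY 0 = k" and y: "y < n"
    and z: "S {x, z} = Some (k, j)"
  shows "runs W evict (200 * (H + 2) + 60) M (\<lambda>M'. unchanged {COUNT, TREE, POS, HEAD, KEY, SLOT, NEXT, SAVED} M M' \<and>
    ready (S({x, z} := None)) l M' \<and> M' HEAD 0 = y \<and> M' KEY 0 = k \<and> M' NEXT 0 = z)"
    (is "runs W _ _ M ?Q")
proof -
  let ?M = "M(NEXT := (M NEXT)(0 := z), SAVED := (M SAVED)(0 := y), HEAD := (M HEAD)(0 := z))"
  note d = valid_stateD[OF ready_valid_state[OF r] z]
  have k: "k \<in> colors S x full" "k < B" "k < W" using z d(4) B_bounds(1) by (auto simp: colors_def)
  have rem: "runs W remove_edge (200 * (H + 2)) ?M (\<lambda>M'. unchanged {COUNT, TREE, KEY, POS, SLOT} ?M M' \<and>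
      ready (S({x, z} := None)) l M' \<and> M' KEY 0 = k \<and> M' SLOT 0 = j)"
    by (rule runs_remove_edge) (use r z M in auto)
  have "runs W (remove_edge ;; HEAD ::= Var SAVED) (200 * (H + 2) + 4) ?M ?Q"
    by (rule runs_SeqI[OF rem, where ?T2.0 = 4]) (use y in \<open>auto simp: runs_simps\<close>)
  then have "runs W (NEXT ::= Read MATE (Var TAIL \<otimes> Var STRIDE \<oplus> Var KEY) ;; SAVED ::= Var HEAD ;;
      HEAD ::= Var NEXT ;; remove_edge ;; HEAD ::= Var SAVED) (200 * (H + 2) + 30) M ?Q"
    using ready_mate[OF r z] ready_scalars[OF r] k d M y by (simp add: runs_simps) (auto elim: runs_conseq)
  then show ?thesis unfolding evict_def runs_If
    using eval_conflict[OF r M(1,3) d(1,4)] k(1) by (simp del: eval.simps) (auto elim: runs_conseq)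
qed

lemma runs_place:
  assumes r: "ready S l M" and e: "S {x, y} = None"
    and M: "M TAIL 0 = x" "M HEAD 0 = y" "M KEY 0 = k" "M NEXT 0 = z"
    and xy: "x < n" "y < n" "x \<noteq> y" "k < 2 ^ H" "z < W"
    and free: "k \<notin> colors S x full" "k \<notin> colors S y full"
  shows "runs W place (200 * (H + 2) + 20) M
    (\<lambda>M'. unchanged {COLOR, BUCKET, MATE, COUNT, TREE, POS, TAIL, HEAD, SLOT} M M' \<and>
      ready (S({x, y} \<mapsto> (k, l x))) l M' \<and> M' HEAD 0 = x \<and> M' TAIL 0 = z)"
    (is "runs W _ _ M ?Q")
proof -
  let ?M = "M(SLOT := (M SLOT)(0 := l x))"
  note level = ready_level[OF r xy(1)]
  have add: "runs W add_edge (200 * (H + 2)) ?M (\<lambda>M'. unchanged {COLOR, BUCKET, MATE, COUNT, TREE, POS} ?M M' \<and>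
      ready (S({x, y} \<mapsto> (k, l x))) l M')"
    by (rule runs_add_edge) (use r e M xy free level in auto)
  have "runs W (add_edge ;; HEAD ::= Var TAIL ;; TAIL ::= Var NEXT) (200 * (H + 2) + 8) ?M ?Q"
    by (rule runs_SeqI[OF add, where ?T2.0 = 8]) (use M xy in \<open>auto simp: runs_simps\<close>)
  then show ?thesis unfolding place_def using M xy level by (simp add: runs_simps) (auto elim: runs_conseq)
qed

lemma conflict_level_less:
  assumes "ready S l M" "consistent S l" "S {x, z} = Some (k, j)" "k \<notin> colors S x (l x)"
  shows "l z < l x"
proof -
  have "j \<noteq> l x" using assms(3,4) by (auto simp: colors_def)
  then show ?thesis using consistentD[OF assms(2,3)] by (simp add: min_def split: if_splits)
qed

lemma runs_evict_place:
  assumes r: "ready S l M" "consistent S l" and e: "S {x, y} = None"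
    and M: "M TAIL 0 = x" "M HEAD 0 = y" "M KEY 0 = k" and xy: "x < n" "y < n" "x \<noteq> y"
    and free: "k \<notin> colors S y full" and z: "S {x, z} = Some (k, j)"
  shows "runs W (evict ;; place) (400 * (H + 2) + 80) M (\<lambda>M'. unchanged color_vars M M' \<and>
    M' ACTIVE 0 = M ACTIVE 0 \<and> M' TAIL 0 = z \<and> M' HEAD 0 = x \<and>
    ready (S({x, z} := None, {x, y} \<mapsto> (k, l x))) l M')"
proof -
  let ?S = "S({x, z} := None)"
  note d = valid_stateD[OF ready_valid_state[OF r(1)] z]
  have upd: "?S({x, z} \<mapsto> (k, j)) = S" using z by (simp add: fun_upd_idem)
  have x_free: "k \<notin> colors ?S x full"
    by (rule color_of_edge_new[of ?S x z k j]) (use upd ready_valid_state[OF r(1)] in auto)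
  have y_free: "k \<notin> colors ?S y full" using free by (auto simp: colors_def split: if_splits)
  show ?thesis
  proof (rule runs_SeqI[OF runs_evict_conflict[OF r(1) M xy(2) z]])
    fix M1 assume M1: "unchanged {COUNT, TREE, POS, HEAD, KEY, SLOT, NEXT, SAVED} M M1 \<and>
      ready ?S l M1 \<and> M1 HEAD 0 = y \<and> M1 KEY 0 = k \<and> M1 NEXT 0 = z"
    show "runs W place (200 * (H + 2) + 20) M1 (\<lambda>M'. unchanged color_vars M M' \<and>
        M' ACTIVE 0 = M ACTIVE 0 \<and> M' TAIL 0 = z \<and> M' HEAD 0 = x \<and> ready (?S({x, y} \<mapsto> (k, l x))) l M')"
      by (rule runs_conseq[OF runs_place[where S = ?S and l = l and x = x and y = y and k = k and z = z]])
        (use M1 M e xy x_free y_free d(2,4) in auto)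
  qed simp
qed

lemma runs_color_step:
  assumes r: "ready S l M" "consistent S l" and e: "S {x, y} = None"
    and M: "M TAIL 0 = x" "M HEAD 0 = y" "M ACTIVE 0 = 1" and xy: "x < n" "y < n" "x \<noteq> y"
  shows "runs W (find_color ;; evict ;; place) (600 * (H + 2)) M (\<lambda>M'. unchanged color_vars M M' \<and>
    (\<exists>k \<le> card (colors S y full) + card (colors S x (l x)).
       M' ACTIVE 0 = 0 \<and> ready (S({x, y} \<mapsto> (k, l x))) l M' \<or>
       (\<exists>z j. S {x, z} = Some (k, j) \<and> l z < l x \<and> M' ACTIVE 0 = 1 \<and> M' TAIL 0 = z \<and> M' HEAD 0 = x \<and>
          ready (S({x, z} := None, {x, y} \<mapsto> (k, l x))) l M')))"
    (is "runs W _ _ M ?Q")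
proof (rule runs_SeqI[OF runs_find_color[OF r(1) M(1,2) xy(1,2)]], elim conjE)
  fix M1 :: memory
  define k where "k = M1 KEY 0"
  assume same: "unchanged {TREE, TREE2, KEY, POS, SPAN} M M1" and k: "M1 KEY 0 < 2 ^ H" "M1 KEY 0 \<notin> colors S y full"
    "M1 KEY 0 \<notin> colors S x (l x)" "M1 KEY 0 \<le> card (colors S y full) + card (colors S x (l x))"
  note k = k[folded k_def]
  have M1: "M1 TAIL 0 = x" "M1 HEAD 0 = y" "M1 ACTIVE 0 = 1" using same M by simp_all
  have r1: "ready S l M1" by (rule ready_unchanged[OF r(1) same]) auto
  show "runs W (evict ;; place) (400 * (H + 2) + 80) M1 ?Q"
  proof (cases "k \<in> colors S x full")
    case False
    show ?thesis
    proof (rule runs_SeqI[OF runs_evict_free[OF r1 M1(1) k_def[symmetric] xy(1) k(1) False]])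
      fix M2 assume M2: "unchanged {ACTIVE, NEXT} M1 M2 \<and> ready S l M2 \<and> M2 ACTIVE 0 = 0 \<and> M2 NEXT 0 = 0"
      show "runs W place (200 * (H + 2) + 20) M2 ?Q"
        by (rule runs_conseq[OF runs_place[where S = S and l = l and x = x and y = y and k = k]])
          (use M2 M1 same e xy k False in \<open>auto simp: k_def\<close>)
    qed simp
  next
    case True
    then obtain z j where z: "S {x, z} = Some (k, j)" by (auto elim: colorsE)
    note less = conflict_level_less[OF r1 r(2) z k(3)]
    show ?thesis
      by (rule runs_conseq[OF runs_evict_place[OF r1 r(2) e M1(1,2) k_def[symmetric] xy k(2) z] order.refl])
        (use same M1 k(4) z less in auto)
  qed
qed simp

definition colors_below :: "nat \<Rightarrow> state \<Rightarrow> bool" where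
  "colors_below m S \<longleftrightarrow> (\<forall>e c j. S e = Some (c, j) \<longrightarrow> c < m)"

definition recolored ::
  "nat \<Rightarrow> nat \<Rightarrow> nat set set \<Rightarrow> state \<Rightarrow> (nat \<Rightarrow> nat) \<Rightarrow> memory \<Rightarrow> bool" where
  "recolored m r E S l M \<longleftrightarrow> (\<exists>S'. ready S' l M \<and> consistent S' l \<and> dom S' = E \<and> colors_below m S' \<and>
     card (color_changes S S') \<le> r)"

text \<open>The edge \<open>xy\<close> is about to be colored from its lower end \<open>x\<close>, and \<open>R\<close> contains all edges
  whose color differs from \<open>S0\<close>.\<close>

definition partial_coloring ::
  "nat set set \<Rightarrow> nat \<Rightarrow> nat \<Rightarrow> (nat \<Rightarrow> nat) \<Rightarrow> state \<Rightarrow> nat \<Rightarrow> nat \<Rightarrow> state \<Rightarrow> nat set set \<Rightarrow> bool" where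
  "partial_coloring E D k l S0 x y S R \<longleftrightarrow> consistent S l \<and> colors_below (D + k) S \<and>
     finite R \<and> color_changes S0 S \<subseteq> R \<and> {x, y} \<in> E \<and> {x, y} \<in> R \<and> dom S = E - {{x, y}} \<and>
     l x \<le> l y \<and> card (colors S x (l x)) \<le> k"

lemma colors_below_insert: "colors_below m S \<Longrightarrow> c < m \<Longrightarrow> colors_below m (S(e \<mapsto> (c, j)))"
  by (simp add: colors_below_def)

lemma colors_below_delete: "colors_below m S \<Longrightarrow> colors_below m (S(e := None))"
  by (simp add: colors_below_def)

lemma color_changes_upd: "color_changes S (S'(e := x)) \<subseteq> insert e (color_changes S S')"
  by (auto simp: color_changes_def)

lemma palette_bound:
  assumes E: "graph_on n E" "card (neighbors E y) \<le> D" and S: "valid_state S"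
    and p: "partial_coloring E D k l S0 x y S R"
    and c: "c \<le> card (colors S y full) + card (colors S x (l x))"
  shows "c < D + k"
proof -
  have xy: "{x, y} \<in> E" "dom S = E - {{x, y}}" using p by (auto simp: partial_coloring_def)
  have sub: "neighbors (dom S) y \<subseteq> neighbors E y - {x}"
    unfolding xy(2) by (auto simp: neighbors_def insert_commute)
  have "card (colors S y full) \<le> card (neighbors (dom S) y)" by (rule card_colors_le[OF S])
  also have "\<dots> \<le> card (neighbors E y - {x})"
    using finite_neighbors[OF E(1)] by (intro card_mono sub) auto
  also have "\<dots> < card (neighbors E y)"
    by (rule card_Diff1_less[OF finite_neighbors[OF E(1)]]) (use xy(1) in \<open>simp add: neighbors_def insert_commute\<close>)
  finally show ?thesis using E(2) c p by (simp add: partial_coloring_def)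
qed

lemma partial_coloring_place:
  assumes p: "partial_coloring E D k l S0 x y S R" and c: "c < D + k"
  defines "S' \<equiv> S({x, y} \<mapsto> (c, l x))"
  shows "consistent S' l" "colors_below (D + k) S'" "color_changes S0 S' \<subseteq> R" "dom S' = E"
proof -
  have S: "consistent S l" "colors_below (D + k) S" "color_changes S0 S \<subseteq> R" "{x, y} \<in> E" "{x, y} \<in> R"
    "dom S = E - {{x, y}}" "l x \<le> l y" using p by (auto simp: partial_coloring_def)
  show "consistent S' l" unfolding S'_def by (rule consistent_insert[OF S(1,7)])
  show "colors_below (D + k) S'" unfolding S'_def by (rule colors_below_insert[OF S(2) c])
  show "color_changes S0 S' \<subseteq> R" using color_changes_upd[of S0 S "{x, y}"] S(3,5) unfolding S'_def by blast
  show "dom S' = E" using S(4,6) by (auto simp: S'_def)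
qed

lemma partial_coloring_evict:
  assumes E: "graph_on n E" and p: "partial_coloring E D k l S0 x y S R" and c: "c < D + k"
    and z: "S {x, z} = Some (c, j)" "l z < l x" "l z < full" "deg_above E l z (l z) \<le> k"
  defines "S' \<equiv> S({x, z} := None, {x, y} \<mapsto> (c, l x))"
  assumes S': "valid_state S'"
  shows "partial_coloring E D k l S0 z x S' (insert {x, z} R)"
proof -
  have S: "consistent S l" "colors_below (D + k) S" "finite R" "color_changes S0 S \<subseteq> R" "{x, y} \<in> E" "{x, y} \<in> R"
    "dom S = E - {{x, y}}" "l x \<le> l y" using p by (auto simp: partial_coloring_def)
  have zx: "{z, x} = {x, z}" by auto
  have xz: "{x, z} \<in> E" "{x, z} \<noteq> {x, y}" using z(1) S(7) by auto
  then have dom: "dom S' = E - {{z, x}}" using S(5,7) unfolding S'_def zx by auto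
  have cons: "consistent S' l" unfolding S'_def by (rule consistent_insert[OF consistent_delete[OF S(1)] S(8)])
  have "card (colors S' z (l z)) = deg_above (dom S') l z (l z)" by (rule card_colors_level[OF S' cons z(3)])
  also have "\<dots> \<le> deg_above E l z (l z)"
    unfolding dom deg_above_def using finite_neighbors[OF E] by (intro card_mono) (auto simp: neighbors_def)
  finally have "card (colors S' z (l z)) \<le> k" using z(4) by simp
  moreover have "colors_below (D + k) S'"
    unfolding S'_def by (rule colors_below_insert[OF colors_below_delete[OF S(2)] c])
  moreover have "color_changes S0 S' \<subseteq> insert {x, z} R"
    using color_changes_upd[of S0 "S({x, z} := None)" "{x, y}"] color_changes_upd[of S0 S "{x, z}"] S(4,6)
    unfolding S'_def by blast
  ultimately show ?thesis
    using cons dom xz(1) z(2) S(3) unfolding partial_coloring_def zx by simp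
qed

definition coloring_pending ::
  "nat set set \<Rightarrow> nat \<Rightarrow> nat \<Rightarrow> (nat \<Rightarrow> nat) \<Rightarrow> state \<Rightarrow> nat \<Rightarrow> nat \<Rightarrow> memory \<Rightarrow> bool" where
  "coloring_pending E D k l S0 r i M \<longleftrightarrow> M ACTIVE 0 = 1 \<and>
     (\<exists>S R x y. ready S l M \<and> M TAIL 0 = x \<and> M HEAD 0 = y \<and> partial_coloring E D k l S0 x y S R \<and>
        l x < i \<and> card R + l x \<le> r)"

definition coloring_done ::
  "nat set set \<Rightarrow> nat \<Rightarrow> (nat \<Rightarrow> nat) \<Rightarrow> state \<Rightarrow> nat \<Rightarrow> memory \<Rightarrow> bool" where
  "coloring_done E m l S0 r M \<longleftrightarrow> M ACTIVE 0 = 0 \<and> recolored m r E S0 l M"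

lemma coloring_done_place:
  assumes "ready (S({x, y} \<mapsto> (c, l x))) l M" "M ACTIVE 0 = 0"
    and p: "partial_coloring E D k l S0 x y S R" and c: "c < D + k" and R: "card R + l x \<le> r"
  shows "coloring_done E (D + k) l S0 r M"
proof -
  note place = partial_coloring_place[OF p c]
  have "finite R" using p by (simp add: partial_coloring_def)
  then have "card (color_changes S0 (S({x, y} \<mapsto> (c, l x)))) \<le> r"
    using card_mono[OF _ place(3)] R by fastforce
  then show ?thesis using assms(1,2) place unfolding coloring_done_def recolored_def by blast
qed

lemma coloring_pending_evict:
  assumes E: "graph_on n E" and r': "ready (S({x, z} := None, {x, y} \<mapsto> (c, l x))) l M"
    and M: "M ACTIVE 0 = 1" "M TAIL 0 = z" "M HEAD 0 = x"
    and z: "S {x, z} = Some (c, j)" "l z < l x" "z < n" "deg_above E l z (l z) \<le> k"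
    and p: "partial_coloring E D k l S0 x y S R" and c: "c < D + k" and R: "l x \<le> i" "card R + l x \<le> r"
  shows "coloring_pending E D k l S0 r i M"
proof -
  have "partial_coloring E D k l S0 z x (S({x, z} := None, {x, y} \<mapsto> (c, l x))) (insert {x, z} R)"
    by (rule partial_coloring_evict[OF E p c z(1,2) ready_level(2)[OF r' z(3)] z(4) ready_valid_state[OF r']])
  moreover have "card (insert {x, z} R) \<le> card R + 1" using p by (simp add: partial_coloring_def card_insert_if)
  then have "card (insert {x, z} R) + l z \<le> r" using R(2) z(2) by linarith
  ultimately show ?thesis using r' M z(2) R(1) unfolding coloring_pending_def by fastforce
qed

lemma runs_coloring_pending:
  assumes E: "graph_on n E" "\<And>v. v < n \<Longrightarrow> card (neighbors E v) \<le> D"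
    and k: "\<And>v. v < n \<Longrightarrow> l v + 1 < r \<Longrightarrow> deg_above E l v (l v) \<le> k"
    and pending: "coloring_pending E D k l S0 r i M"
  shows "runs W (find_color ;; evict ;; place) (600 * (H + 2)) M (\<lambda>M'. unchanged color_vars M M' \<and>
    (coloring_done E (D + k) l S0 r M' \<or> coloring_pending E D k l S0 r (i - 1) M'))"
proof -
  obtain S R x y where S: "ready S l M" "M TAIL 0 = x" "M HEAD 0 = y" "M ACTIVE 0 = 1"
    and p: "partial_coloring E D k l S0 x y S R" and R: "l x < i" "card R + l x \<le> r"
    using pending unfolding coloring_pending_def by blast
  have cons: "consistent S l" and dom: "dom S = E - {{x, y}}" and xE: "{x, y} \<in> E" and "{x, y} \<in> R" "finite R"
    using p by (auto simp: partial_coloring_def)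
  then have r: "l x + 1 \<le> r" using R(2) card_gt_0_iff[of R] by fastforce
  have xy: "x < n" "y < n" "x \<noteq> y" using graph_on_neighbors[OF E(1), of y x] xE by (auto simp: neighbors_def)
  have e: "S {x, y} = None" using dom by blast
  show ?thesis
  proof (rule runs_conseq[OF runs_color_step[OF S(1) cons e S(2-4) xy] order.refl], elim conjE exE, intro conjI)
    fix M' c
    assume "c \<le> card (colors S y full) + card (colors S x (l x))"
      and alt: "M' ACTIVE 0 = 0 \<and> ready (S({x, y} \<mapsto> (c, l x))) l M' \<or>
       (\<exists>z j. S {x, z} = Some (c, j) \<and> l z < l x \<and> M' ACTIVE 0 = 1 \<and> M' TAIL 0 = z \<and> M' HEAD 0 = x \<and>
          ready (S({x, z} := None, {x, y} \<mapsto> (c, l x))) l M')"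
    then have c: "c < D + k" using palette_bound[OF E(1) E(2)[OF xy(2)] ready_valid_state[OF S(1)] p] by blast
    from alt show "coloring_done E (D + k) l S0 r M' \<or> coloring_pending E D k l S0 r (i - 1) M'"
    proof (elim disjE exE conjE)
      assume "M' ACTIVE 0 = 0" "ready (S({x, y} \<mapsto> (c, l x))) l M'"
      then show ?thesis using coloring_done_place[OF _ _ p c R(2)] by blast
    next
      fix z j
      assume z: "S {x, z} = Some (c, j)" "l z < l x" "M' ACTIVE 0 = 1" "M' TAIL 0 = z" "M' HEAD 0 = x"
        and r': "ready (S({x, z} := None, {x, y} \<mapsto> (c, l x))) l M'"
      have zn: "z < n" using valid_stateD(2)[OF ready_valid_state[OF S(1)] z(1)] .
      have "deg_above E l z (l z) \<le> k" using k[OF zn] z(2) r by simp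
      then have "coloring_pending E D k l S0 r (i - 1) M'"
        using coloring_pending_evict[OF E(1) r' z(3-5,1,2) zn _ p c _ R(2)] R(1) by simp
      then show ?thesis ..
    qed
  qed
qed

text \<open>Every step leads from \<open>x\<close> to a node of smaller level, since the new color avoids all edges from
  \<open>x\<close> to nodes that are not below \<open>x\<close>.\<close>

lemma runs_color_loop:
  assumes E: "graph_on n E" "\<And>v. v < n \<Longrightarrow> card (neighbors E v) \<le> D"
    and k: "\<And>v. v < n \<Longrightarrow> l v + 1 < r \<Longrightarrow> deg_above E l v (l v) \<le> k"
    and pending: "coloring_pending E D k l S0 r i M0"
  shows "runs W color_loop (i * (600 * (H + 2) + 3) + 3) M0
    (\<lambda>M. unchanged color_vars M0 M \<and> coloring_done E (D + k) l S0 r M)"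
    (is "runs W _ _ M0 ?Q")
proof -
  define I where "I i M \<longleftrightarrow> unchanged color_vars M0 M \<and>
    (coloring_done E (D + k) l S0 r M \<or> coloring_pending E D k l S0 r i M)" for i M
  have "runs W color_loop (i * (600 * (H + 2) + 1 + expr_cost (Var ACTIVE)) + (1 + expr_cost (Var ACTIVE))) M0 ?Q"
    unfolding color_loop_def
  proof (rule runs_While_decreasing[where I = I])
    show "I i M0" using pending by (simp add: I_def)
    fix i M assume I: "I i M"
    show "\<exists>a. eval W M (Var ACTIVE) = Some a \<and> (if a = 0 then ?Q M
      else runs W (find_color ;; evict ;; place) (600 * (H + 2)) M (\<lambda>M'. \<exists>i'<i. I i' M'))"
    proof (cases "M ACTIVE 0 = 0")
      case True
      then show ?thesis using I by (simp add: I_def coloring_pending_def)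
    next
      case False
      then have p: "coloring_pending E D k l S0 r i M" and fr: "unchanged color_vars M0 M"
        using I by (auto simp: I_def coloring_done_def)
      have active: "0 < i" "M ACTIVE 0 = 1" using p by (auto simp: coloring_pending_def)
      have "runs W (find_color ;; evict ;; place) (600 * (H + 2)) M (\<lambda>M'. \<exists>i'<i. I i' M')"
        by (rule runs_conseq[OF runs_coloring_pending[OF E k p]])
          (use active fr in \<open>auto simp: I_def intro!: exI[of _ "i - 1"]\<close>)
      then show ?thesis using active by simp
    qed
  qed
  then show ?thesis by (rule runs_conseq) simp_all
qed

end

section \<open>Moving a node to another level\<close>

definition push :: "expr \<Rightarrow> com" where
  "push e = Write STACK (Var TOP) e ;; TOP ::= Var TOP \<oplus> Const 1"

definition select_edge :: com where
  "select_edge = RANK ::= Var RANK \<ominus> Const 1 ;; TREE ::= (Var NODE \<otimes> Var STRIDE \<oplus> Var OLD) \<otimes> Var STRIDE ;;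
     select ;; TAIL ::= Var NODE ;; HEAD ::= Read MATE (Var NODE \<otimes> Var STRIDE \<oplus> Var KEY)"

definition new_bucket :: com where
  "new_bucket = If (Read LEVEL (Var TAIL) \<prec> Read LEVEL (Var HEAD))
     (NEW ::= Read LEVEL (Var TAIL)) (NEW ::= Read LEVEL (Var HEAD))"

definition move_edge :: com where
  "move_edge = remove_edge ;; SLOT ::= Var NEW ;; add_edge"

text \<open>The neighbors along the moved edges are pushed, since only their degrees above their levels can
  have changed.\<close>

definition rebucket_step :: com where
  "rebucket_step = select_edge ;; new_bucket ;; If (Var NEW \<doteq> Var OLD) Skip (move_edge ;; push (Var HEAD))"

definition rebucket :: "expr \<Rightarrow> com" where
  "rebucket e = OLD ::= Read LEVEL (Var NODE) ;; Write LEVEL (Var NODE) e ;;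
     RANK ::= Read COUNT ((Var NODE \<otimes> Var STRIDE \<oplus> Var OLD) \<otimes> Var STRIDE \<oplus> Const 1) ;;
     While (Var RANK) rebucket_step"

definition fix_step :: "expr \<Rightarrow> expr \<Rightarrow> com" where
  "fix_step b e = NODE ::= Read STACK (Var TOP \<ominus> Const 1) ;; If b (rebucket e) (TOP ::= Var TOP \<ominus> Const 1)"

definition fix_loop :: "expr \<Rightarrow> expr \<Rightarrow> com" where
  "fix_loop b e = While (Var TOP) (fix_step b e)"

definition stack :: "memory \<Rightarrow> nat set" where
  "stack M = M STACK ` {..<M TOP 0}"

lemma stack_Suc:
  "stack (M(STACK := (M STACK)(M TOP 0 := w), TOP := (M TOP)(0 := M TOP 0 + 1))) = insert w (stack M)"
  unfolding stack_def by (auto simp: lessThan_Suc image_iff)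

lemma runs_push:
  assumes "eval W M e = Some w" "M TOP 0 + 1 < W" "1 < W"
  shows "runs W (push e) (10 + expr_cost e) M
    (\<lambda>M'. unchanged {STACK, TOP} M M' \<and> stack M' = insert w (stack M) \<and> M' TOP 0 = M TOP 0 + 1)"
  unfolding push_def using assms by (simp add: runs_simps stack_Suc)

lemma color_changes_empty_dom: "color_changes S S' = {} \<Longrightarrow> dom S' = dom S"
proof -
  assume "color_changes S S' = {}"
  then have "map_option fst (S e) = map_option fst (S' e)" for e unfolding color_changes_def by blast
  then have "S e = None \<longleftrightarrow> S' e = None" for e by (metis map_option_is_None)
  then show ?thesis by (simp add: dom_def)
qed

lemma color_changes_same_colors: "color_changes S' S'' = {} \<Longrightarrow> color_changes S S'' = color_changes S S'"
  by (auto simp: color_changes_def)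

context coloring_ram
begin

lemma colors_below_same: "color_changes S S' = {} \<Longrightarrow> colors_below m S \<Longrightarrow> colors_below m S'"
proof -
  assume same: "color_changes S S' = {}" and m: "colors_below m S"
  have "map_option fst (S e) = map_option fst (S' e)" for e using same unfolding color_changes_def by blast
  then have "\<exists>i. S e = Some (c, i)" if "S' e = Some (c, j)" for e c j
    using that by (metis (no_types, lifting) fst_conv map_option_eq_Some option.simps(9) prod.collapse)
  then show ?thesis using m unfolding colors_below_def by blast
qed

lemma runs_select_edge:
  assumes r: "ready S l M" and M: "M NODE 0 = v" "M OLD 0 = i" "M RANK 0 = Suc k"
    and v: "v < n" "i < full" and k: "k < card (colors S v i)"
  shows "runs W select_edge (50 * (H + 1) + 50) M
    (\<lambda>M'. unchanged {TREE, KEY, POS, RANK, REST, TAIL, HEAD} M M' \<and> M' RANK 0 = k \<and> M' TAIL 0 = v \<and>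
      (\<exists>c w. S {v, w} = Some (c, i) \<and> rank (colors S v i) c = k \<and> M' HEAD 0 = w))"
    (is "runs W _ _ M ?Q")
proof -
  let ?M = "M(RANK := (M RANK)(0 := k), TREE := (M TREE)(0 := tree_base v i))"
  note S = ready_valid_state[OF r] and scalars = ready_scalars[OF r]
  have i: "i < B" using v(2) full_bounds(1) by simp
  have kW: "Suc k < W" "k < W" using k card_colors_less[OF S v(1), of i] word_small(1) by linarith+
  have r': "ready S l ?M" using r by simp
  have sel: "runs W select (50 * (H + 1)) ?M (\<lambda>M'. unchanged {KEY, POS, REST} ?M M' \<and>
      M' KEY 0 \<in> colors S v i \<and> rank (colors S v i) (M' KEY 0) = k)"
    by (rule runs_select[OF four_leaves_le_W colors_bounded[OF S] ready_tree[OF r' v(1) i] tree_words[OF v(1) i]])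
      (use scalars k in simp_all)
  have "runs W (select ;; TAIL ::= Var NODE ;; HEAD ::= Read MATE (Var NODE \<otimes> Var STRIDE \<oplus> Var KEY))
      (50 * (H + 1) + 20) ?M ?Q"
  proof (rule runs_SeqI[OF sel])
    fix M1 assume M1: "unchanged {KEY, POS, REST} ?M M1 \<and>
      M1 KEY 0 \<in> colors S v i \<and> rank (colors S v i) (M1 KEY 0) = k"
    then obtain w j where w: "S {v, w} = Some (M1 KEY 0, j)" "i = j \<or> i = full" by (auto elim: colorsE)
    have d: "w < n" "M1 KEY 0 < 2 ^ H" using valid_stateD[OF S w(1)] by auto
    then have c: "M1 KEY 0 < B" "M1 KEY 0 < W" using B_bounds(1) by simp_all
    show "runs W (TAIL ::= Var NODE ;; HEAD ::= Read MATE (Var NODE \<otimes> Var STRIDE \<oplus> Var KEY)) 20 M1 ?Q"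
      using M1 M v w d c scalars ready_mate[OF r w(1)] by (auto simp: runs_simps)
  qed simp
  then show ?thesis unfolding select_edge_def
    using M v i kW scalars by (simp add: runs_simps) (auto elim: runs_conseq)
qed

lemma runs_new_bucket:
  assumes r: "ready S l M" and M: "M TAIL 0 = v" "M HEAD 0 = w" "v < n" "w < n"
  shows "runs W new_bucket 20 M (\<lambda>M'. unchanged {NEW} M M' \<and> M' NEW 0 = min (l v) (l w))"
  unfolding new_bucket_def using M ready_level[OF r M(3)] ready_level[OF r M(4)]
  by (simp add: runs_simps min_def)

lemma runs_move_edge:
  assumes r: "ready S l M" and e: "S {v, w} = Some (c, i)"
    and M: "M TAIL 0 = v" "M HEAD 0 = w" "M NEW 0 = b" and b: "b < full"
  shows "runs W move_edge (400 * (H + 2) + 10) M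
    (\<lambda>M'. unchanged {COLOR, BUCKET, MATE, COUNT, TREE, KEY, POS, SLOT} M M' \<and> ready (S({v, w} \<mapsto> (c, b))) l M')"
  unfolding move_edge_def
proof (rule runs_SeqI[OF runs_remove_edge[OF r e M(1,2)]])
  let ?S = "S({v, w} := None)"
  fix M1 assume M1: "unchanged {COUNT, TREE, KEY, POS, SLOT} M M1 \<and> ready ?S l M1 \<and> M1 KEY 0 = c \<and> M1 SLOT 0 = i"
  let ?M = "M1(SLOT := (M1 SLOT)(0 := b))"
  have S: "valid_state S" by (rule ready_valid_state[OF r])
  have "?S({v, w} \<mapsto> (c, i)) = S" using e by (simp add: fun_upd_idem)
  then have free: "c \<notin> colors ?S a full" if "a \<in> {v, w}" for a
    using color_of_edge_new[of ?S v w c i a] S that by simp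
  have "runs W add_edge (200 * (H + 2)) ?M (\<lambda>M'. unchanged {COLOR, BUCKET, MATE, COUNT, TREE, POS} ?M M' \<and>
      ready (?S({v, w} \<mapsto> (c, b))) l M')"
    by (rule runs_add_edge) (use M1 M b free valid_stateD(1-4)[OF S e] in simp_all)
  then have "runs W add_edge (200 * (H + 2)) ?M
      (\<lambda>M'. unchanged {COLOR, BUCKET, MATE, COUNT, TREE, KEY, POS, SLOT} M M' \<and> ready (S({v, w} \<mapsto> (c, b))) l M')"
    by (rule runs_conseq) (use M1 in simp_all)
  moreover have "b < W" using b full_bounds(1) by simp
  ultimately show "runs W (SLOT ::= Var NEW ;; add_edge) (200 * (H + 2) + 10) M1
      (\<lambda>M'. unchanged {COLOR, BUCKET, MATE, COUNT, TREE, KEY, POS, SLOT} M M' \<and> ready (S({v, w} \<mapsto> (c, b))) l M')"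
    using M1 M by (simp add: runs_simps) (auto elim: runs_conseq)
qed simp

lemma colors_change_bucket:
  assumes S: "valid_state S" and e: "S {v, w} = Some (c, i)" and b: "b \<noteq> i" "i \<noteq> full"
  shows "colors (S({v, w} \<mapsto> (c, b))) v i = colors S v i - {c}"
proof -
  let ?S = "S({v, w} := None)"
  have upd: "?S({v, w} \<mapsto> (c, i)) = S" using e by (simp add: fun_upd_idem)
  then have "c \<notin> colors ?S v i" using color_of_edge_new[of ?S v w c i v] S by simp
  moreover have "colors S v i = insert c (colors ?S v i)"
    using colors_insert[of ?S v w c i v i] upd by simp
  moreover have "colors (S({v, w} \<mapsto> (c, b))) v i = colors ?S v i"
    using colors_insert[of ?S v w c b v i] b by simp
  ultimately show ?thesis by simp
qed

text \<open>While the edges of bucket \<open>i\<close> at \<open>v\<close> are checked in the order of decreasing colors, only the edges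
  with the \<open>k\<close> smallest colors can still be in the wrong bucket.\<close>

definition sifted :: "(nat \<Rightarrow> nat) \<Rightarrow> nat \<Rightarrow> nat \<Rightarrow> nat \<Rightarrow> state \<Rightarrow> bool" where
  "sifted l v i k S \<longleftrightarrow> k \<le> card (colors S v i) \<and>
     (\<forall>w c. S {v, w} = Some (c, i) \<longrightarrow> k \<le> rank (colors S v i) c \<longrightarrow> min (l v) (l w) = i) \<and>
     (\<forall>u w c j. S {u, w} = Some (c, j) \<longrightarrow> j = min (l u) (l w) \<or> j = i \<and> (u = v \<or> w = v))"

lemma siftedD:
  assumes "sifted l v i k S"
  shows "k \<le> card (colors S v i)"
    and "S {v, w} = Some (c, i) \<Longrightarrow> k \<le> rank (colors S v i) c \<Longrightarrow> min (l v) (l w) = i"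
    and "S {u, w} = Some (c, j) \<Longrightarrow> j = min (l u) (l w) \<or> j = i \<and> (u = v \<or> w = v)"
  using assms unfolding sifted_def by blast+

lemma sifted_0_consistent:
  assumes "sifted l v i 0 S"
  shows "consistent S l"
  unfolding consistent_def
proof (intro allI impI)
  fix u w c j assume a: "S {u, w} = Some (c, j)"
  have bucket: "min (l v) (l x) = i" if "S {v, x} = Some (c, i)" for x
    using siftedD(2)[OF assms that] by simp
  from siftedD(3)[OF assms a] show "j = min (l u) (l w)"
    using bucket[of w] bucket[of u] a by (auto simp: insert_commute min.commute)
qed

lemma finite_colors: "valid_state S \<Longrightarrow> finite (colors S v j)"
  using colors_bounded finite_leaves by blast

lemma sifted_keep:
  assumes S: "valid_state S" "sifted l v i (Suc k) S" and w: "S {v, w} = Some (c, i)"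
    and rank: "rank (colors S v i) c = k" and ok: "min (l v) (l w) = i"
  shows "sifted l v i k S"
  unfolding sifted_def
proof (intro conjI allI impI)
  let ?F = "colors S v i"
  have c: "c \<in> ?F" using w by (auto simp: colors_def)
  show "k \<le> card ?F" using siftedD(1)[OF S(2)] by simp
  fix w' c' assume w': "S {v, w'} = Some (c', i)" "k \<le> rank ?F c'"
  have c': "c' \<in> ?F" using w' by (auto simp: colors_def)
  show "min (l v) (l w') = i"
  proof (cases "c' = c")
    case True
    then show ?thesis using valid_stateD(7)[OF S(1) w, of w' i] w'(1) ok by simp
  next
    case False
    then have "rank ?F c' \<noteq> k"
      using rank rank_strict_mono[OF finite_colors[OF S(1)] c, of c']
        rank_strict_mono[OF finite_colors[OF S(1)] c', of c] by linarith
    then show ?thesis using siftedD(2)[OF S(2) w'(1)] w'(2) by simp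
  qed
qed (use siftedD(3)[OF S(2)] in blast)

lemma sifted_move:
  assumes S: "valid_state S" "sifted l v i (Suc k) S" and w: "S {v, w} = Some (c, i)"
    and rank: "rank (colors S v i) c = k" and i: "min (l v) (l w) \<noteq> i" "i < full"
  shows "sifted l v i k (S({v, w} \<mapsto> (c, min (l v) (l w))))"
  unfolding sifted_def
proof (intro conjI allI impI)
  let ?S = "S({v, w} \<mapsto> (c, min (l v) (l w)))" and ?F = "colors S v i"
  have c: "c \<in> ?F" using w by (auto simp: colors_def)
  have F': "colors ?S v i = ?F - {c}" using colors_change_bucket[OF S(1) w i(1)] i(2) by simp
  show "k \<le> card (colors ?S v i)"
    using siftedD(1)[OF S(2)] c finite_colors[OF S(1)] by (simp add: F')
  show "min (l v) (l w') = i" if w': "?S {v, w'} = Some (c', i)" "k \<le> rank (colors ?S v i) c'" for w' c'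
  proof -
    have "w' \<noteq> w" using w'(1) i(1) by auto
    then have w'S: "S {v, w'} = Some (c', i)" using w'(1) by (simp add: doubleton_eq_iff split: if_splits)
    then have c': "c' \<in> ?F" by (auto simp: colors_def)
    have "c' \<noteq> c" using valid_stateD(7)[OF S(1) w, of w' i] w'S \<open>w' \<noteq> w\<close> by auto
    have "\<not> c' < c"
      using rank_strict_mono[OF finite_colors[OF S(1)] c', of c] rank_remove[OF finite_colors[OF S(1)] c, of c']
        w'(2) rank by (auto simp: F')
    then have "Suc k \<le> rank ?F c'"
      using rank_remove[OF finite_colors[OF S(1)] c, of c'] w'(2) \<open>c' \<noteq> c\<close> by (simp add: F')
    then show ?thesis by (rule siftedD(2)[OF S(2) w'S])
  qed
  show "j = min (l u) (l x) \<or> j = i \<and> (u = v \<or> x = v)" if a: "?S {u, x} = Some (d, j)" for u x d j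
  proof (cases "{u, x} = {v, w}")
    case True
    then show ?thesis using a by (auto simp: doubleton_eq_iff min.commute)
  next
    case False
    then show ?thesis using a siftedD(3)[OF S(2), of u x d j] by simp
  qed
qed

definition rebucketing ::
  "state \<Rightarrow> nat set \<Rightarrow> nat \<Rightarrow> (nat \<Rightarrow> nat) \<Rightarrow> nat \<Rightarrow> nat \<Rightarrow> nat \<Rightarrow> state \<Rightarrow> memory \<Rightarrow> bool" where
  "rebucketing S0 X s l v i k S M \<longleftrightarrow> ready S l M \<and> M NODE 0 = v \<and> M OLD 0 = i \<and>
     M TOP 0 + k \<le> s \<and> X \<subseteq> stack M \<and> stack M \<subseteq> X \<union> {..<n} \<and> sifted l v i k S \<and> color_changes S0 S = {} \<and>
     (\<forall>w c. S0 {v, w} = Some (c, i) \<longrightarrow> w \<in> stack M \<or> S {v, w} = Some (c, i))"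

lemma rebucketing_unchanged:
  assumes "rebucketing S0 X s l v i k S M" "unchanged {TREE, KEY, POS, RANK, REST, TAIL, HEAD, NEW} M M'"
  shows "rebucketing S0 X s l v i k S M'"
proof -
  have "ready S l M'"
    by (rule ready_unchanged[OF _ assms(2)]) (use assms(1) in \<open>auto simp: rebucketing_def\<close>)
  then show ?thesis using assms by (simp add: rebucketing_def stack_def)
qed

lemma rebucketing_move:
  assumes I: "rebucketing S0 X s l v i (Suc k) S M" and w: "S {v, w} = Some (c, i)"
    and rank: "rank (colors S v i) c = k" and i: "min (l v) (l w) \<noteq> i" "i < full"
    and M': "ready (S({v, w} \<mapsto> (c, min (l v) (l w)))) l M'" "M' NODE 0 = v" "M' OLD 0 = i"
      "stack M' = insert w (stack M)" "M' TOP 0 = M TOP 0 + 1"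
  shows "rebucketing S0 X s l v i k (S({v, w} \<mapsto> (c, min (l v) (l w)))) M'"
proof -
  have r: "ready S l M" and M: "M TOP 0 + Suc k \<le> s" "X \<subseteq> stack M" "stack M \<subseteq> X \<union> {..<n}"
    and sift: "sifted l v i (Suc k) S" and same: "color_changes S0 S = {}"
    and kept: "\<And>w c. S0 {v, w} = Some (c, i) \<Longrightarrow> w \<in> stack M \<or> S {v, w} = Some (c, i)"
    using I unfolding rebucketing_def by blast+
  note S = ready_valid_state[OF r]
  have "w < n" using valid_stateD(2)[OF S w] .
  moreover have "color_changes S0 (S({v, w} \<mapsto> (c, min (l v) (l w)))) = {}"
    using same w by (auto simp: color_changes_def)
  moreover have "x \<in> insert w (stack M) \<or> (S({v, w} \<mapsto> (c, min (l v) (l w)))) {v, x} = Some (d, i)"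
    if "S0 {v, x} = Some (d, i)" for x d
    using kept[OF that] by (auto simp: doubleton_eq_iff)
  ultimately show ?thesis
    using M M' sifted_move[OF S sift w rank i] unfolding rebucketing_def by auto
qed

lemma runs_rebucket_move:
  assumes I: "rebucketing S0 X s l v i (Suc k) S M" and s: "s < W" and i: "i < full"
    and M: "M TAIL 0 = v" "M HEAD 0 = w" "M NEW 0 = min (l v) (l w)"
    and w: "S {v, w} = Some (c, i)" and rank: "rank (colors S v i) c = k" and move: "min (l v) (l w) \<noteq> i"
  shows "runs W (move_edge ;; push (Var HEAD)) (400 * (H + 2) + 30) M
    (\<lambda>M'. M' RANK 0 = M RANK 0 \<and> (\<exists>S'. rebucketing S0 X s l v i k S' M'))"
    (is "runs W _ _ M ?Q")
proof -
  let ?b = "min (l v) (l w)"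
  have r: "ready S l M" and regs: "M NODE 0 = v" "M OLD 0 = i" "M TOP 0 + 1 < W"
    using I s by (auto simp: rebucketing_def)
  note d = valid_stateD[OF ready_valid_state[OF r] w]
  have b: "?b < full" using ready_level(2)[OF r d(1)] by simp
  show ?thesis
  proof (rule runs_SeqI[OF runs_move_edge[OF r w M b]])
    fix M1 assume M1: "unchanged {COLOR, BUCKET, MATE, COUNT, TREE, KEY, POS, SLOT} M M1 \<and>
      ready (S({v, w} \<mapsto> (c, ?b))) l M1"
    have "runs W (push (Var HEAD)) (10 + expr_cost (Var HEAD)) M1 (\<lambda>M'. unchanged {STACK, TOP} M1 M' \<and>
        stack M' = insert w (stack M1) \<and> M' TOP 0 = M1 TOP 0 + 1)"
      by (rule runs_push) (use M1 M(2) regs(3) d(2) in simp_all)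
    then show "runs W (push (Var HEAD)) 20 M1 ?Q"
    proof (rule runs_conseq)
      fix M' assume M': "unchanged {STACK, TOP} M1 M' \<and> stack M' = insert w (stack M1) \<and> M' TOP 0 = M1 TOP 0 + 1"
      have "ready (S({v, w} \<mapsto> (c, ?b))) l M'"
        by (rule ready_unchanged[of _ _ M1 "{STACK, TOP}"]) (use M1 M' in auto)
      moreover have "stack M1 = stack M" using M1 by (simp add: stack_def)
      ultimately have "rebucketing S0 X s l v i k (S({v, w} \<mapsto> (c, ?b))) M'"
        using rebucketing_move[OF I w rank move i] M1 M' regs by simp
      then show "?Q M'" using M1 M' by auto
    qed simp
  qed simp
qed

lemma runs_rebucket_edge:
  assumes I: "rebucketing S0 X s l v i (Suc k) S M" and s: "s < W" and i: "i < full"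
    and M: "M RANK 0 = k" "M TAIL 0 = v" "M HEAD 0 = w" "M NEW 0 = min (l v) (l w)"
    and w: "S {v, w} = Some (c, i)" and rank: "rank (colors S v i) c = k"
  shows "runs W (If (Var NEW \<doteq> Var OLD) Skip (move_edge ;; push (Var HEAD))) (400 * (H + 2) + 60) M
    (\<lambda>M'. M' RANK 0 = k \<and> (\<exists>S'. rebucketing S0 X s l v i k S' M'))"
proof -
  have r: "ready S l M" and old: "M OLD 0 = i" and sift: "sifted l v i (Suc k) S"
    using I by (auto simp: rebucketing_def)
  note S = ready_valid_state[OF r]
  have words: "min (l v) (l w) < W" "i < W"
    using ready_level(4)[OF r valid_stateD(1)[OF S w]] i full_bounds(1) B_less_W by simp_all
  show ?thesis
  proof (cases "min (l v) (l w) = i")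
    case True
    have "rebucketing S0 X s l v i k S M"
      using I sifted_keep[OF S sift w rank True] by (simp add: rebucketing_def)
    then show ?thesis using True M(1,4) old words by (auto simp: runs_simps)
  next
    case False
    show ?thesis
      using runs_rebucket_move[OF I s i M(2-4) w rank False] False M(1,4) old words
      by (simp add: runs_simps) (auto elim: runs_conseq)
  qed
qed

lemma runs_rebucket_step:
  assumes v: "v < n" "i < full" and s: "s < W"
    and I: "rebucketing S0 X s l v i (Suc k) S M" and k: "M RANK 0 = Suc k"
  shows "runs W rebucket_step (600 * (H + 2)) M
    (\<lambda>M'. M' RANK 0 = k \<and> (\<exists>S'. rebucketing S0 X s l v i k S' M'))"
proof -
  have r: "ready S l M" and M: "M NODE 0 = v" "M OLD 0 = i" and sift: "sifted l v i (Suc k) S"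
    using I by (auto simp: rebucketing_def)
  have "k < card (colors S v i)" using siftedD(1)[OF sift] by simp
  note select = runs_select_edge[OF r M k v this]
  show ?thesis unfolding rebucket_step_def
  proof (rule runs_SeqI[OF select], elim conjE exE)
    fix M1 c w
    assume M1: "unchanged {TREE, KEY, POS, RANK, REST, TAIL, HEAD} M M1"
        "M1 RANK 0 = k" "M1 TAIL 0 = v" "M1 HEAD 0 = w"
      and w: "S {v, w} = Some (c, i)" and rank: "rank (colors S v i) c = k"
    note d = valid_stateD[OF ready_valid_state[OF r] w]
    have r1: "ready S l M1" by (rule ready_unchanged[OF r M1(1)]) auto
    show "runs W (new_bucket ;; If (Var NEW \<doteq> Var OLD) Skip (move_edge ;; push (Var HEAD)))
        (400 * (H + 2) + 80) M1 (\<lambda>M'. M' RANK 0 = k \<and> (\<exists>S'. rebucketing S0 X s l v i k S' M'))"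
    proof (rule runs_SeqI[OF runs_new_bucket[OF r1 M1(3,4) d(1,2)]], elim conjE)
      fix M2 assume M2: "unchanged {NEW} M1 M2" "M2 NEW 0 = min (l v) (l w)"
      have "rebucketing S0 X s l v i (Suc k) S M2"
        by (rule rebucketing_unchanged[OF I]) (use M1 M2 in auto)
      then show "runs W (If (Var NEW \<doteq> Var OLD) Skip (move_edge ;; push (Var HEAD)))
          (400 * (H + 2) + 60) M2 (\<lambda>M'. M' RANK 0 = k \<and> (\<exists>S'. rebucketing S0 X s l v i k S' M'))"
        by (rule runs_rebucket_edge[OF _ s v(2) _ _ _ _ w rank]) (use M1 M2 in auto)
    qed simp
  qed simp
qed

lemma runs_rebucket_loop:
  assumes v: "v < n" "i < full" and s: "s < W"
    and I: "rebucketing S0 X s l v i k S M" and k: "M RANK 0 = k"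
  shows "runs W (While (Var RANK) rebucket_step) (k * (600 * (H + 2) + 3) + 3) M
    (\<lambda>M'. \<exists>S'. rebucketing S0 X s l v i 0 S' M')"
proof -
  let ?I = "\<lambda>k M'. M' RANK 0 = k \<and> (\<exists>S'. rebucketing S0 X s l v i k S' M')"
  have "runs W (While (Var RANK) rebucket_step)
      (k * (600 * (H + 2) + 1 + expr_cost (Var RANK)) + (1 + expr_cost (Var RANK))) M (?I 0)"
  proof (rule runs_While_countdown[where I = ?I])
    fix k M' assume I: "?I (Suc k) M'"
    then obtain S' where S': "rebucketing S0 X s l v i (Suc k) S' M'" by blast
    have "Suc k \<le> card (colors S' v i)" "ready S' l M'"
      using S' siftedD(1) by (auto simp: rebucketing_def)
    then have "Suc k < W" using card_colors_less[of S' v i] ready_valid_state[of S'] v(1) word_small(1)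
      by fastforce
    then show "(\<exists>x. eval W M' (Var RANK) = Some x \<and> x \<noteq> 0) \<and> runs W rebucket_step (600 * (H + 2)) M' (?I k)"
      using runs_rebucket_step[OF v s S'] I by simp
  qed (use I k in auto)
  then show ?thesis by (rule runs_conseq) simp_all
qed

lemma rebucketing_start:
  assumes r: "ready S l M" and c: "consistent S l" and v: "v < n"
    and i: "i < full" "\<And>x. x < l v \<Longrightarrow> x \<le> i"
    and M': "ready S (l(v := i)) M'" "M' NODE 0 = v" "M' OLD 0 = l v" "M' TOP = M TOP" "M' STACK = M STACK"
  shows "rebucketing S (stack M) (M TOP 0 + card (colors S v (l v))) (l(v := i)) v (l v)
    (card (colors S v (l v))) S M'"
proof -
  note S = ready_valid_state[OF r]
  have "sifted (l(v := i)) v (l v) (card (colors S v (l v))) S" unfolding sifted_def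
  proof (intro conjI allI impI)
    fix w d assume a: "S {v, w} = Some (d, l v)" and "card (colors S v (l v)) \<le> rank (colors S v (l v)) d"
    moreover have "d \<in> colors S v (l v)" using a by (auto simp: colors_def)
    then have "rank (colors S v (l v)) d < card (colors S v (l v))" by (rule rank_less_card[OF finite_colors[OF S]])
    ultimately show "min ((l(v := i)) v) ((l(v := i)) w) = l v" by simp
  next
    fix u w d j assume a: "S {u, w} = Some (d, j)"
    have "l u < l v \<longrightarrow> l u \<le> i" "l w < l v \<longrightarrow> l w \<le> i" using i(2) by auto
    then show "j = min ((l(v := i)) u) ((l(v := i)) w) \<or> j = l v \<and> (u = v \<or> w = v)"
      using consistentD[OF c a] valid_stateD(3)[OF S a] by (auto simp: min_def)
  qed simp
  then show ?thesis using M' by (auto simp: rebucketing_def color_changes_def stack_def)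
qed

lemma rebucketing_stack:
  assumes c: "valid_state S" "consistent S l" and I: "rebucketing S X s (l(v := i)) v (l v) 0 S' M"
    and w: "w \<in> neighbors (dom S) v" "l v \<le> l w" "min i (l w) \<noteq> l v"
  shows "w \<in> stack M"
proof -
  obtain a j where a: "S {v, w} = Some (a, j)" using w(1) by (auto simp: neighbors_def)
  have sift: "sifted (l(v := i)) v (l v) 0 S'"
    and kept: "S {v, w} = Some (a, l v) \<Longrightarrow> w \<in> stack M \<or> S' {v, w} = Some (a, l v)"
    using I unfolding rebucketing_def by blast+
  have "j = l v" using consistentD[OF c(2) a] w(2) by simp
  moreover have "min ((l(v := i)) v) ((l(v := i)) w) \<noteq> l v" using w(3) valid_stateD(3)[OF c(1) a] by auto
  ultimately show ?thesis using kept a siftedD(2)[OF sift, of w a] by auto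
qed

lemma runs_rebucket:
  assumes r: "ready S l M" and c: "consistent S l" and M: "M NODE 0 = v" and v: "v < n"
    and e: "\<And>M. M OLD 0 = l v \<Longrightarrow> eval W M e = Some i" "expr_cost e = 4"
    and i: "i < full" "\<And>x. x < l v \<Longrightarrow> x \<le> i"
  defines "d \<equiv> deg_above (dom S) l v (l v)"
  assumes s: "M TOP 0 + d < W"
  shows "runs W (rebucket e) (d * (600 * (H + 2) + 3) + 40) M (\<lambda>M'. M' TOP 0 \<le> M TOP 0 + d \<and>
    stack M \<subseteq> stack M' \<and> stack M' \<subseteq> stack M \<union> {..<n} \<and>
    (\<forall>w \<in> neighbors (dom S) v. l v \<le> l w \<longrightarrow> min i (l w) \<noteq> l v \<longrightarrow> w \<in> stack M') \<and>
    (\<exists>S'. ready S' (l(v := i)) M' \<and> consistent S' (l(v := i)) \<and> color_changes S S' = {}))"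
    (is "runs W _ _ M ?Q")
proof -
  let ?l = "l(v := i)"
  define M1 where "M1 = M(OLD := (M OLD)(0 := l v), LEVEL := (M LEVEL)(v := i), RANK := (M RANK)(0 := d))"
  note S = ready_valid_state[OF r] and level = ready_level[OF r v]
  have d: "card (colors S v (l v)) = d" unfolding d_def by (rule card_colors_level[OF S c level(2)])
  have r1: "ready S ?l M1"
    using r i(1) by (simp add: ready_def represents_def tables_at_def trees_at_def tree_at_def M1_def)
  have start: "rebucketing S (stack M) (M TOP 0 + d) ?l v (l v) d S M1"
    using rebucketing_start[OF r c v i r1] M unfolding d by (simp add: M1_def)
  have "runs W (While (Var RANK) rebucket_step) (d * (600 * (H + 2) + 3) + 3) M1 ?Q"
  proof (rule runs_conseq[OF runs_rebucket_loop[OF v level(2) s start]])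
    fix M' assume "\<exists>S'. rebucketing S (stack M) (M TOP 0 + d) ?l v (l v) 0 S' M'"
    then obtain S' where I: "rebucketing S (stack M) (M TOP 0 + d) ?l v (l v) 0 S' M'" by blast
    then have "sifted ?l v (l v) 0 S'" by (simp add: rebucketing_def)
    then have "consistent S' ?l" by (rule sifted_0_consistent)
    then show "?Q M'" using rebucketing_stack[OF S c I] I unfolding rebucketing_def by auto
  qed (simp_all add: M1_def)
  moreover have "M COUNT (tree_base v (l v) + 1) = d" using ready_tree_root[OF r v level(3)] d by simp
  moreover have "tree_base v (l v) + 1 < W" using v level(3) B_bounds(6) by simp
  moreover have "d < W" "i < W" using s i(1) full_bounds(1) by simp_all
  ultimately show ?thesis unfolding rebucket_def using M v level ready_scalars[OF r]
    by (simp add: runs_simps e M1_def) (auto elim: runs_conseq)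
qed

definition C :: nat where "C = 600 * (H + 2) + 120"

end

text \<open>Levels are changed by the rule \<open>l v := nl (l v)\<close> at all nodes \<open>v\<close> that violate a condition,
  which the expression \<open>b\<close> tests; \<open>e\<close> computes the new level.\<close>

locale level_rule = coloring_ram +
  fixes b e :: expr and E :: "nat set set" and nl :: "nat \<Rightarrow> nat"
    and viol :: "(nat \<Rightarrow> nat) \<Rightarrow> nat \<Rightarrow> bool" and Inv :: "(nat \<Rightarrow> nat) \<Rightarrow> bool" and \<Phi> :: "(nat \<Rightarrow> nat) \<Rightarrow> nat"
  assumes eval_condition: "ready S l M \<Longrightarrow> consistent S l \<Longrightarrow> dom S = E \<Longrightarrow> M NODE 0 = v \<Longrightarrow> v < n \<Longrightarrow>
      \<exists>x. eval W M b = Some x \<and> (x \<noteq> 0 \<longleftrightarrow> viol l v)"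
    and cost_condition: "expr_cost b \<le> 50"
    and eval_new_level: "M OLD 0 = i \<Longrightarrow> i < full \<Longrightarrow> eval W M e = Some (nl i)"
    and cost_new_level: "expr_cost e = 4"
    and Inv_step: "Inv l \<Longrightarrow> v < n \<Longrightarrow> viol l v \<Longrightarrow> Inv (l(v := nl (l v)))"
    and new_level_less: "Inv l \<Longrightarrow> v < n \<Longrightarrow> viol l v \<Longrightarrow> nl (l v) < full"
    and new_level_ge: "Inv l \<Longrightarrow> v < n \<Longrightarrow> viol l v \<Longrightarrow> x < l v \<Longrightarrow> x \<le> nl (l v)"
    and \<Phi>_step: "Inv l \<Longrightarrow> v < n \<Longrightarrow> viol l v \<Longrightarrow>
      \<Phi> (l(v := nl (l v))) + N * (deg_above E l v (l v) + 1) \<le> \<Phi> l"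
    and viol_step: "Inv l \<Longrightarrow> v < n \<Longrightarrow> viol l v \<Longrightarrow> w < n \<Longrightarrow> w \<noteq> v \<Longrightarrow> viol (l(v := nl (l v))) w \<Longrightarrow>
      viol l w \<or> w \<in> neighbors E v \<and> l v \<le> l w \<and> min (nl (l v)) (l w) \<noteq> l v"
begin

definition fixing :: "state \<Rightarrow> state \<Rightarrow> (nat \<Rightarrow> nat) \<Rightarrow> memory \<Rightarrow> bool" where
  "fixing S0 S l M \<longleftrightarrow> ready S l M \<and> consistent S l \<and> dom S = E \<and> color_changes S0 S = {} \<and> Inv l \<and>
     stack M \<subseteq> {..<n} \<and> (\<forall>v<n. viol l v \<longrightarrow> v \<in> stack M) \<and> 2 * \<Phi> l + N * M TOP 0 < W"

definition repaired :: "state \<Rightarrow> (nat \<Rightarrow> nat) \<Rightarrow> memory \<Rightarrow> bool" where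
  "repaired S0 l M \<longleftrightarrow> (\<exists>S. ready S l M \<and> consistent S l \<and> dom S = E \<and> color_changes S0 S = {}) \<and>
     Inv l \<and> (\<forall>v<n. \<not> viol l v)"

lemma fixing_top:
  assumes I: "fixing S0 S l M" and top: "M TOP 0 = Suc t"
  shows "M STACK t < n" "stack M = insert (M STACK t) (M STACK ` {..<t})" "Suc t < W"
proof -
  show st: "stack M = insert (M STACK t) (M STACK ` {..<t})" by (simp add: stack_def top lessThan_Suc)
  show "M STACK t < n" using I st by (simp add: fixing_def)
  have "1 * Suc t \<le> N * Suc t" using N_ge by (rule mult_right_mono) simp
  then show "Suc t < W" using I top by (simp add: fixing_def)
qed

lemma fixing_pop:
  assumes I: "fixing S0 S l M" and top: "M TOP 0 = Suc t" and ok: "\<not> viol l (M STACK t)"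
  shows "fixing S0 S l (M(NODE := (M NODE)(0 := M STACK t), TOP := (M TOP)(0 := t)))"
proof -
  let ?M = "M(NODE := (M NODE)(0 := M STACK t), TOP := (M TOP)(0 := t))"
  have "stack M = insert (M STACK t) (stack ?M)" using fixing_top(2)[OF I top] by (simp add: stack_def)
  moreover have "N * t \<le> N * Suc t" by simp
  ultimately show ?thesis using I top ok unfolding fixing_def by auto
qed

lemma fixing_move:
  assumes I: "fixing S0 S l M" and v: "v < n" "viol l v" "v \<in> stack M"
  defines "d \<equiv> deg_above E l v (l v)" and "l' \<equiv> l(v := nl (l v))"
  assumes top: "M' TOP 0 \<le> M TOP 0 + d" and st: "stack M \<subseteq> stack M'" "stack M' \<subseteq> stack M \<union> {..<n}"
    and pushed: "\<And>w. w \<in> neighbors E v \<Longrightarrow> l v \<le> l w \<Longrightarrow> min (nl (l v)) (l w) \<noteq> l v \<Longrightarrow> w \<in> stack M'"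
    and S': "ready S' l' M'" "consistent S' l'" "color_changes S S' = {}"
  shows "fixing S0 S' l' M'" "2 * \<Phi> l' + N * M' TOP 0 + N * (d + 1) \<le> 2 * \<Phi> l + N * M TOP 0"
proof -
  have inv: "Inv l" "dom S = E" "color_changes S0 S = {}" "stack M \<subseteq> {..<n}" "2 * \<Phi> l + N * M TOP 0 < W"
    and violated: "\<And>v. v < n \<Longrightarrow> viol l v \<Longrightarrow> v \<in> stack M" using I by (auto simp: fixing_def)
  have "N * M' TOP 0 \<le> N * M TOP 0 + N * d" using mult_left_mono[OF top, of N] by (simp add: distrib_left)
  moreover have "\<Phi> l' + (N * d + N) \<le> \<Phi> l" using \<Phi>_step[OF inv(1) v(1,2)] by (simp add: d_def l'_def distrib_left)
  ultimately show pot: "2 * \<Phi> l' + N * M' TOP 0 + N * (d + 1) \<le> 2 * \<Phi> l + N * M TOP 0"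
    by (simp add: distrib_left)
  have "w \<in> stack M'" if w: "w < n" "viol l' w" for w
  proof (cases "w = v")
    case False
    then show ?thesis using viol_step[OF inv(1) v(1,2) w(1)] w violated[of w] pushed st(1) unfolding l'_def by blast
  qed (use v(3) st(1) in blast)
  moreover have "dom S' = E" using color_changes_empty_dom[OF S'(3)] inv(2) by simp
  moreover have "color_changes S0 S' = {}" using color_changes_same_colors[OF S'(3)] inv(3) by simp
  moreover have "2 * \<Phi> l' + N * M' TOP 0 < W" using pot inv(5) by linarith
  ultimately show "fixing S0 S' l' M'"
    using S'(1,2) Inv_step[OF inv(1) v(1,2)] inv(4) st(2) unfolding fixing_def l'_def by auto
qed

lemma credit_pays:
  assumes "q' + N * (d + 1) \<le> q" "T \<le> C * (d + 1)"
  shows "N * T + C * q' \<le> C * q"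
proof -
  have "N * T + C * q' \<le> N * (C * (d + 1)) + C * q'" using assms(2) by simp
  also have "\<dots> = C * (q' + N * (d + 1))" by (simp add: algebra_simps)
  also have "\<dots> \<le> C * q" using assms(1) by (rule mult_left_mono) simp
  finally show ?thesis .
qed

lemma runs_fix_step_pop:
  assumes I: "fixing S0 S l M" and top: "M TOP 0 = Suc t" and ok: "\<not> viol l (M STACK t)"
  shows "runs W (fix_step b e) 70 M (\<lambda>M'. fixing S0 S l M' \<and> M' TOP 0 = t)"
proof -
  let ?M = "M(NODE := (M NODE)(0 := M STACK t))"
  note top_bounds = fixing_top[OF I top]
  have "ready S l ?M" "consistent S l" "dom S = E" using I by (auto simp: fixing_def)
  then have "eval W ?M b = Some 0" using eval_condition[of S l ?M "M STACK t"] ok top_bounds(1) by auto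
  then show ?thesis
    unfolding fix_step_def using fixing_pop[OF I top ok] top top_bounds cost_condition
    by (simp add: runs_simps)
qed

lemma runs_fix_step_move:
  assumes I: "fixing S0 S l M" and top: "M TOP 0 = Suc t" and v: "v = M STACK t" "viol l v"
  defines "d \<equiv> deg_above E l v (l v)" and "l' \<equiv> l(v := nl (l v))"
  shows "runs W (fix_step b e) (d * (600 * (H + 2) + 3) + 100) M (\<lambda>M'. \<exists>S'. fixing S0 S' l' M' \<and>
    2 * \<Phi> l' + N * M' TOP 0 + N * (d + 1) \<le> 2 * \<Phi> l + N * M TOP 0)"
    (is "runs W _ _ M ?Q")
proof -
  let ?M = "M(NODE := (M NODE)(0 := v))"
  note top_bounds = fixing_top[OF I top, folded v(1)]
  have r: "ready S l ?M" and cons: "consistent S l" and dom: "dom S = E" and inv: "Inv l"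
    and W: "2 * \<Phi> l + N * M TOP 0 < W" using I by (auto simp: fixing_def)
  obtain x where x: "eval W ?M b = Some x" "x \<noteq> 0"
    using eval_condition[OF r cons dom _ top_bounds(1)] v(2) by auto
  have new: "eval W M' e = Some (nl (l v))" if "M' OLD 0 = l v" for M'
    using eval_new_level[of M' "l v"] that ready_level(2)[OF r top_bounds(1)] by blast
  have "1 * (M TOP 0 + d) \<le> N * (M TOP 0 + d)" using N_ge by (rule mult_right_mono) simp
  also have "\<dots> \<le> 2 * \<Phi> l + N * M TOP 0"
    using \<Phi>_step[OF inv top_bounds(1) v(2)] by (simp add: d_def distrib_left)
  finally have s: "?M TOP 0 + deg_above (dom S) l v (l v) < W" using W dom by (simp add: d_def)
  have I': "fixing S0 S l ?M" using I r by (simp add: fixing_def stack_def)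
  have "runs W (rebucket e) (d * (600 * (H + 2) + 3) + 40) ?M ?Q"
  proof (rule runs_conseq[OF runs_rebucket[OF r cons _ top_bounds(1) new cost_new_level
          new_level_less[OF inv top_bounds(1) v(2)] new_level_ge[OF inv top_bounds(1) v(2)] s]])
    show "d * (600 * (H + 2) + 3) + 40 \<ge> deg_above (dom S) l v (l v) * (600 * (H + 2) + 3) + 40"
      by (simp add: d_def dom)
    show "?Q M'" if "M' TOP 0 \<le> ?M TOP 0 + deg_above (dom S) l v (l v) \<and> stack ?M \<subseteq> stack M' \<and>
        stack M' \<subseteq> stack ?M \<union> {..<n} \<and>
        (\<forall>w \<in> neighbors (dom S) v. l v \<le> l w \<longrightarrow> min (nl (l v)) (l w) \<noteq> l v \<longrightarrow> w \<in> stack M') \<and>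
        (\<exists>S'. ready S' (l(v := nl (l v))) M' \<and> consistent S' (l(v := nl (l v))) \<and> color_changes S S' = {})" for M'
      using that fixing_move[OF I' top_bounds(1) v(2), of M'] top_bounds(2) unfolding dom d_def l'_def
      by (auto simp: stack_def)
  qed simp_all
  then show ?thesis unfolding fix_step_def
    using x top top_bounds cost_condition by (simp add: runs_simps v(1)) (auto elim: runs_conseq)
qed

lemma runs_fix_step:
  assumes I: "fixing S0 S l M" and top: "0 < M TOP 0"
  shows "\<exists>T. runs W (fix_step b e) T M (\<lambda>M'. \<exists>S' l'. fixing S0 S' l' M' \<and>
    N * (3 + T) + C * (2 * \<Phi> l' + N * M' TOP 0) \<le> C * (2 * \<Phi> l + N * M TOP 0))"
proof -
  obtain t where t: "M TOP 0 = Suc t" using top gr0_implies_Suc by blast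
  define v where "v = M STACK t"
  show ?thesis
  proof (cases "viol l v")
    case False
    have "N * (3 + 70) + C * (2 * \<Phi> l + N * t) \<le> C * (2 * \<Phi> l + N * M TOP 0)"
      by (rule credit_pays[where d = 0]) (simp_all add: t C_def)
    then show ?thesis
      by (intro exI[of _ 70] runs_conseq[OF runs_fix_step_pop[OF I t] order.refl])
        (use False in \<open>auto simp: v_def\<close>)
  next
    case True
    let ?d = "deg_above E l v (l v)" and ?l = "l(v := nl (l v))"
    let ?T = "?d * (600 * (H + 2) + 3) + 100"
    have "3 + ?T \<le> C * (?d + 1)" by (simp add: C_def algebra_simps)
    then have "N * (3 + ?T) + C * q \<le> C * (2 * \<Phi> l + N * M TOP 0)"
      if "q + N * (?d + 1) \<le> 2 * \<Phi> l + N * M TOP 0" for q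
      using credit_pays[OF that] by blast
    then show ?thesis
      by (intro exI[of _ ?T] runs_conseq[OF runs_fix_step_move[OF I t v_def True] order.refl]) blast
  qed
qed

lemma runs_fix_loop_credit:
  assumes I: "fixing S0 S l M"
  shows "\<exists>T. runs W (fix_loop b e) T M (\<lambda>M'. \<exists>k. (\<exists>S' l'. fixing S0 S' l' M' \<and> M' TOP 0 = 0 \<and> C * (2 * \<Phi> l') \<le> k) \<and>
    N * T + k \<le> C * (2 * \<Phi> l + N * M TOP 0) + N * (1 + expr_cost (Var TOP)))"
  unfolding fix_loop_def
proof (rule runs_While_amortized)
  let ?J = "\<lambda>k M'. \<exists>S' l'. fixing S0 S' l' M' \<and> C * (2 * \<Phi> l' + N * M' TOP 0) \<le> k"
  show "?J (C * (2 * \<Phi> l + N * M TOP 0)) M" using I by blast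
  fix k M' assume "?J k M'"
  then obtain S' l' where I': "fixing S0 S' l' M'" and k: "C * (2 * \<Phi> l' + N * M' TOP 0) \<le> k" by blast
  have "\<exists>T. runs W (fix_step b e) T M' (\<lambda>M''. \<exists>k'. ?J k' M'' \<and> N * (1 + expr_cost (Var TOP) + T) + k' \<le> k)"
    if top: "0 < M' TOP 0"
  proof -
    obtain T where T: "runs W (fix_step b e) T M' (\<lambda>M''. \<exists>S'' l''. fixing S0 S'' l'' M'' \<and>
        N * (3 + T) + C * (2 * \<Phi> l'' + N * M'' TOP 0) \<le> C * (2 * \<Phi> l' + N * M' TOP 0))"
      using runs_fix_step[OF I' top] by blast
    show ?thesis
      by (rule exI[of _ T], rule runs_conseq[OF T order.refl]) (use k in \<open>auto intro: order_trans\<close>)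
  qed
  moreover have "M' TOP 0 < W" using I' fixing_top(3) by (cases "M' TOP 0") auto
  ultimately show "\<exists>x. eval W M' (Var TOP) = Some x \<and>
      (if x = 0 then \<exists>S' l'. fixing S0 S' l' M' \<and> M' TOP 0 = 0 \<and> C * (2 * \<Phi> l') \<le> k
       else \<exists>T. runs W (fix_step b e) T M' (\<lambda>M''. \<exists>k'. ?J k' M'' \<and> N * (1 + expr_cost (Var TOP) + T) + k' \<le> k))"
    using I' k by (cases "M' TOP 0 = 0") (simp, blast, simp)
qed (use N_ge in simp)

lemma runs_fix_loop:
  assumes I: "fixing S0 S l M"
  shows "\<exists>T. runs W (fix_loop b e) T M (\<lambda>M'. \<exists>l'. repaired S0 l' M' \<and>
    N * T + C * (2 * \<Phi> l') \<le> C * (2 * \<Phi> l + N * M TOP 0) + N * 3)"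
proof -
  obtain T where T: "runs W (fix_loop b e) T M (\<lambda>M'. \<exists>k.
      (\<exists>S' l'. fixing S0 S' l' M' \<and> M' TOP 0 = 0 \<and> C * (2 * \<Phi> l') \<le> k) \<and>
      N * T + k \<le> C * (2 * \<Phi> l + N * M TOP 0) + N * (1 + expr_cost (Var TOP)))"
    using runs_fix_loop_credit[OF I] by blast
  show ?thesis
  proof (rule exI[of _ T], rule runs_conseq[OF T order.refl], elim exE conjE)
    fix M' k S' l'
    assume I': "fixing S0 S' l' M'" and top: "M' TOP 0 = 0" and k: "C * (2 * \<Phi> l') \<le> k"
      "N * T + k \<le> C * (2 * \<Phi> l + N * M TOP 0) + N * (1 + expr_cost (Var TOP))"
    have "stack M' = {}" using top by (simp add: stack_def)
    then have "repaired S0 l' M'" using I' unfolding fixing_def repaired_def by auto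
    moreover have "N * T + C * (2 * \<Phi> l') \<le> C * (2 * \<Phi> l + N * M TOP 0) + N * 3" using k by simp
    ultimately show "\<exists>l'. repaired S0 l' M' \<and>
        N * T + C * (2 * \<Phi> l') \<le> C * (2 * \<Phi> l + N * M TOP 0) + N * 3" by blast
  qed
qed

end

section \<open>Processing an update\<close>

definition init_loop :: com where
  "init_loop = While (Var LEAVES \<prec> Const 2 \<otimes> Var INPUT) (LEAVES ::= Const 2 \<otimes> Var LEAVES)"

definition init :: "nat \<Rightarrow> com" where
  "init N = LEAVES ::= Const 1 ;; init_loop ;; STRIDE ::= Const (4 * N) \<otimes> Var LEAVES"

definition orient :: com where
  "orient = If (Read LEVEL (Read INPUT (Const 4)) \<prec> Read LEVEL (Read INPUT (Const 3)))
     (TAIL ::= Read INPUT (Const 4) ;; HEAD ::= Read INPUT (Const 3))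
     (TAIL ::= Read INPUT (Const 3) ;; HEAD ::= Read INPUT (Const 4))"

definition color_edge :: com where
  "color_edge = orient ;; ACTIVE ::= Const 1 ;; color_loop"

definition uncolor_edge :: com where
  "uncolor_edge = TAIL ::= Read INPUT (Const 3) ;; HEAD ::= Read INPUT (Const 4) ;; remove_edge"

definition push_endpoints :: com where
  "push_endpoints = TOP ::= Const 0 ;; push (Read INPUT (Const 3)) ;; push (Read INPUT (Const 4))"

definition raise_cond :: "nat \<Rightarrow> expr" where
  "raise_cond N = Const (4 * N + 5) \<otimes> Read INPUT (Const 1) \<prec>
     Const N \<otimes> Read COUNT ((Var NODE \<otimes> Var STRIDE \<oplus> Read LEVEL (Var NODE)) \<otimes> Var STRIDE \<oplus> Const 1)"

definition lower_cond :: "nat \<Rightarrow> expr" where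
  "lower_cond N = (Const 0 \<prec> Read LEVEL (Var NODE)) \<otimes>
     (Const N \<otimes> (Read COUNT ((Var NODE \<otimes> Var STRIDE \<oplus> Read LEVEL (Var NODE)) \<otimes> Var STRIDE \<oplus> Const 1) \<oplus>
        Read COUNT ((Var NODE \<otimes> Var STRIDE \<oplus> (Read LEVEL (Var NODE) \<ominus> Const 1)) \<otimes> Var STRIDE \<oplus> Const 1))
      \<prec> Const (2 * N + 1) \<otimes> Read INPUT (Const 1))"

definition insert_edge :: "nat \<Rightarrow> com" where
  "insert_edge N = color_edge ;; push_endpoints ;; fix_loop (raise_cond N) (Var OLD \<oplus> Const 1)"

definition delete_edge :: "nat \<Rightarrow> com" where
  "delete_edge N = uncolor_edge ;; push_endpoints ;; fix_loop (lower_cond N) (Var OLD \<ominus> Const 1)"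

definition coloring_program :: "nat \<Rightarrow> com" where
  "coloring_program N = init N ;; If (Read INPUT (Const 2)) (insert_edge N) (delete_edge N)"

context coloring_ram
begin

lemma runs_init_loop:
  assumes "M INPUT 0 = n" "M LEAVES 0 = 1"
  shows "runs W init_loop (14 * H + 8) M
    (\<lambda>M'. M' LEAVES 0 = 2 ^ H \<and> unchanged {LEAVES} M M')"
proof -
  let ?b = "Var LEAVES \<prec> Const 2 \<otimes> Var INPUT"
  let ?I = "\<lambda>h M'. h \<le> H \<and> M' LEAVES 0 = 2 ^ (H - h) \<and> unchanged {LEAVES} M M'"
  have words: "2 * n < W" using H_ge word_small(3) by linarith
  have "runs W init_loop (H * (6 + 1 + expr_cost ?b) + (1 + expr_cost ?b)) M (?I 0)"
    unfolding init_loop_def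
  proof (rule runs_While_countdown[where I = ?I])
    show "?I H M" using assms by simp
    fix h M' assume I: "?I (Suc h) M'"
    have double: "(2::nat) ^ (H - h) = 2 * 2 ^ (H - Suc h)"
      using I by (metis Suc_diff_le Suc_le_eq diff_Suc_Suc less_or_eq_imp_le power_Suc)
    have le: "(2::nat) ^ (H - h) \<le> 2 ^ H" by (rule power_increasing) auto
    have "2 ^ (H - Suc h) < 2 * n" using le double H_le by linarith
    moreover have "2 ^ (H - Suc h) < W" "2 * 2 ^ (H - Suc h) < W" using le double word_small(3) by linarith+
    ultimately show "(\<exists>x. eval W M' ?b = Some x \<and> x \<noteq> 0) \<and>
        runs W (LEAVES ::= Const 2 \<otimes> Var LEAVES) 6 M' (?I h)"
      using I assms(1) words double by (simp add: runs_simps)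
  qed (use assms(1) words H_ge in auto)
  then show ?thesis by (rule runs_conseq) simp_all
qed

lemma runs_init:
  assumes r: "represents S l M"
  shows "runs W (init N) (20 * (H + 2)) M (\<lambda>M'. ready S l M' \<and> unchanged {LEAVES, STRIDE} M M')"
    (is "runs W _ _ M ?Q")
proof -
  let ?M = "M(LEAVES := (M LEAVES)(0 := 1))"
  have "M INPUT 0 = n" using r by (simp add: represents_def)
  then have loop: "runs W init_loop (14 * H + 8) ?M
      (\<lambda>M'. M' LEAVES 0 = 2 ^ H \<and> unchanged {LEAVES} ?M M')"
    by (intro runs_init_loop) simp_all
  have "runs W (init_loop ;;
      STRIDE ::= Const (4 * N) \<otimes> Var LEAVES) (20 * (H + 2) - 3) ?M ?Q"
  proof (rule runs_SeqI[OF loop])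
    fix M1 assume M1: "M1 LEAVES 0 = 2 ^ H \<and> unchanged {LEAVES} ?M M1"
    have "represents S l (M1(STRIDE := (M1 STRIDE)(0 := B)))"
      by (rule represents_cong[THEN iffD2, OF _ r]) (use M1 in auto)
    moreover have "4 * N < W" using B_bounds(2) B_less_W by linarith
    moreover have "4 * N * 2 ^ H = B" by (simp add: B_def)
    ultimately show "runs W (STRIDE ::= Const (4 * N) \<otimes> Var LEAVES) 7 M1 ?Q"
      using M1 by (simp add: runs_simps ready_def)
  qed simp
  then show ?thesis unfolding init_def by (simp add: runs_simps)
qed

definition K :: nat where "K = (4 * N + 5) * \<alpha> div N"

definition overfull :: "nat set set \<Rightarrow> (nat \<Rightarrow> nat) \<Rightarrow> nat \<Rightarrow> bool" where
  "overfull E l v \<longleftrightarrow> (4 * N + 5) * \<alpha> < N * deg_above E l v (l v)"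

definition underfull :: "nat set set \<Rightarrow> (nat \<Rightarrow> nat) \<Rightarrow> nat \<Rightarrow> bool" where
  "underfull E l v \<longleftrightarrow> 0 < l v \<and> N * deg_above E l v (l v - 1) < (2 * N + 1) * \<alpha>"

abbreviation pot :: "nat set set \<Rightarrow> (nat \<Rightarrow> nat) \<Rightarrow> nat" where
  "pot \<equiv> potential n \<alpha> N L"

lemma not_overfull: "\<not> overfull E l v \<Longrightarrow> deg_above E l v (l v) \<le> K"
  using N_ge by (simp add: overfull_def K_def less_eq_div_iff_mult_less_eq mult.commute)

lemma not_underfull_level_less:
  assumes "graph_on n E" "arboricity {..<n} E \<le> \<alpha>" "\<And>v. v < n \<Longrightarrow> \<not> underfull E l v" "v < n"
  shows "l v < L"
  unfolding L_def
proof (rule level_bound[OF assms(1,2) \<alpha>_ge N_ge _ _ assms(4)])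
  show "n < 2 ^ H" using H_ge n_ge by linarith
  show "(2 * N + 1) * \<alpha> \<le> N * deg_above E l v (l v - 1)" if "v < n" "0 < l v" for v
    using assms(3)[OF that(1)] that(2) by (auto simp: underfull_def)
qed

lemma overfull_mono:
  assumes "overfull E l v" "deg_above E l v (l v) \<le> deg_above E' l' v (l' v)"
  shows "overfull E' l' v"
  unfolding overfull_def
  by (rule less_le_trans[OF _ mult_left_mono[OF assms(2)]]) (use assms(1) in \<open>simp_all add: overfull_def\<close>)

lemma underfull_antimono:
  assumes "underfull E l v" "l' v = l v" "deg_above E' l' v (l v - 1) \<le> deg_above E l v (l v - 1)"
  shows "underfull E' l' v"
  using assms(1,2) le_less_trans[OF mult_left_mono[OF assms(3)]] by (auto simp: underfull_def)

lemma overfull_insert: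
  assumes "graph_on n (insert e E)" "overfull (insert e E) l w" "w \<notin> e"
  shows "overfull E l w"
  by (rule overfull_mono[OF assms(2)]) (use deg_above_insert_edge(2)[OF assms(1), of l w "l w"] assms(3) in simp)

lemma underfull_insert:
  assumes "graph_on n (insert e E)" "underfull (insert e E) l w"
  shows "underfull E l w"
  by (rule underfull_antimono[OF assms(2) refl deg_above_insert_edge(1)[OF assms(1)]])

lemma overfull_delete:
  assumes "graph_on n (insert e E)" "overfull E l w"
  shows "overfull (insert e E) l w"
  by (rule overfull_mono[OF assms(2) deg_above_insert_edge(1)[OF assms(1)]])

lemma underfull_delete:
  assumes "graph_on n (insert e E)" "underfull E l w" "w \<notin> e"
  shows "underfull (insert e E) l w"
  by (rule underfull_antimono[of E l w l, OF assms(2) refl])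
    (use deg_above_insert_edge(2)[OF assms(1), of l w "l w - 1"] assms(3) in simp)

lemma underfull_raise:
  assumes g: "graph_on n E" and v: "overfull E l v" and w: "underfull E (l(v := Suc (l v))) w"
  shows "underfull E l w"
proof (cases "w = v")
  case True
  have "(2 * N + 1) * \<alpha> \<le> (4 * N + 5) * \<alpha>" by (rule mult_right_mono) auto
  then have "(2 * N + 1) * \<alpha> \<le> N * deg_above E l v (l v)" using v unfolding overfull_def by linarith
  then show ?thesis
    using w True not_in_neighbors[OF g] by (simp add: underfull_def deg_above_raise[OF g])
next
  case False
  then show ?thesis
    using underfull_antimono[OF w, of l E] deg_above_raise[OF g, of l v w "l w - 1"] by simp
qed

lemma overfull_raise:
  assumes g: "graph_on n E" and w: "w \<noteq> v" "overfull E (l(v := Suc (l v))) w"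
  shows "overfull E l w \<or> w \<in> neighbors E v \<and> l v \<le> l w \<and> min (Suc (l v)) (l w) \<noteq> l v"
proof (cases "v \<in> neighbors E w \<and> l w = Suc (l v)")
  case True
  then show ?thesis by (simp add: neighbors_sym[of w])
next
  case False
  then have "deg_above E (l(v := Suc (l v))) w (l w) = deg_above E l w (l w)"
    unfolding deg_above_raise[OF g] if_not_P[OF False] by simp
  then show ?thesis using overfull_mono[OF w(2), of E l] w(1) by simp
qed

lemma overfull_lower:
  assumes g: "graph_on n E" and v: "underfull E l v" and w: "overfull E (l(v := l v - 1)) w"
  shows "overfull E l w"
proof -
  have pos: "0 < l v" using v by (simp add: underfull_def)
  note lower = deg_above_lower[where l = l and v = v, OF g pos]
  show ?thesis
  proof (cases "w = v")
    case True
    have "N * deg_above E l v (l v - 1) < (2 * N + 1) * \<alpha>" using v by (simp add: underfull_def)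
    also have "\<dots> \<le> (4 * N + 5) * \<alpha>" by (rule mult_right_mono) auto
    finally show ?thesis
      using w True lower[of v "l v - 1"] not_in_neighbors[OF g] by (simp add: overfull_def)
  next
    case False
    then show ?thesis using overfull_mono[OF w, of E l] lower[of w "l w"] by simp
  qed
qed

lemma underfull_lower:
  assumes g: "graph_on n E" and v: "underfull E l v" and w: "w \<noteq> v" "underfull E (l(v := l v - 1)) w"
  shows "underfull E l w \<or> w \<in> neighbors E v \<and> l v \<le> l w \<and> min (l v - 1) (l w) \<noteq> l v"
proof (cases "v \<in> neighbors E w \<and> l w - 1 = l v")
  case True
  then show ?thesis using v by (auto simp: neighbors_sym[of w] underfull_def)
next
  case False
  have "0 < l v" using v by (simp add: underfull_def)
  from deg_above_lower[where l = l and v = v, OF g this, of w "l w - 1"]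
  have "deg_above E l w (l w - 1) = deg_above E (l(v := l v - 1)) w (l w - 1)"
    unfolding if_not_P[OF False] by simp
  then show ?thesis using underfull_antimono[OF w(2), of l E] w(1) by simp
qed

lemma pot_word:
  assumes "graph_on n E" "\<And>v. v < n \<Longrightarrow> l v \<le> L"
  shows "2 * pot E l + N * 2 < W"
proof -
  let ?X = "N * (n * n * (4 * L + 2))" and ?Y = "n * (L * ((2 * N + 1) ^ 2 * \<alpha>))" and ?Z = "\<alpha> * (B * B * B)"
  have "64 * ?X = 8 * (n * N) * (8 * n) * (4 * L + 2)" by (simp add: algebra_simps)
  also have "\<dots> \<le> B * B * (3 * B)" by (intro mult_mono) (use B_bounds in auto)
  also have "\<dots> \<le> 3 * ?Z" using \<alpha>_ge by simp
  finally have X: "64 * ?X \<le> 3 * ?Z" .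
  have "(2 * N + 1) ^ 2 \<le> (3 * N) ^ 2" using N_ge by (intro power_mono) auto
  then have "256 * ?Y \<le> 256 * (n * (L * ((3 * N) ^ 2 * \<alpha>)))" by (intro mult_left_mono mult_right_mono) auto
  also have "\<dots> = 9 * (\<alpha> * (8 * (n * N) * (2 * L) * (16 * N)))" by (simp add: power2_eq_square algebra_simps)
  also have "\<dots> \<le> 9 * (\<alpha> * (B * B * B))" by (intro mult_left_mono mult_mono) (use B_bounds in auto)
  finally have Y: "256 * ?Y \<le> 9 * ?Z" .
  have "pot E l \<le> ?X + 5 * ?Y" by (rule potential_le[OF assms])
  moreover have "16 * (16 * N) \<le> ?Z"
  proof -
    have "1 * (16 * 1 * (16 * N)) \<le> \<alpha> * (B * B * B)" by (intro mult_mono) (use B_bounds \<alpha>_ge in auto)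
    then show ?thesis by simp
  qed
  moreover have "0 < ?Z" using \<alpha>_ge B_bounds(6) by simp
  ultimately have "2 * pot E l + N * 2 < ?Z" using X Y by linarith
  then show ?thesis using B_cube(2) by linarith
qed

lemma threshold_words: "4 * N + 5 < W" "(4 * N + 5) * \<alpha> < W" "2 * N + 1 < W" "(2 * N + 1) * \<alpha> < W" "N < W" "\<alpha> < W"
proof -
  have "(4 * N + 5) * \<alpha> \<le> B * \<alpha>" using B_bounds(2) N_ge by (intro mult_right_mono) auto
  also have "\<dots> = B * \<alpha> * (1 * 1)" by simp
  also have "\<dots> < B * \<alpha> * (B * B)"
    by (intro mult_strict_left_mono mult_strict_mono) (use B_bounds(6) \<alpha>_ge in auto)
  finally show raise: "(4 * N + 5) * \<alpha> < W" using B_cube(2) by (simp add: algebra_simps)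
  have "(4 * N + 5) * 1 \<le> (4 * N + 5) * \<alpha>" using \<alpha>_ge by (rule mult_left_mono) simp
  then show "4 * N + 5 < W" using le_less_trans[OF _ raise] by simp
  then show "2 * N + 1 < W" "N < W" by linarith+
  have "1 * \<alpha> \<le> (4 * N + 5) * \<alpha>" by (rule mult_right_mono) auto
  then show "\<alpha> < W" using le_less_trans[OF _ raise] by simp
  have "(2 * N + 1) * \<alpha> \<le> (4 * N + 5) * \<alpha>" by (rule mult_right_mono) auto
  then show "(2 * N + 1) * \<alpha> < W" using le_less_trans[OF _ raise] by blast
qed

lemma N_times_word: "x < 2 * n \<Longrightarrow> N * x < W"
proof -
  assume "x < 2 * n"
  then have "N * x \<le> B * B" using B_bounds(2,5) by (intro mult_mono) auto
  then show ?thesis using B_square by linarith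
qed

lemma eval_raise_cond:
  assumes r: "ready S l M" and c: "consistent S l" and M: "M NODE 0 = v" "v < n"
  shows "eval W M (raise_cond N) = Some (if overfull (dom S) l v then 1 else 0)"
proof -
  note level = ready_level[OF r M(2)] and S = ready_valid_state[OF r]
  have count: "M COUNT (tree_base v (l v) + 1) = deg_above (dom S) l v (l v)"
    using ready_tree_root[OF r M(2) level(3)] card_colors_level[OF S c level(2)] by simp
  have "deg_above (dom S) l v (l v) < n" using S M(2) by (simp add: valid_state_def deg_above_less)
  then have words: "N * deg_above (dom S) l v (l v) < W" "deg_above (dom S) l v (l v) < W"
    using N_times_word[of "deg_above (dom S) l v (l v)"] word_small(1) by linarith+
  have "tree_base v (l v) + 1 < W" using M(2) level(3) B_bounds(6) by simp
  then show ?thesis unfolding raise_cond_def overfull_def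
    using threshold_words words level count M ready_scalars[OF r] by simp
qed

lemma eval_lower_cond:
  assumes r: "ready S l M" and c: "consistent S l" and M: "M NODE 0 = v" "v < n"
  shows "eval W M (lower_cond N) = Some (if underfull (dom S) l v then 1 else 0)"
proof -
  note level = ready_level[OF r M(2)] and S = ready_valid_state[OF r]
  let ?a = "card (colors S v (l v))" and ?b = "card (colors S v (l v - 1))"
  have pred: "l v - 1 < B" "l v - 1 < W" using level(3,4) by auto
  have count: "M COUNT (tree_base v (l v) + 1) = ?a" "M COUNT (tree_base v (l v - 1) + 1) = ?b"
    using ready_tree_root[OF r M(2)] level(3) pred(1) by auto
  have "?a < n" "?b < n" using card_colors_less[OF S M(2)] by auto
  then have words: "N * (?a + ?b) < W" "?a < W" "?b < W" "?a + ?b < W"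
    using N_times_word[of "?a + ?b"] H_ge word_small(1,3) by linarith+
  have index: "tree_base v (l v) + 1 < W" "tree_base v (l v - 1) + 1 < W"
    using M(2) level(3) pred(1) B_bounds(6) by simp_all
  have "eval W M (lower_cond N) = Some ((if 0 < l v then 1 else 0) *
      (if N * (?a + ?b) < (2 * N + 1) * \<alpha> then 1 else 0))"
    unfolding lower_cond_def using threshold_words words index level pred count M ready_scalars[OF r] by simp
  moreover have "underfull (dom S) l v \<longleftrightarrow> 0 < l v \<and> N * (?a + ?b) < (2 * N + 1) * \<alpha>"
    using card_colors_below[OF S c level(2)] by (auto simp: underfull_def)
  ultimately show ?thesis by simp
qed

lemma level_rule_raise:
  assumes g: "graph_on n E" and ab: "arboricity {..<n} E \<le> \<alpha>"
  shows "level_rule n \<alpha> N H W (raise_cond N) (Var OLD \<oplus> Const 1) E Suc (overfull E)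
    (\<lambda>l. \<forall>v<n. \<not> underfull E l v) (pot E)"
proof unfold_locales
  have level: "l v < L" if "\<forall>v<n. \<not> underfull E l v" "v < n" for l v
    using not_underfull_level_less[OF g ab] that by blast
  show step: "\<forall>w<n. \<not> underfull E (l(v := Suc (l v))) w"
    if "\<forall>v<n. \<not> underfull E l v" "v < n" "overfull E l v" for l v
    using underfull_raise[OF g that(3)] that(1) by blast
  show "Suc (l v) < full" if a: "\<forall>v<n. \<not> underfull E l v" "v < n" "overfull E l v" for l v
    using level[OF step[OF a] a(2)] full_bounds(4) by simp
  show "pot E (l(v := Suc (l v))) + N * (deg_above E l v (l v) + 1) \<le> pot E l"
    if "\<forall>v<n. \<not> underfull E l v" "v < n" "overfull E l v" for l v
    using that(3)
    by (intro potential_raise[where l = l and v = v, OF g level[OF that(1,2)] N_ge]) (simp add: overfull_def)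
  show "overfull E l w \<or> w \<in> neighbors E v \<and> l v \<le> l w \<and> min (Suc (l v)) (l w) \<noteq> l v"
    if "w \<noteq> v" "overfull E (l(v := Suc (l v))) w" for l v w
    by (rule overfull_raise[OF g that])
  show "eval W M (Var OLD \<oplus> Const 1) = Some (Suc i)" if "M OLD 0 = i" "i < full" for M i
  proof -
    have "i < W" "i + 1 < W" using that(2) full_bounds(1,3) B_less_W by linarith+
    then show ?thesis using that(1) by simp
  qed
  show "\<exists>x. eval W M (raise_cond N) = Some x \<and> (x \<noteq> 0 \<longleftrightarrow> overfull E l v)"
    if "ready S l M" "consistent S l" "dom S = E" "M NODE 0 = v" "v < n" for S l M v
    using eval_raise_cond[OF that(1,2,4,5)] that(3) by simp
qed (simp_all add: raise_cond_def)

lemma level_rule_lower: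
  assumes g: "graph_on n E"
  shows "level_rule n \<alpha> N H W (lower_cond N) (Var OLD \<ominus> Const 1) E (\<lambda>i. i - 1) (underfull E)
    (\<lambda>l. \<forall>v<n. \<not> overfull E l v \<and> l v \<le> L) (pot E)"
proof unfold_locales
  let ?Inv = "\<lambda>l. \<forall>v<n. \<not> overfull E l v \<and> l v \<le> L"
  show "?Inv (l(v := l v - 1))" if "?Inv l" "v < n" "underfull E l v" for l v
    using overfull_lower[OF g that(3)] that(1) by (auto intro: le_trans[OF diff_le_self])
  show "l v - 1 < full" if "?Inv l" "v < n" "underfull E l v" for l v
  proof -
    have "l v \<le> L" using that(1,2) by blast
    then show ?thesis using full_bounds(4) by linarith
  qed
  show "x \<le> l v - 1" if "x < l v" for x v :: nat and l :: "nat \<Rightarrow> nat" using that by simp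
  show "pot E (l(v := l v - 1)) + N * (deg_above E l v (l v) + 1) \<le> pot E l"
    if "?Inv l" "v < n" "underfull E l v" for l v
    by (rule potential_lower[where l = l and v = v, OF g that(2) _ _ N_ge])
      (use that in \<open>simp_all add: underfull_def\<close>)
  show "underfull E l w \<or> w \<in> neighbors E v \<and> l v \<le> l w \<and> min (l v - 1) (l w) \<noteq> l v"
    if "underfull E l v" "w \<noteq> v" "underfull E (l(v := l v - 1)) w" for l v w
    by (rule underfull_lower[OF g that])
  show "eval W M (Var OLD \<ominus> Const 1) = Some (i - 1)" if "M OLD 0 = i" "i < full" for M i
  proof -
    have "i < W" "i - 1 < W" using that(2) full_bounds(1) B_less_W by linarith+
    then show ?thesis using that(1) by simp
  qed
  show "\<exists>x. eval W M (lower_cond N) = Some x \<and> (x \<noteq> 0 \<longleftrightarrow> underfull E l v)"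
    if "ready S l M" "consistent S l" "dom S = E" "M NODE 0 = v" "v < n" for S l M v
    using eval_lower_cond[OF that(1,2,4,5)] that(3) by simp
qed (simp_all add: lower_cond_def)

lemma runs_push_endpoints:
  assumes "M INPUT 3 = u" "M INPUT 4 = v" "u < n" "v < n"
  shows "runs W push_endpoints 30 M (\<lambda>M'. unchanged {STACK, TOP} M M' \<and> stack M' = {u, v} \<and> M' TOP 0 = 2)"
proof -
  let ?M = "M(TOP := (M TOP)(0 := 0))"
  have empty: "stack ?M = {}" by (simp add: stack_def)
  have "runs W (push (Read INPUT (Const 3)) ;; push (Read INPUT (Const 4))) 27 ?M
      (\<lambda>M'. unchanged {STACK, TOP} M M' \<and> stack M' = {u, v} \<and> M' TOP 0 = 2)"
  proof (rule runs_SeqI[OF runs_push[where w = u]])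
    fix M1 assume M1: "unchanged {STACK, TOP} ?M M1 \<and> stack M1 = insert u (stack ?M) \<and> M1 TOP 0 = ?M TOP 0 + 1"
    show "runs W (push (Read INPUT (Const 4))) 12 M1
        (\<lambda>M'. unchanged {STACK, TOP} M M' \<and> stack M' = {u, v} \<and> M' TOP 0 = 2)"
      by (rule runs_conseq[OF runs_push[where w = v]]) (use M1 empty assms in \<open>simp_all add: insert_commute\<close>)
  qed (use assms in simp_all)
  then show ?thesis unfolding push_endpoints_def by (simp add: runs_simps)
qed

lemma runs_orient:
  assumes r: "ready S l M" and M: "M INPUT 3 = u" "M INPUT 4 = v" and uv: "u < n" "v < n"
  shows "runs W orient 30 M (\<lambda>M'. unchanged {TAIL, HEAD} M M' \<and>
    {M' TAIL 0, M' HEAD 0} = {u, v} \<and> l (M' TAIL 0) \<le> l (M' HEAD 0))"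
proof -
  show ?thesis unfolding orient_def
    using M uv ready_level[OF r uv(1)] ready_level[OF r uv(2)]
    by (cases "l v < l u") (auto simp: runs_simps)
qed

lemma coloring_pending_start:
  assumes r: "ready S l M" and c: "consistent S l" and E: "dom S = E" "{x, y} \<notin> E" "x < n"
    and M: "M TAIL 0 = x" "M HEAD 0 = y" "M ACTIVE 0 = 1" and le: "l x \<le> l y"
    and few: "colors_below (D + K) S" and full: "\<not> overfull E l x"
  shows "coloring_pending (insert {x, y} E) D K l S (l x + 1) (l x + 1) M"
proof -
  have "card (colors S x (l x)) \<le> K"
    using card_colors_level[OF ready_valid_state[OF r] c ready_level(2)[OF r E(3)]] not_overfull[OF full] E(1)
    by simp
  then have "partial_coloring (insert {x, y} E) D K l S x y S {{x, y}}"
    using c few E le unfolding partial_coloring_def color_changes_def by auto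
  then show ?thesis unfolding coloring_pending_def using r M
    by (intro conjI exI[of _ S] exI[of _ "{{x, y}}"] exI[of _ x] exI[of _ y]) simp_all
qed

lemma runs_color_edge:
  assumes r: "ready S l M" and c: "consistent S l" and few: "colors_below (D + K) S"
    and M: "M INPUT 3 = u" "M INPUT 4 = v" and uv: "{u, v} \<notin> dom S"
  defines "E \<equiv> insert {u, v} (dom S)"
  assumes g: "graph_on n E" and D: "\<And>w. w < n \<Longrightarrow> card (neighbors E w) \<le> D"
    and full: "\<And>w. w < n \<Longrightarrow> \<not> overfull (dom S) l w" and lL: "\<And>w. w < n \<Longrightarrow> l w < L"
  shows "runs W color_edge (L * (600 * (H + 2) + 3) + 40) M
    (\<lambda>M'. unchanged color_vars M M' \<and> recolored (D + K) (L + 1) E S l M')"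
    (is "runs W _ _ M ?Q")
proof -
  have uv_n: "u < n" "v < n"
    using graph_on_neighbors[OF g, of u v] by (auto simp: E_def neighbors_def insert_commute)
  show ?thesis unfolding color_edge_def
  proof (rule runs_SeqI[OF runs_orient[OF r M uv_n]], elim conjE)
    fix M1 assume M1: "unchanged {TAIL, HEAD} M M1" "{M1 TAIL 0, M1 HEAD 0} = {u, v}"
      "l (M1 TAIL 0) \<le> l (M1 HEAD 0)"
    define x y where "x = M1 TAIL 0" and "y = M1 HEAD 0"
    let ?M = "M1(ACTIVE := (M1 ACTIVE)(0 := 1))"
    have xy: "{x, y} = {u, v}" "l x \<le> l y" using M1 by (auto simp: x_def y_def)
    then have "x \<in> {u, v}" by blast
    then have x: "x < n" using uv_n by blast
    have "ready S l ?M" using ready_unchanged[OF r M1(1)] by simp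
    then have pending: "coloring_pending E D K l S (l x + 1) (l x + 1) ?M"
      unfolding E_def xy(1)[symmetric] using c few uv xy full[OF x] x
      by (intro coloring_pending_start) (simp_all add: x_def y_def)
    have deg: "deg_above E l w (l w) \<le> K" if w: "w < n" "l w + 1 < l x + 1" for w
    proof -
      have "w \<notin> {x, y}" using w(2) xy(2) by auto
      then have "\<not> overfull E l w"
        using overfull_insert[of "{u, v}" "dom S" l w] g full[OF w(1)] xy(1) unfolding E_def by auto
      then show ?thesis by (rule not_overfull)
    qed
    have "(l x + 1) * (600 * (H + 2) + 3) + 3 \<le> L * (600 * (H + 2) + 3) + 3"
      using lL[OF x] by (intro add_right_mono mult_right_mono) auto
    moreover have "?Q M'" if "unchanged color_vars ?M M' \<and> coloring_done E (D + K) l S (l x + 1) M'" for M'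
      using that M1(1) lL[OF x] unfolding coloring_done_def recolored_def by (auto intro: order_trans)
    ultimately have "runs W color_loop (L * (600 * (H + 2) + 3) + 3) ?M ?Q"
      by (intro runs_conseq[OF runs_color_loop[OF g D deg pending]])
    then show "runs W (ACTIVE ::= Const 1 ;; color_loop) (L * (600 * (H + 2) + 3) + 10) M1 ?Q"
      by (simp add: runs_simps) (auto elim: runs_conseq)
  qed simp
qed

lemma runs_uncolor_edge:
  assumes r: "ready S l M" and c: "consistent S l" and few: "colors_below (D + K) S"
    and M: "M INPUT 3 = u" "M INPUT 4 = v" and uv: "{u, v} \<in> dom S"
  shows "runs W uncolor_edge (L * (600 * (H + 2) + 3) + 40) M
    (\<lambda>M'. unchanged color_vars M M' \<and> recolored (D + K) (L + 1) (dom S - {{u, v}}) S l M')"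
    (is "runs W _ _ M ?Q")
proof -
  let ?S = "S({u, v} := None)" and ?M = "M(TAIL := (M TAIL)(0 := u), HEAD := (M HEAD)(0 := v))"
  obtain k j where e: "S {u, v} = Some (k, j)" using uv by auto
  have uv_n: "u < n" "v < n" using valid_stateD(1,2)[OF ready_valid_state[OF r] e] .
  have "color_changes S ?S \<subseteq> {{u, v}}" by (auto simp: color_changes_def)
  then have "card (color_changes S ?S) \<le> card {{u, v}}" by (intro card_mono) simp_all
  then have changes: "card (color_changes S ?S) \<le> L + 1" by simp
  have "200 * (H + 2) \<le> 1 * (600 * (H + 2) + 3)" by simp
  also have "\<dots> \<le> L * (600 * (H + 2) + 3)" using L_ge N_ge by (intro mult_right_mono) auto
  finally have time: "200 * (H + 2) \<le> L * (600 * (H + 2) + 3)" .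
  have "runs W remove_edge (200 * (H + 2)) ?M (\<lambda>M'. unchanged {COUNT, TREE, KEY, POS, SLOT} ?M M' \<and>
      ready ?S l M' \<and> M' KEY 0 = k \<and> M' SLOT 0 = j)"
    by (rule runs_remove_edge) (use r e in simp_all)
  then have "runs W remove_edge (L * (600 * (H + 2) + 3)) ?M ?Q"
  proof (rule runs_conseq[OF _ time])
    fix M' assume M': "unchanged {COUNT, TREE, KEY, POS, SLOT} ?M M' \<and> ready ?S l M' \<and> M' KEY 0 = k \<and> M' SLOT 0 = j"
    then have "unchanged color_vars M M'" by simp
    moreover have "dom ?S = dom S - {{u, v}}" by simp
    ultimately show "?Q M'"
      using M' changes consistent_delete[OF c, of "{u, v}"] colors_below_delete[OF few, of "{u, v}"]
      unfolding recolored_def by blast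
  qed
  then show ?thesis unfolding uncolor_edge_def using M uv_n by (simp add: runs_simps) (auto elim: runs_conseq)
qed

end

context level_rule
begin

lemma runs_repair:
  assumes r: "ready S l M" "consistent S l" "dom S = E" and inv: "Inv l"
    and M: "M INPUT 3 = u" "M INPUT 4 = v" "u < n" "v < n"
    and viol: "{w. w < n \<and> viol l w} \<subseteq> {u, v}" and word: "2 * \<Phi> l + N * 2 < W"
  shows "\<exists>T. runs W (push_endpoints ;; fix_loop b e) (30 + T) M (\<lambda>M'. \<exists>l'. repaired S l' M' \<and>
    N * T + C * (2 * \<Phi> l') \<le> C * (2 * \<Phi> l + N * 2) + N * 3)"
proof (rule runs_SeqI_ex[OF runs_push_endpoints[where M = M and u = u and v = v, OF M], where ?T2.0 = 0],
    elim conjE)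
  fix M1 assume M1: "unchanged {STACK, TOP} M M1" "stack M1 = {u, v}" "M1 TOP 0 = 2"
  have "ready S l M1" by (rule ready_unchanged[OF r(1) M1(1)]) auto
  then have "fixing S S l M1"
    using r(2,3) inv M(3,4) M1(2,3) viol word by (auto simp: fixing_def color_changes_def)
  then show "\<exists>T. runs W (fix_loop b e) (0 + T) M1 (\<lambda>M'. \<exists>l'. repaired S l' M' \<and>
      N * T + C * (2 * \<Phi> l') \<le> C * (2 * \<Phi> l + N * 2) + N * 3)"
    using runs_fix_loop[of S S l M1] unfolding M1(3) by simp
qed simp

lemma runs_phases:
  assumes color: "runs W c (L * (600 * (H + 2) + 3) + 40) M
      (\<lambda>M'. unchanged color_vars M M' \<and> recolored m (L + 1) E S l M')"
    and inv: "Inv l" and M: "M INPUT 3 = u" "M INPUT 4 = v" "u < n" "v < n"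
    and viol: "{w. w < n \<and> viol l w} \<subseteq> {u, v}" and word: "2 * \<Phi> l + N * 2 < W"
  shows "\<exists>T. runs W (c ;; push_endpoints ;; fix_loop b e) (C * L + 70 + T) M (\<lambda>M'. \<exists>l'.
    recolored m (L + 1) E S l' M' \<and> Inv l' \<and> (\<forall>v<n. \<not> viol l' v) \<and> N * T + C * (2 * \<Phi> l') \<le> C * (2 * \<Phi> l + N * 2) + N * 3)"
    (is "\<exists>T. runs W _ _ M (?Q T)")
proof -
  have "L * (600 * (H + 2) + 3) \<le> L * C" by (rule mult_left_mono) (simp_all add: C_def)
  then have "L * (600 * (H + 2) + 3) + 40 + 30 \<le> C * L + 70" by (simp add: mult.commute)
  then show ?thesis
  proof (rule runs_SeqI_ex[OF color, rotated], elim conjE)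
    fix M1 assume M1: "unchanged color_vars M M1" and "recolored m (L + 1) E S l M1"
    then obtain S1 where S1: "ready S1 l M1" "consistent S1 l" "dom S1 = E" "colors_below m S1"
      "card (color_changes S S1) \<le> L + 1" unfolding recolored_def by blast
    have "M1 INPUT 3 = u" "M1 INPUT 4 = v" using M1 M by simp_all
    from runs_repair[OF S1(1-3) inv this M(3,4) viol word]
    obtain T where T: "runs W (push_endpoints ;; fix_loop b e) (30 + T) M1 (\<lambda>M'. \<exists>l'. repaired S1 l' M' \<and>
        N * T + C * (2 * \<Phi> l') \<le> C * (2 * \<Phi> l + N * 2) + N * 3)" by (rule exE)
    have "recolored m (L + 1) E S l' M'" if "repaired S1 l' M'" for l' M'
      using that colors_below_same[OF _ S1(4)] color_changes_same_colors[of S1 _ S] S1(5)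
      unfolding recolored_def repaired_def by metis
    then show "\<exists>T. runs W (push_endpoints ;; fix_loop b e) (30 + T) M1 (?Q T)"
      by (intro exI[of _ T] runs_conseq[OF T order.refl]) (auto simp: repaired_def)
  qed
qed

end

context coloring_ram
begin

lemma represents_input: "represents S l (input_update x M) \<longleftrightarrow> represents S l M"
  by (cases x) (simp_all add: represents_def tables_at_def trees_at_def tree_at_def)

lemma runs_program:
  assumes r: "represents S l M" and k: "M INPUT 2 = k" "k < W"
    and c: "c = (if k = 0 then delete_edge N else insert_edge N)"
    and branch: "\<And>M'. ready S l M' \<Longrightarrow> M' INPUT = M INPUT \<Longrightarrow> \<exists>T. runs W c (C * L + 70 + T) M' (Q T)"
  shows "\<exists>T. runs W (coloring_program N) (C * (L + 1) + T) M (Q T)"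
  unfolding coloring_program_def
proof (rule runs_SeqI_ex[OF runs_init[OF r], where ?T2.0 = "C * L + 73"], elim conjE)
  fix M1 assume M1: "ready S l M1" "unchanged {LEAVES, STRIDE} M M1"
  from branch[OF M1(1)] M1(2) obtain T where T: "runs W c (C * L + 70 + T) M1 (Q T)" by auto
  show "\<exists>T. runs W (If (Read INPUT (Const 2)) (insert_edge N) (delete_edge N)) (C * L + 73 + T) M1 (Q T)"
  proof (rule exI)
    show "runs W (If (Read INPUT (Const 2)) (insert_edge N) (delete_edge N)) (C * L + 73 + T) M1 (Q T)"
      using T k M1(2) unfolding c by (simp add: runs_If ac_simps cong del: runs_weak_cong)
  qed
qed (simp add: C_def algebra_simps)

definition invariant :: "nat \<Rightarrow> nat set set \<Rightarrow> state \<Rightarrow> (nat \<Rightarrow> nat) \<Rightarrow> memory \<Rightarrow> bool" where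
  "invariant D E S l M \<longleftrightarrow> represents S l M \<and> dom S = E \<and> consistent S l \<and> colors_below (D + K) S \<and>
     (\<forall>v<n. \<not> overfull E l v \<and> \<not> underfull E l v)"

text \<open>Twice the potential, weighted by \<open>C\<close>, pays for the moves of the nodes.\<close>

definition updated ::
  "nat \<Rightarrow> nat set set \<Rightarrow> nat set set \<Rightarrow> state \<Rightarrow> (nat \<Rightarrow> nat) \<Rightarrow> nat \<Rightarrow> memory \<Rightarrow> bool" where
  "updated D E E' S l T M' \<longleftrightarrow> (\<exists>S' l'. invariant D E' S' l' M' \<and> card (color_changes S S') \<le> L + 1 \<and>
     N * T + 2 * C * pot E' l' \<le> 2 * C * pot E l + N * (C * (50 * N * L)))"

lemma amortized_bound:
  assumes p: "p1 \<le> p0 + N * (10 * N * L + 2)" and f: "N * T + C * (2 * p2) \<le> C * (2 * p1 + N * 2) + N * 3"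
  shows "N * (C * (L + 1) + T) + 2 * C * p2 \<le> 2 * C * p0 + N * (C * (50 * N * L))"
proof -
  have L: "4 \<le> L" "L \<le> N * L" using L_ge N_ge by auto
  have "C * (2 * p1 + N * 2) \<le> C * (2 * (p0 + N * (10 * N * L + 2)) + N * 2)"
    using p by (intro mult_left_mono) auto
  moreover have "N * 3 \<le> N * (C * 1)" by (rule mult_left_mono) (auto simp: C_def)
  moreover have "N * (C * (L + 1) + T) + 2 * C * p2 = N * (C * (L + 1)) + (N * T + C * (2 * p2))"
    by (simp add: algebra_simps)
  ultimately have "N * (C * (L + 1) + T) + 2 * C * p2 \<le>
      N * (C * (L + 1)) + C * (2 * (p0 + N * (10 * N * L + 2)) + N * 2) + N * (C * 1)"
    using f by linarith
  also have "\<dots> = 2 * C * p0 + N * (C * (L + 20 * (N * L) + 8))" by (simp add: algebra_simps)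
  also have "\<dots> \<le> 2 * C * p0 + N * (C * (50 * (N * L)))"
    using L by (intro add_left_mono mult_left_mono) linarith+
  finally show ?thesis by (simp add: mult.assoc)
qed

lemma runs_program_updated:
  assumes r: "represents S l M" and k: "M INPUT 2 = k" "k < W"
    and c: "c = (if k = 0 then delete_edge N else insert_edge N)"
    and pot: "pot E' l \<le> pot E l + N * (10 * N * L + 2)"
    and branch: "\<And>M'. ready S l M' \<Longrightarrow> M' INPUT = M INPUT \<Longrightarrow> \<exists>T. runs W c (C * L + 70 + T) M'
      (\<lambda>M'. \<exists>l'. recolored (D + K) (L + 1) E' S l' M' \<and> (\<forall>v<n. \<not> overfull E' l' v \<and> \<not> underfull E' l' v) \<and>
         N * T + C * (2 * pot E' l') \<le> C * (2 * pot E' l + N * 2) + N * 3)"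
      (is "\<And>M'. _ \<Longrightarrow> _ \<Longrightarrow> \<exists>T. runs W c _ M' (?Q T)")
  shows "\<exists>T. runs W (coloring_program N) T M (updated D E E' S l T)"
proof -
  obtain T where T: "runs W (coloring_program N) (C * (L + 1) + T) M (?Q T)"
    using runs_program[OF r k c branch] by (rule exE)
  have "updated D E E' S l (C * (L + 1) + T) M'" if Q: "?Q T M'" for M'
  proof -
    obtain l' where l': "recolored (D + K) (L + 1) E' S l' M'" "\<forall>v<n. \<not> overfull E' l' v \<and> \<not> underfull E' l' v"
      and paid: "N * T + C * (2 * pot E' l') \<le> C * (2 * pot E' l + N * 2) + N * 3"
      using Q by blast
    obtain S' where "invariant D E' S' l' M'" "card (color_changes S S') \<le> L + 1"
      using l' unfolding recolored_def invariant_def ready_def by blast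
    then show ?thesis using amortized_bound[OF pot paid] unfolding updated_def by blast
  qed
  from runs_conseq[OF T order.refl this] show ?thesis by (rule exI)
qed

lemma runs_insert:
  assumes inv: "invariant D E S l M" and g: "graph_on n E" and ab: "arboricity {..<n} E \<le> \<alpha>"
    and uv: "u < n" "v < n" "u \<noteq> v" "{u, v} \<notin> E"
  defines "E' \<equiv> insert {u, v} E"
  assumes ab': "arboricity {..<n} E' \<le> \<alpha>" and D: "\<And>x. x < n \<Longrightarrow> card (neighbors E' x) \<le> D"
  shows "\<exists>T. runs W (coloring_program N) T (input_update (Insert u v) M) (updated D E E' S l T)"
proof -
  let ?M = "input_update (Insert u v) M"
  have r: "represents S l ?M" and S: "dom S = E" "consistent S l" "colors_below (D + K) S"
    and calm: "\<And>v. v < n \<Longrightarrow> \<not> overfull E l v" "\<And>v. v < n \<Longrightarrow> \<not> underfull E l v"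
    using inv unfolding invariant_def represents_input by auto
  have g': "graph_on n E'" using g uv by (auto simp: graph_on_def E'_def)
  have lL: "l w < L" if "w < n" for w by (rule not_underfull_level_less[OF g ab calm(2) that])
  interpret level_rule n \<alpha> N H W "raise_cond N" "Var OLD \<oplus> Const 1" E' Suc "overfull E'"
    "\<lambda>l. \<forall>v<n. \<not> underfull E' l v" "pot E'" by (rule level_rule_raise[OF g' ab'])
  have "4 * L + 2 \<le> 10 * N * L + 2" using N_ge by (intro add_right_mono mult_right_mono) auto
  then have "N * (4 * L + 2) \<le> N * (10 * N * L + 2)" by (rule mult_left_mono) simp
  then have pot: "pot E' l \<le> pot E l + N * (10 * N * L + 2)"
    using potential_insert[of n "{u, v}" E \<alpha> N L l] g' unfolding E'_def by linarith
  have calm': "\<forall>w<n. \<not> underfull E' l w"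
    using underfull_insert[OF g'[unfolded E'_def]] calm(2) unfolding E'_def by blast
  have ends: "{w. w < n \<and> overfull E' l w} \<subseteq> {u, v}"
    using overfull_insert[OF g'[unfolded E'_def]] calm(1) unfolding E'_def by blast
  have word: "2 * pot E' l + N * 2 < W" using pot_word[OF g'] lL by (simp add: less_imp_le)
  show ?thesis
  proof (rule runs_program_updated[OF r, where k = 1 and c = "insert_edge N", OF _ _ _ pot])
    fix M1 assume r1: "ready S l M1" and "M1 INPUT = ?M INPUT"
    then have M1: "M1 INPUT 3 = u" "M1 INPUT 4 = v" by simp_all
    have "runs W color_edge (L * (600 * (H + 2) + 3) + 40) M1
        (\<lambda>M'. unchanged color_vars M1 M' \<and> recolored (D + K) (L + 1) E' S l M')"
      unfolding E'_def S(1)[symmetric]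
      by (rule runs_color_edge[OF r1 S(2,3) M1]) (use uv(4) g' D calm(1) lL in \<open>simp_all add: E'_def S(1)\<close>)
    from runs_phases[OF this calm' M1 uv(1,2) ends word]
    show "\<exists>T. runs W (insert_edge N) (C * L + 70 + T) M1 (\<lambda>M'. \<exists>l'. recolored (D + K) (L + 1) E' S l' M' \<and>
        (\<forall>v<n. \<not> overfull E' l' v \<and> \<not> underfull E' l' v) \<and>
        N * T + C * (2 * pot E' l') \<le> C * (2 * pot E' l + N * 2) + N * 3)"
      unfolding insert_edge_def by (rule ex_forward) (erule runs_conseq, rule order.refl, blast)
  qed simp_all
qed

lemma runs_delete:
  assumes inv: "invariant D E S l M" and g: "graph_on n E" and ab: "arboricity {..<n} E \<le> \<alpha>"
    and uv: "u < n" "v < n" "{u, v} \<in> E"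
  defines "E' \<equiv> E - {{u, v}}"
  shows "\<exists>T. runs W (coloring_program N) T (input_update (Delete u v) M) (updated D E E' S l T)"
proof -
  let ?M = "input_update (Delete u v) M"
  have r: "represents S l ?M" and S: "dom S = E" "consistent S l" "colors_below (D + K) S"
    and calm: "\<And>v. v < n \<Longrightarrow> \<not> overfull E l v" "\<And>v. v < n \<Longrightarrow> \<not> underfull E l v"
    using inv unfolding invariant_def represents_input by auto
  have g': "graph_on n E'" using g by (simp add: graph_on_def E'_def)
  have E: "insert {u, v} E' = E" using uv(3) by (auto simp: E'_def)
  have g_insert: "graph_on n (insert {u, v} E')" using g by (simp only: E)
  have lL: "l w \<le> L" if "w < n" for w using not_underfull_level_less[OF g ab calm(2) that] by simp
  interpret level_rule n \<alpha> N H W "lower_cond N" "Var OLD \<ominus> Const 1" E' "\<lambda>i. i - 1" "underfull E'"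
    "\<lambda>l. \<forall>v<n. \<not> overfull E' l v \<and> l v \<le> L" "pot E'" by (rule level_rule_lower[OF g'])
  have "pot E' l \<le> pot E l + 10 * (N ^ 2 * L)" using potential_delete[OF g_insert lL] unfolding E .
  then have pot: "pot E' l \<le> pot E l + N * (10 * N * L + 2)" by (simp add: power2_eq_square algebra_simps)
  have calm': "\<forall>w<n. \<not> overfull E' l w \<and> l w \<le> L"
    using overfull_delete[OF g_insert] calm(1) lL unfolding E by blast
  have ends: "{w. w < n \<and> underfull E' l w} \<subseteq> {u, v}"
    using underfull_delete[OF g_insert] calm(2) unfolding E by blast
  have word: "2 * pot E' l + N * 2 < W" using pot_word[OF g'] lL by simp
  show ?thesis
  proof (rule runs_program_updated[OF r, where k = 0 and c = "delete_edge N", OF _ _ _ pot])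
    fix M1 assume r1: "ready S l M1" and "M1 INPUT = ?M INPUT"
    then have M1: "M1 INPUT 3 = u" "M1 INPUT 4 = v" by simp_all
    have "runs W uncolor_edge (L * (600 * (H + 2) + 3) + 40) M1
        (\<lambda>M'. unchanged color_vars M1 M' \<and> recolored (D + K) (L + 1) E' S l M')"
      using runs_uncolor_edge[OF r1 S(2,3) M1] uv(3) unfolding S(1) E'_def by blast
    from runs_phases[OF this calm' M1 uv(1,2) ends word]
    show "\<exists>T. runs W (delete_edge N) (C * L + 70 + T) M1 (\<lambda>M'. \<exists>l'. recolored (D + K) (L + 1) E' S l' M' \<and>
        (\<forall>v<n. \<not> overfull E' l' v \<and> \<not> underfull E' l' v) \<and>
        N * T + C * (2 * pot E' l') \<le> C * (2 * pot E' l + N * 2) + N * 3)"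
      unfolding delete_edge_def by (rule ex_forward) (erule runs_conseq, rule order.refl, blast)
  qed simp_all
qed

end

section \<open>Update sequences\<close>

lemma graph_after_Suc:
  "i < length us \<Longrightarrow> graph_after us (Suc i) = apply_update (us ! i) (graph_after us i)"
  by (simp add: graph_after_def take_Suc_conv_app_nth)

lemma graph_on_graph_after:
  "valid_updates n \<alpha> us \<Longrightarrow> i \<le> length us \<Longrightarrow> graph_on n (graph_after us i)"
proof (induction i)
  case 0
  show ?case by (simp add: graph_after_def graph_on_def)
next
  case (Suc i)
  then have g: "graph_on n (graph_after us i)" and v: "valid_update n (graph_after us i) (us ! i)"
    by (auto simp: valid_updates_def)
  show ?case
  proof (cases "us ! i")
    case (Insert u v)
    then show ?thesis using g v Suc.prems(2) by (auto simp: graph_after_Suc graph_on_def)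
  next
    case (Delete u v)
    then show ?thesis using g Suc.prems(2) by (auto simp: graph_after_Suc graph_on_def)
  qed
qed

lemma card_neighbors_le_overall_max_degree:
  assumes "valid_updates n \<alpha> us" "i \<le> length us" "x < n"
  shows "card (neighbors (graph_after us i) x) \<le> overall_max_degree n us"
proof -
  have "card (neighbors (graph_after us i) x) = degree (graph_after us i) x"
    using degree_eq_card_neighbors[OF graph_on_graph_after[OF assms(1,2)]] by simp
  also have "\<dots> \<le> max_degree n (graph_after us i)"
    unfolding max_degree_def using assms(3) by (intro Max_ge) auto
  also have "\<dots> \<le> overall_max_degree n us"
    unfolding overall_max_degree_def using assms(2) by (intro Max_ge) auto
  finally show ?thesis .
qed

lemma valid_updates_nonempty:
  assumes v: "valid_updates n \<alpha> us" and ne: "us \<noteq> []"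
  shows "2 \<le> n" "1 \<le> \<alpha>" "1 \<le> overall_max_degree n us"
proof -
  have len: "0 < length us" "1 \<le> length us" using ne by (cases us; simp)+
  then have "valid_update n {} (us ! 0)" using v by (force simp: valid_updates_def graph_after_def)
  then obtain x y where u: "us ! 0 = Insert x y" and xy: "x < n" "y < n" "x \<noteq> y"
    by (cases "us ! 0") auto
  then show "2 \<le> n" by linarith
  have g: "graph_after us 1 = {{x, y}}"
    using graph_after_Suc[of 0 us] len u by (simp add: graph_after_def One_nat_def)
  have "induced_edges {{x, y}} {x, y} = {{x, y}}" by (auto simp: induced_edges_def)
  moreover have "card (induced_edges (graph_after us 1) {x, y}) \<le> \<alpha> * card {x, y}"
    by (rule card_induced_edges_le[OF graph_on_graph_after[OF v len(2)]])
      (use v len xy in \<open>auto simp: valid_updates_def\<close>)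
  ultimately show "1 \<le> \<alpha>" using g by (cases \<alpha>) auto
  have "neighbors {{x, y}} x = {y}" using xy by (auto simp: neighbors_def doubleton_eq_iff)
  then show "1 \<le> overall_max_degree n us"
    using card_neighbors_le_overall_max_degree[OF v len(2) xy(1)] unfolding g by simp
qed

lemma is_run_exists:
  assumes init: "I 0 (initial_memory n \<alpha>) x0"
    and step: "\<And>i M x. i < length us \<Longrightarrow> I i M x \<Longrightarrow>
      \<exists>t M' x'. exec W p (input_update (us ! i) M) t M' \<and> I (Suc i) M' x' \<and> R i x t x'"
  obtains M t x where "is_run W p n \<alpha> us M t" "x 0 = x0" "\<And>i. i \<le> length us \<Longrightarrow> I i (M i) (x i)"
    "\<And>i. i < length us \<Longrightarrow> R i (x i) (t i) (x (Suc i))"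
proof -
  let ?P = "\<lambda>i y. (i = 0 \<longrightarrow> y = (initial_memory n \<alpha>, x0)) \<and> (i \<le> length us \<longrightarrow> I i (fst y) (snd y))"
  let ?Q = "\<lambda>i y z. \<exists>t. i < length us \<longrightarrow>
    exec W p (input_update (us ! i) (fst y)) t (fst z) \<and> R i (snd y) t (snd z)"
  have "\<exists>f. \<forall>i. ?P i (f i) \<and> ?Q i (f i) (f (Suc i))"
  proof (rule dependent_nat_choice)
    show "\<exists>y. ?P 0 y" using init by simp
    fix y i assume "?P i y"
    then show "\<exists>z. ?P (Suc i) z \<and> ?Q i y z" using step[of i "fst y" "snd y"] by (cases "i < length us") auto
  qed
  then obtain f where f: "\<forall>i. ?P i (f i) \<and> ?Q i (f i) (f (Suc i))" by (rule exE)
  then have "\<forall>i. ?Q i (f i) (f (Suc i))" by simp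
  then obtain t where "\<forall>i. i < length us \<longrightarrow>
      exec W p (input_update (us ! i) (fst (f i))) (t i) (fst (f (Suc i))) \<and>
      R i (snd (f i)) (t i) (snd (f (Suc i)))"
    unfolding choice_iff by (rule exE)
  then show thesis
    using f by (intro that[of "\<lambda>i. fst (f i)" t "\<lambda>i. snd (f i)"]) (simp_all add: is_run_def)
qed

lemma sum_le_amortized:
  fixes t p :: "nat \<Rightarrow> nat"
  assumes "\<And>i. i < k \<Longrightarrow> t i + p (Suc i) \<le> p i + c"
  shows "(\<Sum>i<k. t i) + p k \<le> p 0 + k * c"
  using assms
proof (induction k)
  case (Suc k)
  then show ?case using Suc.prems[of k] by fastforce
qed simp

context coloring_ram
begin

lemma stored_coloring_represented:
  assumes r: "represents S l M"
  shows "stored_coloring n (dom S) M = (\<lambda>e. map_option (Suc \<circ> fst) (S e))"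
proof
  fix e
  show "stored_coloring n (dom S) M e = map_option (Suc \<circ> fst) (S e)"
  proof (cases "S e")
    case None
    then show ?thesis by (simp add: stored_coloring_def domIff)
  next
    case (Some x)
    obtain c j where S: "S e = Some (c, j)" using Some by (cases x) simp
    then have "e \<in> dom S" by blast
    moreover have "graph_on n (dom S)" using r by (simp add: represents_def valid_state_def)
    ultimately obtain u v where "e = {u, v}" "u \<noteq> v" unfolding graph_on_def by blast
    then have "e = {Min e, Max e}" by (auto simp: min_def max_def)
    then have "S {Min e, Max e} = Some (c, j)" using S by simp
    then have "M COLOR (Min e * n + Max e) = c + 1"
      using r unfolding represents_def tables_at_def by blast
    then show ?thesis using S \<open>e \<in> dom S\<close> by (simp add: stored_coloring_def)
  qed
qed

lemma invariant_proper:
  assumes inv: "invariant D E S l M" and X: "real (D + K) \<le> X"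
  shows "proper_edge_coloring X E (stored_coloring n E M)"
proof -
  have E: "dom S = E" and S: "valid_state S" and below: "colors_below (D + K) S"
    using inv by (auto simp: invariant_def represents_def)
  have col: "stored_coloring n E M = (\<lambda>e. map_option (Suc \<circ> fst) (S e))"
    using inv stored_coloring_represented by (auto simp: invariant_def)
  show ?thesis unfolding proper_edge_coloring_def col
  proof (intro conjI ballI impI)
    show "dom (\<lambda>e. map_option (Suc \<circ> fst) (S e)) = E" using E by (auto simp: dom_def)
    show "ran (\<lambda>e. map_option (Suc \<circ> fst) (S e)) \<subseteq> {1..nat \<lfloor>X\<rfloor>}"
    proof
      fix k assume "k \<in> ran (\<lambda>e. map_option (Suc \<circ> fst) (S e))"
      then obtain e c j where "S e = Some (c, j)" and k: "k = Suc c" by (auto simp: ran_def)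
      then have "real k \<le> X" using below X unfolding colors_below_def by fastforce
      then show "k \<in> {1..nat \<lfloor>X\<rfloor>}" using k by (simp add: le_nat_floor)
    qed
    fix e f assume e: "e \<in> E" and f: "f \<in> E" and ef: "e \<noteq> f \<and> e \<inter> f \<noteq> {}"
    then obtain v where v: "v \<in> e" "v \<in> f" by blast
    have "\<exists>w. e = {v, w}" if "e \<in> E" "v \<in> e" for e
    proof -
      obtain a b where "e = {a, b}" using S E \<open>e \<in> E\<close> unfolding valid_state_def graph_on_def by blast
      then show ?thesis using \<open>v \<in> e\<close> by (auto simp: insert_commute)
    qed
    then obtain w w' where w: "e = {v, w}" "f = {v, w'}" using e f v by meson
    obtain c j c' j' where c: "S e = Some (c, j)" "S f = Some (c', j')" using e f E by (auto simp: dom_def)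
    have "c \<noteq> c'" using S ef c unfolding w valid_state_def by blast
    then show "map_option (Suc \<circ> fst) (S e) \<noteq> map_option (Suc \<circ> fst) (S f)" using c by simp
  qed
qed

lemma invariant_recourse:
  assumes "invariant D E S l M" "invariant D E' S' l' M'"
  shows "recourse (stored_coloring n E M) (stored_coloring n E' M') = card (color_changes S S')"
proof -
  have "stored_coloring n E M = (\<lambda>e. map_option (Suc \<circ> fst) (S e))"
    "stored_coloring n E' M' = (\<lambda>e. map_option (Suc \<circ> fst) (S' e))"
    using stored_coloring_represented assms by (auto simp: invariant_def)
  moreover have "map_option (Suc \<circ> fst) x = map_option (Suc \<circ> fst) y \<longleftrightarrow> map_option fst x = map_option fst y"
    for x y :: "(nat \<times> nat) option" by (cases x; cases y) auto
  ultimately show ?thesis by (simp add: recourse_def color_changes_def)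
qed

lemma invariant_initial: "invariant D {} Map.empty (\<lambda>_. 0) (initial_memory n \<alpha>)"
proof -
  have "colors Map.empty v j = {}" for v j by (simp add: colors_def)
  moreover have "deg_above {} l v i = 0" for l v i by (simp add: deg_above_def neighbors_def)
  ultimately show ?thesis using full_bounds(5)
    by (simp add: invariant_def represents_def valid_state_def graph_on_def tables_at_def trees_at_def
        tree_at_def tree_count_def initial_memory_def consistent_def colors_below_def overfull_def underfull_def)
qed

lemma runs_update:
  assumes v: "valid_updates n \<alpha> us" and i: "i < length us"
  defines "D \<equiv> overall_max_degree n us" and "G \<equiv> graph_after us"
  assumes inv: "invariant D (G i) S l M"
  shows "\<exists>T. runs W (coloring_program N) T (input_update (us ! i) M) (updated D (G i) (G (Suc i)) S l T)"
proof -
  have g: "graph_on n (G i)" using graph_on_graph_after[OF v] i by (simp add: G_def)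
  have a: "arboricity {..<n} (G i) \<le> \<alpha>" "arboricity {..<n} (G (Suc i)) \<le> \<alpha>"
    and u: "valid_update n (G i) (us ! i)" using v i by (auto simp: valid_updates_def G_def)
  have deg: "card (neighbors (G (Suc i)) x) \<le> D" if "x < n" for x
    using card_neighbors_le_overall_max_degree[OF v _ that, of "Suc i"] i by (simp add: D_def G_def)
  show ?thesis
  proof (cases "us ! i")
    case (Insert x y)
    then have G: "G (Suc i) = insert {x, y} (G i)" using i by (simp add: graph_after_Suc G_def)
    show ?thesis unfolding G Insert
      by (rule runs_insert[OF inv g a(1)]) (use u Insert a(2) deg G in auto)
  next
    case (Delete x y)
    then have G: "G (Suc i) = G i - {{x, y}}" using i by (simp add: graph_after_Suc G_def)
    show ?thesis unfolding G Delete
      by (rule runs_delete[OF inv g a(1)]) (use u Delete in auto)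
  qed
qed

definition update_step :: "update list \<Rightarrow> nat \<Rightarrow> state \<times> (nat \<Rightarrow> nat) \<Rightarrow> nat \<Rightarrow> state \<times> (nat \<Rightarrow> nat) \<Rightarrow> bool" where
  "update_step us i x t x' \<longleftrightarrow> card (color_changes (fst x) (fst x')) \<le> L + 1 \<and>
    N * t + 2 * C * pot (graph_after us (Suc i)) (snd x') \<le>
      2 * C * pot (graph_after us i) (snd x) + N * (C * (50 * N * L))"

lemma update_step_exists:
  assumes v: "valid_updates n \<alpha> us" and i: "i < length us"
  defines "D \<equiv> overall_max_degree n us" and "G \<equiv> graph_after us"
  assumes inv: "invariant D (G i) (fst x) (snd x) M"
  shows "\<exists>t M' x'. exec W (coloring_program N) (input_update (us ! i) M) t M' \<and>
    invariant D (G (Suc i)) (fst x') (snd x') M' \<and> update_step us i x t x'"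
proof -
  obtain T t M' where ex: "exec W (coloring_program N) (input_update (us ! i) M) t M'" "t \<le> T"
    and upd: "updated D (G i) (G (Suc i)) (fst x) (snd x) T M'"
    using runs_update[OF v i] inv unfolding D_def G_def runs_def by blast
  obtain S' l' where "invariant D (G (Suc i)) S' l' M'" "card (color_changes (fst x) S') \<le> L + 1"
    and "N * T + 2 * C * pot (G (Suc i)) l' \<le> 2 * C * pot (G i) (snd x) + N * (C * (50 * N * L))"
    using upd unfolding updated_def by blast
  moreover have "N * t \<le> N * T" using ex(2) by (rule mult_left_mono) simp
  ultimately have "invariant D (G (Suc i)) S' l' M'" "update_step us i x t (S', l')"
    unfolding update_step_def G_def fst_conv snd_conv by linarith+
  then show ?thesis using ex(1) by fastforce
qed

lemma coloring_run_exists: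
  assumes v: "valid_updates n \<alpha> us"
  defines "D \<equiv> overall_max_degree n us" and "\<chi> \<equiv> \<lambda>M i. stored_coloring n (graph_after us i) (M i)"
  obtains M t where "is_run W (coloring_program N) n \<alpha> us M t"
    "\<And>i X. i \<le> length us \<Longrightarrow> real (D + K) \<le> X \<Longrightarrow> proper_edge_coloring X (graph_after us i) (\<chi> M i)"
    "\<And>i. i < length us \<Longrightarrow> recourse (\<chi> M i) (\<chi> M (Suc i)) \<le> L + 1"
    "(\<Sum>i<length us. t i) \<le> length us * (C * (50 * N * L))"
proof -
  let ?G = "graph_after us" and ?I = "\<lambda>i M x. invariant D (graph_after us i) (fst x) (snd x) M"
  have init: "?I 0 (initial_memory n \<alpha>) (Map.empty, \<lambda>_. 0)"
    using invariant_initial by (simp add: graph_after_def)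
  obtain M t x where run: "is_run W (coloring_program N) n \<alpha> us M t" and x0: "x 0 = (Map.empty, \<lambda>_. 0)"
    and inv: "\<And>i. i \<le> length us \<Longrightarrow> ?I i (M i) (x i)"
    and step: "\<And>i. i < length us \<Longrightarrow> update_step us i (x i) (t i) (x (Suc i))"
    by (rule is_run_exists[where I = ?I and R = "update_step us", OF init
          update_step_exists[OF v, folded D_def]]) blast+
  have "(\<Sum>i<length us. N * t i) + 2 * C * pot (?G (length us)) (snd (x (length us))) \<le>
      2 * C * pot (?G 0) (snd (x 0)) + length us * (N * (C * (50 * N * L)))"
    by (rule sum_le_amortized) (use step in \<open>auto simp: update_step_def\<close>)
  moreover have "pot (?G 0) (snd (x 0)) = 0" by (simp add: x0 graph_after_def potential_def node_pot_def)
  ultimately have "N * (\<Sum>i<length us. t i) \<le> N * (length us * (C * (50 * N * L)))"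
    by (simp add: sum_distrib_left mult.left_commute)
  then have time: "(\<Sum>i<length us. t i) \<le> length us * (C * (50 * N * L))" using N_ge by simp
  have rec: "recourse (\<chi> M i) (\<chi> M (Suc i)) \<le> L + 1" if "i < length us" for i
    using invariant_recourse inv[of i] inv[of "Suc i"] step[OF that] that unfolding update_step_def \<chi>_def by simp
  have proper: "proper_edge_coloring X (?G i) (\<chi> M i)" if "i \<le> length us" "real (D + K) \<le> X" for i X
    using invariant_proper[OF _ that(2)] inv[OF that(1)] unfolding \<chi>_def by blast
  show thesis by (rule that[OF run proper rec time])
qed

lemma K_le:
  assumes "5 \<le> \<epsilon> * real N"
  shows "real K \<le> (4 + \<epsilon>) * real \<alpha>"
proof -
  have "K * N \<le> (4 * N + 5) * \<alpha>" unfolding K_def by (rule div_times_less_eq_dividend)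
  then have "real (K * N) \<le> real ((4 * N + 5) * \<alpha>)" by (simp only: of_nat_le_iff)
  also have "\<dots> = (4 * real N + 5) * real \<alpha>" by simp
  also have "\<dots> \<le> (4 * real N + \<epsilon> * real N) * real \<alpha>" using assms by (intro mult_right_mono) auto
  also have "\<dots> = (4 + \<epsilon>) * real \<alpha> * real N" by (simp add: algebra_simps)
  finally show ?thesis using N_ge by simp
qed

lemma one_le_log_n: "1 \<le> log 2 (real n)"
  using n_ge by (simp add: le_log_iff)

lemma H_le_log_n: "real H \<le> 3 * log 2 (real n)"
proof -
  have "real (2 ^ H) < real (4 * n)" using H_le by (simp only: of_nat_less_iff)
  then have "2 powr real H < 4 * real n" by (simp add: powr_realpow)
  then have "real H < log 2 (4 * real n)" using n_ge by (simp add: less_log_iff)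
  also have "\<dots> = log 2 (2 ^ 2) + log 2 (real n)" using n_ge by (simp add: log_mult)
  also have "\<dots> = 2 + log 2 (real n)" by (subst log_pow_cancel) simp_all
  finally show ?thesis using one_le_log_n by linarith
qed

lemma L_le:
  assumes "0 < \<epsilon>" "real N \<le> 10 / \<epsilon>"
  shows "real L \<le> 60 * (log 2 (real n) / \<epsilon>)"
proof -
  have "real L = 2 * (real N * real H)" by (simp add: L_def)
  also have "\<dots> \<le> 2 * ((10 / \<epsilon>) * (3 * log 2 (real n)))"
    using assms by (intro mult_left_mono mult_mono H_le_log_n) auto
  finally show ?thesis by simp
qed

lemma recourse_bound:
  assumes "0 < \<epsilon>" "\<epsilon> < 1" "real N \<le> 10 / \<epsilon>"
  shows "real (L + 1) \<le> 100 * (log 2 (real n) / \<epsilon>)"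
proof -
  have "1 * \<epsilon> \<le> log 2 (real n)" using one_le_log_n assms(2) by simp
  then have "1 \<le> log 2 (real n) / \<epsilon>" using assms(1) by (simp only: pos_le_divide_eq)
  then show ?thesis using L_le[OF assms(1,3)] by simp
qed

lemma time_bound:
  assumes \<epsilon>: "0 < \<epsilon>" "real N \<le> 10 / \<epsilon>" and T: "T \<le> m * (C * (50 * N * L))" and d: "1 \<le> d"
  shows "real T \<le> 100000000 * (real m * ((log 2 (real n))\<^sup>2 * d / \<epsilon>\<^sup>2))"
proof -
  let ?lg = "log 2 (real n)"
  have "real C = 600 * real H + 1320" by (simp add: C_def)
  also have "\<dots> \<le> 3120 * ?lg" using H_le_log_n one_le_log_n by linarith
  finally have C: "real C \<le> 3120 * ?lg" .
  have "real T \<le> real (m * (C * (50 * N * L)))" using T by (simp only: of_nat_le_iff)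
  also have "\<dots> = real m * (real C * (50 * real N * real L))" by simp
  also have "\<dots> \<le> real m * ((3120 * ?lg) * (50 * (10 / \<epsilon>) * (60 * (?lg / \<epsilon>))))"
    by (intro mult_left_mono mult_mono C) (use \<epsilon> L_le[OF \<epsilon>] one_le_log_n in auto)
  also have "\<dots> = 93600000 * (real m * (?lg\<^sup>2 * 1 / \<epsilon>\<^sup>2))" by (simp add: power2_eq_square)
  also have "\<dots> \<le> 100000000 * (real m * (?lg\<^sup>2 * d / \<epsilon>\<^sup>2))"
    by (intro mult_mono mult_left_mono divide_right_mono d) simp_all
  finally show ?thesis .
qed

lemma coloring_run_bounds:
  assumes v: "valid_updates n \<alpha> us" "us \<noteq> []"
    and \<epsilon>: "0 < \<epsilon>" "\<epsilon> < 1" and N: "5 \<le> \<epsilon> * real N" "real N \<le> 10 / \<epsilon>"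
  defines "D \<equiv> overall_max_degree n us" and "\<chi> \<equiv> \<lambda>M i. stored_coloring n (graph_after us i) (M i)"
  shows "\<exists>M t. is_run W (coloring_program N) n \<alpha> us M t \<and>
    (\<forall>i\<le>length us. proper_edge_coloring (real D + (4 + \<epsilon>) * real \<alpha>) (graph_after us i) (\<chi> M i)) \<and>
    (\<forall>i<length us. real (recourse (\<chi> M i) (\<chi> M (Suc i))) \<le> 100 * (log 2 (real n) / \<epsilon>)) \<and>
    real (\<Sum>i<length us. t i) \<le>
      100000000 * (real (length us) * ((log 2 (real n))\<^sup>2 * log 2 (real D + 1) / \<epsilon>\<^sup>2))"
proof -
  obtain M t where run: "is_run W (coloring_program N) n \<alpha> us M t"
    and proper: "\<And>i X. i \<le> length us \<Longrightarrow> real (D + K) \<le> X \<Longrightarrow> proper_edge_coloring X (graph_after us i) (\<chi> M i)"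
    and rec: "\<And>i. i < length us \<Longrightarrow> recourse (\<chi> M i) (\<chi> M (Suc i)) \<le> L + 1"
    and time: "(\<Sum>i<length us. t i) \<le> length us * (C * (50 * N * L))"
    unfolding D_def \<chi>_def by (rule coloring_run_exists[OF v(1)]) blast
  have "1 \<le> log 2 (real D + 1)" using valid_updates_nonempty(3)[OF v] by (simp add: le_log_iff D_def)
  note time = time_bound[OF \<epsilon>(1) N(2) time this]
  have rec: "real (recourse (\<chi> M i) (\<chi> M (Suc i))) \<le> 100 * (log 2 (real n) / \<epsilon>)" if "i < length us" for i
    using rec[OF that] recourse_bound[OF \<epsilon> N(2)] by linarith
  have "real (D + K) \<le> real D + (4 + \<epsilon>) * real \<alpha>" using K_le[OF N(1)] by simp
  then show ?thesis using run proper rec time by blast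
qed

end

lemma coloring_ram_exists:
  fixes n \<alpha> q :: nat
  assumes "2 \<le> n" "1 \<le> \<alpha>" "2 \<le> q"
  obtains H where "coloring_ram n \<alpha> (5 * q) H ((n + \<alpha> + q) ^ 16)"
proof -
  define A where "A = n + \<alpha> + q"
  then have A: "5 \<le> A" "n \<le> A" "\<alpha> \<le> A" "q \<le> A" using assms by simp_all
  obtain h where h: "2 ^ h < 2 * n" "2 * n \<le> 2 ^ Suc h"
    using ex_power_ivl2[of 2 "2 * n"] assms(1) unfolding Suc_eq_plus1 by auto
  have H: "2 ^ Suc h < 4 * n" using h(1) by simp
  then have "4 * (5 * q) * 2 ^ Suc h \<le> 4 * (5 * q) * (4 * n)" by (intro mult_left_mono) simp_all
  also have "\<dots> = 5 * (4 * 4 * (q * n))" by simp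
  also have "\<dots> \<le> A * (A * A * (A * A))" using A by (intro mult_mono) simp_all
  also have "\<dots> = A ^ 5" by algebra
  finally have "(4 * (5 * q) * 2 ^ Suc h) ^ 3 \<le> (A ^ 5) ^ 3" by (rule power_mono) simp
  then have "\<alpha> * (4 * (5 * q) * 2 ^ Suc h) ^ 3 \<le> A * (A ^ 5) ^ 3" using A(3) by (intro mult_mono) simp_all
  also have "\<dots> = A ^ 16" by (simp flip: power_mult power_Suc)
  finally have "coloring_ram n \<alpha> (5 * q) (Suc h) (A ^ 16)"
    using assms h(2) H by (simp add: coloring_ram_def)
  then show thesis unfolding A_def by (rule that)
qed

lemma nat_ceiling_inverse_bounds:
  fixes \<epsilon> :: real
  assumes "0 < \<epsilon>" "\<epsilon> < 1"
  defines "q \<equiv> nat \<lceil>1 / \<epsilon>\<rceil>"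
  shows "2 \<le> q" "5 \<le> \<epsilon> * real (5 * q)" "real (5 * q) \<le> 10 / \<epsilon>"
proof -
  have inv: "1 < 1 / \<epsilon>" using assms(1,2) by simp
  then have "real q = real_of_int \<lceil>1 / \<epsilon>\<rceil>" unfolding q_def by simp
  then have q: "1 / \<epsilon> \<le> real q" "real q < 1 / \<epsilon> + 1" by linarith+
  show "2 \<le> q" using q(1) inv by linarith
  show "5 \<le> \<epsilon> * real (5 * q)" using q(1) assms(1) by (simp add: field_simps)
  have "real (5 * q) \<le> 5 * (2 * (1 / \<epsilon>))" using q(2) inv by simp
  then show "real (5 * q) \<le> 10 / \<epsilon>" by simp
qed

theorem theorem3p1:
  "\<exists>(c_word::nat) (c_rec::real) (c_time::real). \<forall>\<epsilon>::real. 0 < \<epsilon> \<and> \<epsilon> < 1 \<longrightarrow>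
     (\<exists>p::com. \<forall>(n::nat) (\<alpha>::nat) (us::update list). valid_updates n \<alpha> us \<longrightarrow>
       (\<exists>(M::nat \<Rightarrow> memory) (t::nat \<Rightarrow> nat).
          is_run ((n + \<alpha> + nat \<lceil>1 / \<epsilon>\<rceil>) ^ c_word) p n \<alpha> us M t \<and>
          (\<forall>i \<le> length us.
             proper_edge_coloring (real (overall_max_degree n us) + (4 + \<epsilon>) * real \<alpha>)
               (graph_after us i) (stored_coloring n (graph_after us i) (M i))) \<and>
          (\<forall>i < length us.
             real (recourse (stored_coloring n (graph_after us i) (M i))
                      (stored_coloring n (graph_after us (Suc i)) (M (Suc i))))
               \<le> c_rec * (log 2 (real n) / \<epsilon>)) \<and>
          real (\<Sum>i<length us. t i)
            \<le> c_time * (real (length us) *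
                 ((log 2 (real n))\<^sup>2 * log 2 (real (overall_max_degree n us) + 1) / \<epsilon>\<^sup>2))))"
proof (rule exI[of _ 16], rule exI[of _ 100], rule exI[of _ 100000000], intro allI impI, elim conjE, goal_cases)
  case \<epsilon>: (1 \<epsilon>)
  let ?q = "nat \<lceil>1 / \<epsilon>\<rceil>"
  note q = nat_ceiling_inverse_bounds[OF \<epsilon>]
  show ?case
  proof (rule exI[of _ "coloring_program (5 * ?q)"], intro allI impI, goal_cases)
    case v: (1 n \<alpha> us)
    show ?case
    proof (cases "us = []")
      case True
      then show ?thesis
        by (intro exI[of _ "\<lambda>_. initial_memory n \<alpha>"] exI[of _ "\<lambda>_. 0"])
          (simp add: is_run_def graph_after_def proper_edge_coloring_def stored_coloring_def)
    next
      case False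
      note ne = valid_updates_nonempty[OF v False]
      obtain H where "coloring_ram n \<alpha> (5 * ?q) H ((n + \<alpha> + ?q) ^ 16)"
        by (rule coloring_ram_exists[OF ne(1,2) q(1)])
      then interpret coloring_ram n \<alpha> "5 * ?q" H "(n + \<alpha> + ?q) ^ 16" .
      show ?thesis by (rule coloring_run_bounds[OF v False \<epsilon> q(2,3)])
    qed
  qed
qed

end
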